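(* Let $g\in\mathcal{C}^2(\mathbb{R})$ be bounded and strictly increasing, with $g(0)=0$, strictly concave on $(0,+\infty)$ and strictly convex on $(-\infty,0)$; put $g_\pm=\lim_{s\to\pm\infty}g(s)$. Let $p:\mathbb{R}\to\mathbb{R}$ be continuous and bounded, with asymptotic average $A(p)$ satisfying $g_-<A(p)<g_+$. Then there exists a sequence $(u_m)$ of solutions of $$\ddot u(t)+g(u(t))=p(t)$$ defined on the whole of $\mathbb{R}$, with $u_m,\dot u_m\in L^\infty(\mathbb{R})$ for every $m$ and $\|u_m\|_\infty\to\infty$ as $m\to\infty$. Moreover, each $u_m$ has infinitely many zeros in $\mathbb{R}$.
   Context: $p$ has asymptotic average $A(p)\in\mathbb{R}$ if $\lim_{T\to+\infty}\frac1T\int_t^{t+T}p(s)\,ds=A(p)$ uniformly in $t\in\mathbb{R}$. *)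

theory Defs
  imports "HOL-Analysis.Analysis" "HOL-Probability.Essential_Supremum"
begin

definition C2_real :: "(real \<Rightarrow> real) \<Rightarrow> bool" where
  "C2_real g \<longleftrightarrow>
     g differentiable_on UNIV \<and> deriv g differentiable_on UNIV \<and>
     continuous_on UNIV (deriv (deriv g))"

definition strictly_convex_on :: "real set \<Rightarrow> (real \<Rightarrow> real) \<Rightarrow> bool" where
  "strictly_convex_on S f \<longleftrightarrow> convex S \<and>
     (\<forall>x\<in>S. \<forall>y\<in>S. \<forall>l. x \<noteq> y \<longrightarrow> 0 < l \<longrightarrow> l < 1 \<longrightarrow>
        f ((1 - l) * x + l * y) < (1 - l) * f x + l * f y)"

definition strictly_concave_on :: "real set \<Rightarrow> (real \<Rightarrow> real) \<Rightarrow> bool" where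
  "strictly_concave_on S f \<longleftrightarrow> strictly_convex_on S (\<lambda>x. - f x)"

text \<open>The limit is taken as \<open>T\<close> tends to infinity, uniformly in the base point \<open>t\<close>. The
  Henstock-Kurzweil integral \<^const>\<open>integral\<close> agrees with the Riemann integral for the continuous
  functions this is applied to.\<close>
definition has_asymptotic_average :: "(real \<Rightarrow> real) \<Rightarrow> real \<Rightarrow> bool" where
  "has_asymptotic_average p A \<longleftrightarrow>
     uniform_limit UNIV (\<lambda>T t. (1 / T) * integral {t..t + T} p) (\<lambda>_. A) at_top"

definition Linf_norm :: "(real \<Rightarrow> real) \<Rightarrow> ereal" where
  "Linf_norm u = esssup lebesgue (\<lambda>t. ereal \<bar>u t\<bar>)"

definition in_Linf :: "(real \<Rightarrow> real) \<Rightarrow> bool" where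
  "in_Linf u \<longleftrightarrow> u \<in> borel_measurable lebesgue \<and> Linf_norm u < \<infinity>"

definition is_global_solution :: "(real \<Rightarrow> real) \<Rightarrow> (real \<Rightarrow> real) \<Rightarrow> (real \<Rightarrow> real) \<Rightarrow> bool" where
  "is_global_solution g p u \<longleftrightarrow>
     u differentiable_on UNIV \<and> deriv u differentiable_on UNIV \<and>
     (\<forall>t. deriv (deriv u) t + g (u t) = p t)"

end

theory Submission
  imports Defs
begin

text \<open>
  Solutions of \<open>u'' + g(u) = p\<close> are glued from arcs of constant sign between consecutive zeros. On a long
  interval \<open>[s, t]\<close> a contraction argument for the Green operator gives exactly one positive Dirichlet
  solution that dominates a fixed multiple of \<open>(x - s)(t - x)\<close>; with \<open>a = g\<^sub>+ - A\<close> its end velocities are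
  \<open>a(t - s)/2\<close> to leading order and its action \<open>\<phi>(s, t)\<close> is \<open>- a\<^sup>2(t - s)\<^sup>3/24\<close> to leading order, because \<open>p\<close>
  only acts through its average on long intervals. The reflection \<open>u \<mapsto> -u\<close> gives the negative arcs.

  Since \<open>\<partial>\<phi>/\<partial>t = - u'(t)\<^sup>2/2\<close> and \<open>\<partial>\<phi>/\<partial>s = u'(s)\<^sup>2/2\<close>, a chain of zeros that is critical for the sum of the actions
  glues to a solution. On \<open>[-X, X]\<close> one maximises this sum minus a constant \<open>C\<close> per arc, over chains with
  a free number of arcs and with normalised gaps restricted to \<open>[\<tau>, 5\<tau>]\<close>. The action is cubic and \<open>C\<close> is of
  order \<open>\<tau>\<^sup>3\<close>, so a maximiser cannot touch the constraint: otherwise neighbouring gaps would all be nearly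
  extremal, and splitting two arcs into four, or merging four into two, would increase the sum. Letting
  \<open>X\<close> tend to infinity gives a bi-infinite chain and a bounded solution of size of order \<open>\<tau>\<^sup>2\<close>.
\<close>

section \<open>Second primitives and Green representation\<close>

text \<open>Arcs exist only on intervals longer than a threshold, so the gaps must be constrained
  from below, and a maximiser that touches a constraint need not be critical. Since the action
  behaves like minus a cube, its sum alone would favour many short gaps and press against the lower
  end; the price \<open>C\<close> per arc counteracts this. A pair of arcs of normalised gap
  \<open>l\<close> takes the time \<open>l * \<kappa>\<close> and loses about
  \<open>(l ^ 3 * \<kappa> / 24 + 2 * C) / (l * \<kappa>)\<close> per unit of time, which is minimal
  at \<open>l ^ 3 = 24 * C / \<kappa>\<close>. The chosen \<open>C\<close> puts this near
  \<open>2.7 * \<tau>\<close>, well inside the admissible range. Only leading orders are used, with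
  fixed relative errors: one tenth for the action and one fiftieth for the end speeds. The
  competitors are therefore chosen with wide numerical margins. They change the number of arcs by
  two, so that all later arcs keep their signs. Criticality only equates the squares of the speeds
  on the two sides of a zero; the speeds agree because both are positive.\<close>

lemma FTC_real_within:
  fixes F f :: "real \<Rightarrow> real"
  assumes "a \<le> b" "\<And>x. x \<in> {a..b} \<Longrightarrow> (F has_real_derivative f x) (at x within {a..b})"
  shows "(f has_integral (F b - F a)) {a..b}"
  using assms
  by (intro fundamental_theorem_of_calculus) (auto simp: has_real_derivative_iff_has_vector_derivative)

text \<open>Derivatives are taken within \<open>{s..t}\<close>, hence one-sided at the ends, because
  an arc is known only on its own interval and is glued to its neighbours later. Carrying
  \<open>y'\<close> explicitly gives access to the end speeds.\<close>

definition second_primitive :: "real \<Rightarrow> real \<Rightarrow> (real \<Rightarrow> real) \<Rightarrow> (real \<Rightarrow> real) \<Rightarrow> (real \<Rightarrow> real) \<Rightarrow> bool" where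
  "second_primitive s t h y y' \<longleftrightarrow>
     (\<forall>x\<in>{s..t}. (y has_real_derivative y' x) (at x within {s..t})) \<and>
     (\<forall>x\<in>{s..t}. (y' has_real_derivative h x) (at x within {s..t}))"

lemma second_primitiveD:
  assumes "second_primitive s t h y y'" "x \<in> {s..t}"
  shows "(y has_real_derivative y' x) (at x within {s..t})"
    "(y' has_real_derivative h x) (at x within {s..t})"
  using assms unfolding second_primitive_def by auto

lemma second_primitive_subinterval:
  assumes "second_primitive s t h y y'" "{a..b} \<subseteq> {s..t}"
  shows "second_primitive a b h y y'"
  using assms unfolding second_primitive_def by (meson DERIV_subset subsetD)

lemma second_primitive_continuous_on:
  assumes "second_primitive s t h y y'"
  shows "continuous_on {s..t} y" "continuous_on {s..t} y'"
  using assms unfolding second_primitive_def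
  by (auto intro!: DERIV_continuous_on)

lemma second_primitive_diff:
  assumes "second_primitive s t h y y'" "second_primitive s t k z z'"
  shows "second_primitive s t (\<lambda>x. h x - k x) (\<lambda>x. y x - z x) (\<lambda>x. y' x - z' x)"
  using assms unfolding second_primitive_def by (auto intro!: derivative_intros)

lemma second_primitive_slope_bounds:
  assumes y: "second_primitive s t h y y'" and B: "\<And>x. x \<in> {s..t} \<Longrightarrow> \<bar>h x\<bar> \<le> B"
    and "x \<in> {s..t}" "z \<in> {s..t}"
  shows "\<bar>y' x - y' z\<bar> \<le> B * \<bar>x - z\<bar>"
proof -
  have "norm (y' x - y' z) \<le> B * norm (x - z)"
    by (rule field_differentiable_bound[of "{s..t}" y' h])
      (use assms second_primitiveD[OF y] in auto)
  then show ?thesis by simp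
qed

lemma second_primitive_value_bounds:
  assumes y: "second_primitive s t h y y'" and B: "\<And>x. x \<in> {s..t} \<Longrightarrow> \<bar>y' x\<bar> \<le> B"
    and "x \<in> {s..t}" "z \<in> {s..t}"
  shows "\<bar>y x - y z\<bar> \<le> B * \<bar>x - z\<bar>"
proof -
  have "norm (y x - y z) \<le> B * norm (x - z)"
    by (rule field_differentiable_bound[of "{s..t}" y y'])
      (use assms second_primitiveD[OF y] in auto)
  then show ?thesis by simp
qed

lemma second_primitive_mvt:
  assumes y: "second_primitive s t h y y'" and ab: "a \<in> {s..t}" "b \<in> {s..t}" "a \<le> b"
  obtains \<xi> where "\<xi> \<in> {a..b}" "y b - y a = (b - a) * y' \<xi>"
proof -
  have "\<exists>\<xi>\<in>{a..b}. y b - y a = y' \<xi> * (b - a)"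
    using ab second_primitiveD(1)[OF second_primitive_subinterval[OF y, of a b]]
    by (intro mvt_very_simple[where f' = "\<lambda>x. (*) (y' x)"]) (auto simp: has_field_derivative_def)
  then show ?thesis using that by (auto simp: mult.commute)
qed

lemma dirichlet_second_primitive_exists:
  fixes h :: "real \<Rightarrow> real"
  assumes st: "s < t" and h: "continuous_on {s..t} h"
  obtains y y' where "second_primitive s t h y y'" "y s = 0" "y t = 0"
proof
  define H where "H r = integral {s..r} h" for r
  have dH: "(H has_real_derivative h x) (at x within {s..t})" if "x \<in> {s..t}" for x
    unfolding H_def using integral_has_real_derivative[OF h that] .
  then have cH: "continuous_on {s..t} H" by (rule DERIV_continuous_on)
  define HH where "HH r = integral {s..r} H" for r
  have dHH: "(HH has_real_derivative H x) (at x within {s..t})" if "x \<in> {s..t}" for x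
    unfolding HH_def using integral_has_real_derivative[OF cH that] .
  define \<alpha> where "\<alpha> = HH t / (t - s)"
  show "second_primitive s t h (\<lambda>r. HH r - \<alpha> * (r - s)) (\<lambda>r. H r - \<alpha>)"
    unfolding second_primitive_def
    by (auto intro!: derivative_eq_intros dHH dH)
  show "HH s - \<alpha> * (s - s) = 0" by (simp add: HH_def)
  show "HH t - \<alpha> * (t - s) = 0" using st by (simp add: \<alpha>_def)
qed

lemma weighted_integral_left:
  assumes y: "second_primitive s t (\<lambda>x. - h x) y y'" and r: "r \<in> {s..t}"
  shows "((\<lambda>x. (x - s) * h x) has_integral (y r - y s - (r - s) * y' r)) {s..r}"
proof -
  have "((\<lambda>x. (x - s) * h x) has_integral (y r - (r - s) * y' r - (y s - (s - s) * y' s))) {s..r}"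
    using r second_primitiveD[OF second_primitive_subinterval[OF y, of s r]]
    by (intro FTC_real_within) (auto intro!: derivative_eq_intros simp: algebra_simps)
  then show ?thesis by (simp add: algebra_simps)
qed

lemma weighted_integral_right:
  assumes y: "second_primitive s t (\<lambda>x. - h x) y y'" and r: "r \<in> {s..t}"
  shows "((\<lambda>x. (t - x) * h x) has_integral ((t - r) * y' r + y r - y t)) {r..t}"
proof -
  have "((\<lambda>x. (t - x) * h x) has_integral
      (- ((t - t) * y' t) - y t - (- ((t - r) * y' r) - y r))) {r..t}"
    using r second_primitiveD[OF second_primitive_subinterval[OF y, of r t]]
    by (intro FTC_real_within) (auto intro!: derivative_eq_intros simp: algebra_simps)
  then show ?thesis by (simp add: algebra_simps)
qed

text \<open>Weighting the two moment identities by \<open>t - r\<close> and \<open>r - s\<close>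
  cancels \<open>y' r\<close>. What remains is the Green kernel of \<open>- y''\<close> together
  with the linear interpolation of the end values.\<close>

lemma green_representation:
  assumes y: "second_primitive s t (\<lambda>x. - h x) y y'" and r: "r \<in> {s..t}"
  shows "(t - s) * y r = (t - r) * integral {s..r} (\<lambda>x. (x - s) * h x)
     + (r - s) * integral {r..t} (\<lambda>x. (t - x) * h x) + (t - r) * y s + (r - s) * y t"
  unfolding integral_unique[OF weighted_integral_left[OF assms]]
    integral_unique[OF weighted_integral_right[OF assms]]
  by (simp add: algebra_simps)

text \<open>Integration by parts replaces \<open>h\<close> by its tail integral \<open>Q\<close>, so
  that only integrals of \<open>h\<close> over subintervals enter and not the size of
  \<open>h\<close>. This is how an oscillating forcing comes to count only by its average.\<close>

lemma moment_bound_left: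
  fixes h :: "real \<Rightarrow> real"
  assumes h: "continuous_on {s..r} h" and sr: "s \<le> r"
    and D: "\<And>x y. s \<le> x \<Longrightarrow> x \<le> y \<Longrightarrow> y \<le> r \<Longrightarrow> \<bar>integral {x..y} h\<bar> \<le> D"
  shows "\<bar>integral {s..r} (\<lambda>x. (x - s) * h x)\<bar> \<le> (r - s) * D"
proof -
  define Q where "Q x = integral {x..r} h" for x
  have dQ: "(Q has_real_derivative - h x) (at x within {s..r})" if "x \<in> {s..r}" for x
    unfolding Q_def using integral_has_real_derivative'[OF h that] .
  then have cQ: "continuous_on {s..r} Q" by (rule DERIV_continuous_on)
  have "((\<lambda>x. Q x - (x - s) * h x) has_integral ((r - s) * Q r - (s - s) * Q s)) {s..r}"
    using sr by (intro FTC_real_within) (auto intro!: derivative_eq_intros dQ)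
  then have "integral {s..r} (\<lambda>x. Q x - (x - s) * h x) = 0"
    by (simp add: Q_def integral_unique)
  moreover have "integral {s..r} (\<lambda>x. Q x - (x - s) * h x)
      = integral {s..r} Q - integral {s..r} (\<lambda>x. (x - s) * h x)"
    by (intro integral_diff integrable_continuous_real continuous_intros cQ h)
  moreover have "\<bar>integral {s..r} Q\<bar> \<le> D * (r - s)"
    using integral_bound[OF sr cQ, of D] D by (auto simp: Q_def)
  ultimately show ?thesis by (simp add: algebra_simps)
qed

lemma moment_bound_right:
  fixes h :: "real \<Rightarrow> real"
  assumes h: "continuous_on {r..t} h" and rt: "r \<le> t"
    and D: "\<And>x y. r \<le> x \<Longrightarrow> x \<le> y \<Longrightarrow> y \<le> t \<Longrightarrow> \<bar>integral {x..y} h\<bar> \<le> D"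
  shows "\<bar>integral {r..t} (\<lambda>x. (t - x) * h x)\<bar> \<le> (t - r) * D"
proof -
  define Q where "Q x = integral {r..x} h" for x
  have dQ: "(Q has_real_derivative h x) (at x within {r..t})" if "x \<in> {r..t}" for x
    unfolding Q_def using integral_has_real_derivative[OF h that] .
  then have cQ: "continuous_on {r..t} Q" by (rule DERIV_continuous_on)
  have "((\<lambda>x. (t - x) * h x - Q x) has_integral ((t - t) * Q t - (t - r) * Q r)) {r..t}"
    using rt by (intro FTC_real_within) (auto intro!: derivative_eq_intros dQ)
  then have "integral {r..t} (\<lambda>x. (t - x) * h x - Q x) = 0"
    by (simp add: Q_def integral_unique)
  moreover have "integral {r..t} (\<lambda>x. (t - x) * h x - Q x)
      = integral {r..t} (\<lambda>x. (t - x) * h x) - integral {r..t} Q"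
    by (intro integral_diff integrable_continuous_real continuous_intros cQ h)
  moreover have "\<bar>integral {r..t} Q\<bar> \<le> D * (t - r)"
    using integral_bound[OF rt cQ, of D] D by (auto simp: Q_def)
  ultimately show ?thesis by (simp add: algebra_simps)
qed

lemma integral_bound_middle_ends:
  fixes m :: "real \<Rightarrow> real"
  assumes m: "continuous_on {s..t} m" and d: "0 \<le> d" "2 * d \<le> t - s" and \<eta>: "0 \<le> \<eta>"
    and ends: "\<And>x. x \<in> {s..t} \<Longrightarrow> x \<le> s + d \<or> t - d \<le> x \<Longrightarrow> m x \<le> B"
    and middle: "\<And>x. x \<in> {s + d..t - d} \<Longrightarrow> m x \<le> \<eta>"
  shows "integral {s..t} m \<le> \<eta> * (t - s) + 2 * d * B"
proof -
  have c: "continuous_on {s..s+d} m" "continuous_on {s+d..t-d} m" "continuous_on {t-d..t} m"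
    "continuous_on {s+d..t} m"
    using d by (auto intro!: continuous_on_subset[OF m])
  note i = c[THEN integrable_continuous_real] integrable_continuous_real[OF m]
  have bd: "integral {a..b} m \<le> C * (b - a)"
    if "a \<le> b" "m integrable_on {a..b}" "\<And>x. x \<in> {a..b} \<Longrightarrow> m x \<le> C" for a b C
    using integral_le[of m "{a..b}" "\<lambda>_. C"] that by (auto simp: mult.commute)
  have "integral {s..t} m = integral {s..s+d} m + integral {s+d..t-d} m + integral {t-d..t} m"
    using Henstock_Kurzweil_Integration.integral_combine[of s "s+d" t m]
      Henstock_Kurzweil_Integration.integral_combine[of "s+d" "t-d" t m] i d by auto
  also have "\<dots> \<le> B * d + \<eta> * (t - d - (s + d)) + B * d"
    using bd[of s "s+d" B] bd[of "s+d" "t-d" \<eta>] bd[of "t-d" t B] i d ends middle by force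
  also have "\<dots> \<le> \<eta> * (t - s) + 2 * d * B"
    using mult_nonneg_nonneg[OF \<eta> d(1)] by (simp add: algebra_simps)
  finally show ?thesis .
qed

text \<open>For \<open>x \<le> r\<close> one has \<open>t - r \<le> t - x\<close>, and symmetrically
  on the other side; hence \<open>t - s\<close> times the kernel is dominated by
  \<open>(x - s) * (t - x)\<close>, whatever \<open>r\<close> is.\<close>

lemma green_abs_bound:
  assumes st: "s < t" and h: "continuous_on {s..t} h"
    and y: "second_primitive s t (\<lambda>x. - h x) y y'" and r: "r \<in> {s..t}"
  shows "(t - s) * \<bar>y r\<bar> \<le> integral {s..t} (\<lambda>x. (x - s) * (t - x) * \<bar>h x\<bar>)
     + (t - r) * \<bar>y s\<bar> + (r - s) * \<bar>y t\<bar>"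
proof -
  let ?m = "\<lambda>x. (x - s) * (t - x) * \<bar>h x\<bar>"
  have ch: "continuous_on {s..r} h" "continuous_on {r..t} h"
    using r by (auto intro!: continuous_on_subset[OF h])
  have "norm (integral {s..r} (\<lambda>x. (t - r) * ((x - s) * h x))) \<le> integral {s..r} ?m"
    by (rule integral_norm_bound_integral)
      (use r in \<open>auto intro!: integrable_continuous_real continuous_intros ch mult_right_mono
        mult_left_mono simp: abs_mult mult.commute mult.left_commute\<close>)
  then have 1: "\<bar>(t - r) * integral {s..r} (\<lambda>x. (x - s) * h x)\<bar> \<le> integral {s..r} ?m"
    by simp
  have "norm (integral {r..t} (\<lambda>x. (r - s) * ((t - x) * h x))) \<le> integral {r..t} ?m"
    by (rule integral_norm_bound_integral)
      (use r in \<open>auto intro!: integrable_continuous_real continuous_intros ch mult_right_mono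
        mult_left_mono simp: abs_mult mult.assoc\<close>)
  then have 2: "\<bar>(r - s) * integral {r..t} (\<lambda>x. (t - x) * h x)\<bar> \<le> integral {r..t} ?m"
    by simp
  have 3: "integral {s..r} ?m + integral {r..t} ?m = integral {s..t} ?m"
    using r by (intro Henstock_Kurzweil_Integration.integral_combine)
      (auto intro!: integrable_continuous_real continuous_intros h)
  have "\<bar>(t - s) * y r\<bar> \<le> integral {s..t} ?m + \<bar>(t - r) * y s\<bar> + \<bar>(r - s) * y t\<bar>"
    unfolding green_representation[OF y r] 3[symmetric] using 1 2 by linarith
  then show ?thesis using r st by (simp add: abs_mult)
qed

text \<open>The parabola is the Dirichlet solution for the constant forcing \<open>a\<close>, and
  the moment bounds control the remainder \<open>z\<close>. Their factors \<open>r - s\<close> and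
  \<open>t - r\<close> survive, so the error is relative to the parabola even near the end points;
  this is what makes the barrier \<open>above\<close> invariant.\<close>

lemma green_mean_bound:
  assumes st: "s < t" and h: "continuous_on {s..t} h"
    and y: "second_primitive s t (\<lambda>x. - h x) y y'" and y0: "y s = 0" "y t = 0"
    and D: "\<And>x z. s \<le> x \<Longrightarrow> x \<le> z \<Longrightarrow> z \<le> t \<Longrightarrow> \<bar>integral {x..z} (\<lambda>x. h x - a)\<bar> \<le> D"
  shows "r \<in> {s..t} \<Longrightarrow> \<bar>y r - a / 2 * ((r - s) * (t - r))\<bar> \<le> 2 * D / (t - s) * ((r - s) * (t - r))"
    and "\<bar>y' s - a / 2 * (t - s)\<bar> \<le> D" and "\<bar>- y' t - a / 2 * (t - s)\<bar> \<le> D"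
proof -
  define k where "k x = h x - a" for x
  define z where "z r = y r - a / 2 * ((r - s) * (t - r))" for r
  define z' where "z' r = y' r - a / 2 * (t + s - 2 * r)" for r
  have k: "continuous_on {s..t} k" unfolding k_def by (intro continuous_intros h)
  have z: "second_primitive s t (\<lambda>x. - k x) z z'"
    unfolding second_primitive_def z_def z'_def k_def
    by (auto intro!: derivative_eq_intros second_primitiveD[OF y] simp: algebra_simps)
  have z0: "z s = 0" "z t = 0" by (auto simp: z_def y0)
  have L: "\<bar>integral {s..r} (\<lambda>x. (x - s) * k x)\<bar> \<le> (r - s) * D" if "r \<in> {s..t}" for r
    using that D[folded k_def] by (intro moment_bound_left continuous_on_subset[OF k]) auto
  have R: "\<bar>integral {r..t} (\<lambda>x. (t - x) * k x)\<bar> \<le> (t - r) * D" if "r \<in> {s..t}" for r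
    using that D[folded k_def] by (intro moment_bound_right continuous_on_subset[OF k]) auto
  show "\<bar>y r - a / 2 * ((r - s) * (t - r))\<bar> \<le> 2 * D / (t - s) * ((r - s) * (t - r))"
    if r: "r \<in> {s..t}"
  proof -
    have "\<bar>(t - s) * z r\<bar> \<le> \<bar>(t - r) * integral {s..r} (\<lambda>x. (x - s) * k x)\<bar>
        + \<bar>(r - s) * integral {r..t} (\<lambda>x. (t - x) * k x)\<bar>"
      unfolding green_representation[OF z r] z0 by simp
    also have "\<dots> \<le> (t - r) * ((r - s) * D) + (r - s) * ((t - r) * D)"
      unfolding abs_mult using r L[OF r] R[OF r] by (intro add_mono mult_mono) auto
    finally have "(t - s) * \<bar>z r\<bar> \<le> 2 * D * ((r - s) * (t - r))"
      using st by (simp add: abs_mult algebra_simps)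
    then show ?thesis using st unfolding z_def[symmetric] by (simp add: field_simps)
  qed
  have "(t - s) * \<bar>z' s\<bar> \<le> (t - s) * D"
    using R[of s] integral_unique[OF weighted_integral_right[OF z, of s]] st z0 by (simp add: abs_mult)
  then show "\<bar>y' s - a / 2 * (t - s)\<bar> \<le> D" using st by (simp add: z'_def)
  have "(t - s) * \<bar>z' t\<bar> \<le> (t - s) * D"
    using L[of t] integral_unique[OF weighted_integral_left[OF z, of t]] st z0 by (simp add: abs_mult)
  then have "\<bar>z' t\<bar> \<le> D" using st by simp
  moreover have "- y' t - a / 2 * (t - s) = - z' t" by (simp add: z'_def field_simps)
  ultimately show "\<bar>- y' t - a / 2 * (t - s)\<bar> \<le> D" by simp
qed

text \<open>Apart from continuity, \<open>g\<close> is constrained only on the positive half-line,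
  so that the reflected pair \<open>- g (- x)\<close>, \<open>- p x\<close> is an instance too and
  yields the negative arcs. \<open>g_decay\<close> is what is kept of concavity;
  \<open>p_avg\<close> restates the uniform convergence of means as an error bound that also holds
  on short intervals.\<close>

locale half_problem =
  fixes g p :: "real \<Rightarrow> real" and gp A K P :: real
  assumes g_cont: "continuous_on UNIV g"
    and g_bounds: "\<And>x. 0 \<le> x \<Longrightarrow> 0 \<le> g x \<and> g x \<le> gp"
    and g_lim: "(g \<longlongrightarrow> gp) at_top"
    and g_lip: "\<And>x y. 0 \<le> x \<Longrightarrow> 0 \<le> y \<Longrightarrow> \<bar>g x - g y\<bar> \<le> K * \<bar>x - y\<bar>"
    and g_decay: "\<And>\<eta>. 0 < \<eta> \<Longrightarrow> \<exists>Y>0. \<forall>z\<ge>Y. \<forall>x\<ge>z. \<forall>y\<ge>z. z * \<bar>g x - g y\<bar> \<le> \<eta> * \<bar>x - y\<bar>"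
    and p_cont: "continuous_on UNIV p"
    and p_bound: "\<And>x. \<bar>p x\<bar> \<le> P"
    and p_avg: "\<And>\<eta>. 0 < \<eta> \<Longrightarrow> \<exists>B. \<forall>x y. x \<le> y \<longrightarrow> \<bar>integral {x..y} p - A * (y - x)\<bar> \<le> \<eta> * (y - x) + B"
    and A_less: "A < gp"
begin

definition a where "a = gp - A"

lemma a_pos: "0 < a" using A_less by (simp add: a_def)

lemma K_nonneg: "0 \<le> K" using g_lip[of 0 1] by simp
lemma gp_nonneg: "0 \<le> gp" using g_bounds[of 0] by simp
lemma P_nonneg: "0 \<le> P" using p_bound[of 0] by linarith

text \<open>The limiting profile of an arc is \<open>a / 2 * ((x - s) * (t - x))\<close>. Half of it
  is taken as barrier, which leaves room for the averaging error.\<close>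

definition above where "above s t u \<longleftrightarrow> (\<forall>x\<in>{s..t}. a / 4 * ((x - s) * (t - x)) \<le> u x)"

lemma aboveD: "above s t u \<Longrightarrow> x \<in> {s..t} \<Longrightarrow> a / 4 * ((x - s) * (t - x)) \<le> u x"
  by (simp add: above_def)

lemma above_nonneg: "above s t u \<Longrightarrow> x \<in> {s..t} \<Longrightarrow> 0 \<le> u x"
  by (rule order_trans[OF _ aboveD[of s t u x]]) (use a_pos in auto)

lemma continuous_on_g: "continuous_on S u \<Longrightarrow> continuous_on S (\<lambda>x. g (u x))"
  by (rule continuous_on_compose2[OF g_cont]) auto

lemma continuous_on_p: "continuous_on S p"
  using p_cont continuous_on_subset by blast

text \<open>On a long interval the barrier lifts \<open>u\<close> above any given level except on
  end pieces of length 1, so \<open>g (u r)\<close> is close to \<open>gp\<close> there. The ends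
  cost at most \<open>2 * gp\<close>, and \<open>p\<close> costs its averaging error.\<close>

lemma forcing_mean:
  assumes "0 < \<eta>"
  shows "\<exists>T1>0. \<forall>s t u. T1 \<le> t - s \<longrightarrow> continuous_on {s..t} u \<longrightarrow> above s t u \<longrightarrow>
    (\<forall>x y. s \<le> x \<longrightarrow> x \<le> y \<longrightarrow> y \<le> t \<longrightarrow> \<bar>integral {x..y} (\<lambda>r. g (u r) - p r - a)\<bar> \<le> \<eta> * (t - s))"
proof -
  have "\<forall>\<^sub>F z in at_top. dist (g z) gp < \<eta> / 4"
    using g_lim assms by (intro tendstoD) auto
  then obtain Y where Y: "\<And>z. Y \<le> z \<Longrightarrow> \<bar>g z - gp\<bar> \<le> \<eta> / 4"
    by (force simp: eventually_at_top_linorder dist_real_def)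
  obtain B where B: "\<And>x y. x \<le> y \<Longrightarrow> \<bar>integral {x..y} p - A * (y - x)\<bar> \<le> \<eta> / 4 * (y - x) + B"
    using p_avg[of "\<eta> / 4"] assms by auto
  \<comment> \<open>The entries ensure, in turn: room for two unit end pieces and
    \<open>t - s - 1 \<ge> (t - s) / 2\<close>; barrier height at least \<open>Y\<close> between
    them; and constant errors \<open>2 * gp + B\<close> of at most half of the allowed
    \<open>\<eta> * (t - s)\<close>.\<close>
  define T1 where "T1 = max 2 (max (8 * Y / a) (2 * (2 * gp + B) / \<eta>))"
  show ?thesis
  proof (intro exI[of _ T1] conjI allI impI)
    show "0 < T1" by (simp add: T1_def)
    fix s t u x y
    assume T: "T1 \<le> t - s" and u: "continuous_on {s..t} u" and ab: "above s t u"
      and xy: "s \<le> x" "x \<le> y" "y \<le> t"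
    have T2: "2 \<le> t - s" "8 * Y / a \<le> t - s" "2 * (2 * gp + B) / \<eta> \<le> t - s"
      using T by (auto simp: T1_def)
    define m where "m r = \<bar>g (u r) - gp\<bar>" for r
    have cm: "continuous_on {s..t} m" unfolding m_def by (intro continuous_intros continuous_on_g u)
    have "integral {s..t} m \<le> \<eta> / 4 * (t - s) + 2 * 1 * gp"
    proof (rule integral_bound_middle_ends[OF cm])
      show "m r \<le> gp" if "r \<in> {s..t}" for r
        using g_bounds[OF above_nonneg[OF ab that]] by (simp add: m_def)
      show "m r \<le> \<eta> / 4" if r: "r \<in> {s + 1..t - 1}" for r
        unfolding m_def
      proof (rule Y)
        have "0 \<le> (r - s - 1) * (t - r - 1)" using r by (intro mult_nonneg_nonneg) auto
        then have "t - s - 1 \<le> (r - s) * (t - r)" by (simp add: algebra_simps)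
        then have "(t - s) / 2 \<le> (r - s) * (t - r)" by (rule order_trans[rotated]) (use T2(1) in simp)
        then have "a / 4 * ((t - s) / 2) \<le> a / 4 * ((r - s) * (t - r))"
          using a_pos by (intro mult_left_mono) auto
        also have "\<dots> \<le> u r" using r by (intro aboveD[OF ab]) auto
        finally show "Y \<le> u r" using T2(2) a_pos by (simp add: field_simps)
      qed
    qed (use T2 assms in auto)
    moreover have im: "m integrable_on {s..t}" using cm by (rule integrable_continuous_real)
    moreover have sub: "{x..y} \<subseteq> {s..t}" using xy by auto
    have im': "m integrable_on {x..y}"
      using continuous_on_subset[OF cm sub] by (rule integrable_continuous_real)
    have "integral {x..y} m \<le> integral {s..t} m"
      by (rule integral_subset_le[OF sub im' im]) (simp add: m_def)
    moreover have igu: "(\<lambda>r. g (u r) - gp) integrable_on {x..y}"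
      by (intro integrable_continuous_real continuous_intros continuous_on_g continuous_on_subset[OF u sub])
    have "norm (integral {x..y} (\<lambda>r. g (u r) - gp)) \<le> integral {x..y} m"
      by (rule integral_norm_bound_integral[OF igu im']) (simp add: m_def)
    ultimately have 1: "\<bar>integral {x..y} (\<lambda>r. g (u r) - gp)\<bar> \<le> \<eta> / 4 * (t - s) + 2 * gp"
      by simp
    have ip: "p integrable_on {x..y}" by (intro integrable_continuous_real continuous_on_p)
    have "integral {x..y} (\<lambda>r. g (u r) - p r - a) = integral {x..y} (\<lambda>r. (g (u r) - gp) - (p r - A))"
      by (simp add: a_def algebra_simps)
    also have "\<dots> = integral {x..y} (\<lambda>r. g (u r) - gp) - (integral {x..y} p - A * (y - x))"
      using integral_diff[OF igu integrable_diff[OF ip integrable_const_ivl[of A]]]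
        integral_diff[OF ip integrable_const_ivl[of A]] xy by (simp add: mult.commute)
    finally have "\<bar>integral {x..y} (\<lambda>r. g (u r) - p r - a)\<bar> \<le> (\<eta> / 4 * (t - s) + 2 * gp) + (\<eta> / 4 * (y - x) + B)"
      using 1 B[OF xy(2)] by linarith
    moreover have "\<eta> / 4 * (y - x) \<le> \<eta> / 4 * (t - s)" using xy assms by (intro mult_left_mono) auto
    moreover have "2 * gp + B \<le> \<eta> / 2 * (t - s)" using T2(3) assms by (simp add: field_simps)
    ultimately show "\<bar>integral {x..y} (\<lambda>r. g (u r) - p r - a)\<bar> \<le> \<eta> * (t - s)" by linarith
  qed
qed

text \<open>This is where concavity enters: the Lipschitz constant of \<open>g\<close> beyond \<open>z\<close> is \<open>o(1/z)\<close>, and the weight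
  \<open>(x - s)(t - x)\<close> makes the two short end pieces harmless.\<close>

lemma forcing_contraction:
  "\<exists>T2>0. \<forall>s t u v D. T2 \<le> t - s \<longrightarrow> continuous_on {s..t} u \<longrightarrow> continuous_on {s..t} v \<longrightarrow>
    above s t u \<longrightarrow> above s t v \<longrightarrow> (\<forall>x\<in>{s..t}. \<bar>u x - v x\<bar> \<le> D) \<longrightarrow>
    integral {s..t} (\<lambda>x. (x - s) * (t - x) * \<bar>g (u x) - g (v x)\<bar>) \<le> (t - s) * D / 2"
proof -
  \<comment> \<open>Within distance \<open>d\<close> of an end the weight is at most
    \<open>d * (t - s)\<close>, so the two ends contribute at most \<open>2 * d * (d * K)\<close>
    times \<open>D * (t - s)\<close>. This \<open>d\<close> makes that a quarter, and the constant
    \<open>a / 16\<close> below gives another quarter for the middle.\<close>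
  define d where "d = 1 / (8 * (K + 1))"
  have d: "0 < d" "d \<le> 1" "2 * d * (d * K) \<le> 1 / 4"
  proof -
    show "0 < d" using K_nonneg by (simp add: d_def)
    show d1: "d \<le> 1" using K_nonneg by (simp add: d_def)
    have "d * K \<le> 1 / 8" using K_nonneg by (simp add: d_def field_simps)
    moreover have "d * (d * K) \<le> 1 * (d * K)"
      using d1 \<open>0 < d\<close> K_nonneg by (intro mult_right_mono) auto
    ultimately show "2 * d * (d * K) \<le> 1 / 4" by linarith
  qed
  obtain Y where Y: "0 < Y" "\<And>z x y. Y \<le> z \<Longrightarrow> z \<le> x \<Longrightarrow> z \<le> y \<Longrightarrow> z * \<bar>g x - g y\<bar> \<le> a / 16 * \<bar>x - y\<bar>"
    using g_decay[of "a / 16"] a_pos by auto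
  define T2 where "T2 = max (2 * d) (8 * Y / (a * d))"
  show ?thesis
  proof (intro exI[of _ T2] conjI allI impI)
    show "0 < T2" using d by (simp add: T2_def)
    fix s t u v D
    assume T: "T2 \<le> t - s" and c: "continuous_on {s..t} u" "continuous_on {s..t} v"
      and ab: "above s t u" "above s t v" and D: "\<forall>x\<in>{s..t}. \<bar>u x - v x\<bar> \<le> D"
    have T': "2 * d \<le> t - s" "8 * Y / (a * d) \<le> t - s" using T by (auto simp: T2_def)
    have st: "s \<le> t" using d T' by simp
    have D0: "0 \<le> D" using bspec[OF D, of s] st by auto
    let ?m = "\<lambda>x. (x - s) * (t - x) * \<bar>g (u x) - g (v x)\<bar>"
    have "integral {s..t} ?m \<le> D / 4 * (t - s) + 2 * d * (d * (t - s) * (K * D))"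
    proof (rule integral_bound_middle_ends)
      show "continuous_on {s..t} ?m" by (intro continuous_intros continuous_on_g c)
      show "?m x \<le> d * (t - s) * (K * D)" if x: "x \<in> {s..t}" "x \<le> s + d \<or> t - d \<le> x" for x
      proof (rule mult_mono)
        show "(x - s) * (t - x) \<le> d * (t - s)"
          using x(2)
        proof
          assume "x \<le> s + d" then show ?thesis using x d by (intro mult_mono) auto
        next
          assume "t - d \<le> x" then have "(t - x) * (x - s) \<le> d * (t - s)" using x d by (intro mult_mono) auto
          then show ?thesis by (simp add: mult.commute)
        qed
        have "\<bar>g (u x) - g (v x)\<bar> \<le> K * \<bar>u x - v x\<bar>"
          by (rule g_lip) (use above_nonneg ab x in auto)
        also have "\<dots> \<le> K * D" using D x K_nonneg by (intro mult_left_mono) auto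
        finally show "\<bar>g (u x) - g (v x)\<bar> \<le> K * D" .
      qed (use st d in auto)
      show "?m x \<le> D / 4" if x: "x \<in> {s + d..t - d}" for x
      proof -
        have xs: "x \<in> {s..t}" using x d by auto
        have "0 \<le> (x - s - d) * (t - x - d)" using x by (intro mult_nonneg_nonneg) auto
        then have "d * (t - s) - d * d \<le> (x - s) * (t - x)" by (simp add: algebra_simps)
        moreover have "d * (2 * d) \<le> d * (t - s)" using T' d by (intro mult_left_mono) auto
        ultimately have "d * (t - s) / 2 \<le> (x - s) * (t - x)" by simp
        then have "a / 4 * (d * (t - s) / 2) \<le> a / 4 * ((x - s) * (t - x))"
          using a_pos by (intro mult_left_mono) auto
        moreover have "Y \<le> a / 4 * (d * (t - s) / 2)" using T'(2) a_pos d by (simp add: field_simps)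
        \<comment> \<open>The level \<open>z\<close> of \<open>g_decay\<close> is taken to be the
          barrier at \<open>x\<close>, a common lower bound of both functions; it is a multiple of
          the weight in the integrand and absorbs it.\<close>
        ultimately have "a / 4 * ((x - s) * (t - x)) * \<bar>g (u x) - g (v x)\<bar> \<le> a / 16 * \<bar>u x - v x\<bar>"
          using aboveD[OF ab(1) xs] aboveD[OF ab(2) xs] by (intro Y) linarith+
        also have "\<dots> \<le> a / 16 * D" using D xs a_pos by (intro mult_left_mono) auto
        finally have "a / 4 * ?m x \<le> a / 4 * (D / 4)" by (simp add: mult.assoc)
        then show ?thesis by (rule mult_left_le_imp_le) (use a_pos in simp)
      qed
    qed (use d T' D0 in auto)
    also have "\<dots> = D / 4 * (t - s) + (2 * d * (d * K)) * (D * (t - s))" by (simp add: algebra_simps)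
    also have "\<dots> \<le> D / 4 * (t - s) + 1 / 4 * (D * (t - s))"
      using d D0 st by (intro add_left_mono mult_right_mono) auto
    finally show "integral {s..t} ?m \<le> (t - s) * D / 2" by (simp add: mult.commute)
  qed
qed

end

section \<open>Positive arcs\<close>

text \<open>With \<open>a / 8\<close> the error factor \<open>2 * D / (t - s)\<close> of
  \<open>green_mean_bound\<close> becomes \<open>a / 4\<close>, exactly the room between the
  limiting profile and the barrier. One threshold \<open>T0\<close> serves both estimates.\<close>

locale half_problem_T = half_problem +
  fixes T0 :: real
  assumes T0_pos: "0 < T0"
    and mean0: "\<And>s t u x y. T0 \<le> t - s \<Longrightarrow> continuous_on {s..t} u \<Longrightarrow> above s t u \<Longrightarrow>
       s \<le> x \<Longrightarrow> x \<le> y \<Longrightarrow> y \<le> t \<Longrightarrow> \<bar>integral {x..y} (\<lambda>r. g (u r) - p r - a)\<bar> \<le> a / 8 * (t - s)"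
    and contraction: "\<And>s t u v D. T0 \<le> t - s \<Longrightarrow> continuous_on {s..t} u \<Longrightarrow> continuous_on {s..t} v \<Longrightarrow>
       above s t u \<Longrightarrow> above s t v \<Longrightarrow> (\<And>x. x \<in> {s..t} \<Longrightarrow> \<bar>u x - v x\<bar> \<le> D) \<Longrightarrow>
       integral {s..t} (\<lambda>x. (x - s) * (t - x) * \<bar>g (u x) - g (v x)\<bar>) \<le> (t - s) * D / 2"
begin

definition is_sol where
  "is_sol s t u u' \<longleftrightarrow> second_primitive s t (\<lambda>x. p x - g (u x)) u u' \<and> u s = 0 \<and> u t = 0 \<and> above s t u"

lemma sol_exists:
  assumes T: "T0 \<le> t - s"
  shows "\<exists>u u'. is_sol s t u u'"
proof -
  have st: "s < t" using T T0_pos by simp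
  define S where "S = PiC {s..t} (\<lambda>x. {a / 4 * ((x - s) * (t - x))..})"
  have S_iff: "u \<in> S \<longleftrightarrow> above s t (apply_bcontfun u)" for u
    by (auto simp: S_def mem_PiC_iff above_def Pi_iff)
  \<comment> \<open>The fixed point is sought among bounded continuous functions on the whole line.
    Freezing the image outside \<open>{s..t}\<close> by \<open>clamp\<close> makes the distance of
    two images a supremum over \<open>{s..t}\<close>, where the estimates hold.\<close>
  have "\<exists>v y'. second_primitive s t (\<lambda>x. p x - g (apply_bcontfun u x)) (apply_bcontfun v) y' \<and>
      v s = 0 \<and> v t = 0 \<and> (\<forall>x. v x = v (clamp s t x))" for u :: "real \<Rightarrow>\<^sub>C real"
  proof -
    have "continuous_on {s..t} (\<lambda>x. p x - g (apply_bcontfun u x))"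
      by (intro continuous_intros continuous_on_g continuous_on_p) auto
    then obtain y y' where y: "second_primitive s t (\<lambda>x. p x - g (apply_bcontfun u x)) y y'" "y s = 0" "y t = 0"
      using dirichlet_second_primitive_exists[OF st] by metis
    obtain v :: "real \<Rightarrow>\<^sub>C real" where v: "\<And>x. x \<in> cbox s t \<Longrightarrow> v x = y x" "\<And>x. v x = y (clamp s t x)"
      using continuous_on_cbox_bcontfunE[of s t y] second_primitive_continuous_on(1)[OF y(1)] by auto
    have "second_primitive s t (\<lambda>x. p x - g (apply_bcontfun u x)) (apply_bcontfun v) y'"
      unfolding second_primitive_def
    proof (intro conjI ballI)
      fix x assume x: "x \<in> {s..t}"
      show "(apply_bcontfun v has_real_derivative y' x) (at x within {s..t})"
        using has_derivative_transform[OF x _ second_primitiveD(1)[OF y(1) x, unfolded has_field_derivative_def]] v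
        unfolding has_field_derivative_def by auto
      show "(y' has_real_derivative p x - g (u x)) (at x within {s..t})"
        by (rule second_primitiveD(2)[OF y(1) x])
    qed
    moreover have "v s = 0" "v t = 0" using v y st by auto
    moreover have "v x = v (clamp s t x)" for x
      using v(1)[of "clamp s t x"] v(2)[of x] clamp_in_interval[of s t x] st by auto
    ultimately show ?thesis by blast
  qed
  then obtain \<Phi> :: "(real \<Rightarrow>\<^sub>C real) \<Rightarrow> (real \<Rightarrow>\<^sub>C real)" and y'
    where \<Phi>: "\<And>u. second_primitive s t (\<lambda>x. p x - g (apply_bcontfun u x)) (apply_bcontfun (\<Phi> u)) (y' u)"
      "\<And>u. \<Phi> u s = 0" "\<And>u. \<Phi> u t = 0" "\<And>u x. \<Phi> u x = \<Phi> u (clamp s t x)"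
    by metis
  have "\<exists>!u\<in>S. \<Phi> u = u"
  proof (rule Banach_fix[where c="1/2"])
    show "complete S" unfolding S_def by (simp add: complete_eq_closed closed_PiC)
    show "S \<noteq> {}"
    proof -
      have "continuous_on (cbox s t) (\<lambda>x. a / 4 * ((x - s) * (t - x)))" by (intro continuous_intros)
      then obtain v :: "real \<Rightarrow>\<^sub>C real" where "\<And>x. x \<in> cbox s t \<Longrightarrow> v x = a / 4 * ((x - s) * (t - x))"
        using continuous_on_cbox_bcontfunE by blast
      then have "v \<in> S" by (simp add: S_iff above_def)
      then show ?thesis by auto
    qed
    show "\<Phi> ` S \<subseteq> S"
    proof
      fix v assume "v \<in> \<Phi> ` S"
      then obtain u :: "real \<Rightarrow>\<^sub>C real" where u: "above s t (apply_bcontfun u)" and v: "v = \<Phi> u" by (auto simp: S_iff)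
      let ?h = "\<lambda>x. g (u x) - p x"
      have h: "continuous_on {s..t} ?h" by (intro continuous_intros continuous_on_g continuous_on_p) auto
      have sp: "second_primitive s t (\<lambda>x. - ?h x) (\<Phi> u) (y' u)" using \<Phi>(1)[of u] by simp
      have "a / 4 * ((x - s) * (t - x)) \<le> \<Phi> u x" if x: "x \<in> {s..t}" for x
      proof -
        have "\<bar>\<Phi> u x - a / 2 * ((x - s) * (t - x))\<bar> \<le> 2 * (a / 8 * (t - s)) / (t - s) * ((x - s) * (t - x))"
          by (rule green_mean_bound(1)[OF st h sp \<Phi>(2,3) mean0[OF T _ u] x]) auto
        moreover have "2 * (a / 8 * (t - s)) / (t - s) = a / 4" using st by (simp add: field_simps)
        ultimately have "\<bar>\<Phi> u x - a / 2 * ((x - s) * (t - x))\<bar> \<le> a / 4 * ((x - s) * (t - x))" by metis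
        moreover have "a / 2 * ((x - s) * (t - x)) = a / 4 * ((x - s) * (t - x)) + a / 4 * ((x - s) * (t - x))"
          by (simp add: field_simps)
        ultimately show ?thesis by (simp only: abs_le_iff) linarith
      qed
      then show "v \<in> S" unfolding S_iff above_def v by auto
    qed
    fix u v assume uv: "u \<in> S" "v \<in> S"
    let ?h = "\<lambda>x. g (u x) - g (v x)"
    have h: "continuous_on {s..t} ?h" by (intro continuous_intros continuous_on_g) auto
    have sp: "second_primitive s t (\<lambda>x. - ?h x) (\<lambda>x. \<Phi> u x - \<Phi> v x) (\<lambda>x. y' u x - y' v x)"
      using second_primitive_diff[OF \<Phi>(1)[of u] \<Phi>(1)[of v]] by simp
    have le: "\<bar>\<Phi> u x - \<Phi> v x\<bar> \<le> 1 / 2 * dist u v" if x: "x \<in> {s..t}" for x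
    proof -
      have "(t - s) * \<bar>\<Phi> u x - \<Phi> v x\<bar> \<le> integral {s..t} (\<lambda>x. (x - s) * (t - x) * \<bar>?h x\<bar>)"
        using green_abs_bound[OF st h sp x] \<Phi>(2,3) by simp
      also have "\<dots> \<le> (t - s) * dist u v / 2"
        by (rule contraction[OF T]) (use uv S_iff dist_bounded[of u _ v] in \<open>auto simp: dist_real_def\<close>)
      finally have "(t - s) * \<bar>\<Phi> u x - \<Phi> v x\<bar> \<le> (t - s) * (1 / 2 * dist u v)" by simp
      then show ?thesis by (rule mult_left_le_imp_le) (use st in simp)
    qed
    show "dist (\<Phi> u) (\<Phi> v) \<le> 1 / 2 * dist u v"
    proof (rule dist_bound)
      fix x
      have "clamp s t x \<in> {s..t}" using clamp_in_interval[of s t x] st by auto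
      then show "dist (\<Phi> u x) (\<Phi> v x) \<le> 1 / 2 * dist u v"
        using le[of "clamp s t x"] \<Phi>(4)[of u x] \<Phi>(4)[of v x] by (simp add: dist_real_def)
    qed
  qed auto
  then obtain u where "u \<in> S" "\<Phi> u = u" by auto
  then have "is_sol s t u (y' u)" using \<Phi>(1-3)[of u] by (auto simp: is_sol_def S_iff)
  then show ?thesis by blast
qed

definition F where "F = gp + P"

lemma F_nonneg: "0 \<le> F" using gp_nonneg P_nonneg by (simp add: F_def)

lemma sol_rhs_bound:
  assumes "is_sol s t u u'" "x \<in> {s..t}"
  shows "\<bar>p x - g (u x)\<bar> \<le> F"
  using g_bounds[of "u x"] above_nonneg[of s t u x] assms p_bound[of x]
  by (auto simp: is_sol_def F_def abs_le_iff)

text \<open>Equal end values provide a point \<open>\<xi>\<close> with \<open>u' \<xi> = 0\<close>;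
  the bound \<open>F\<close> on the second derivative is integrated from there, once for the slope
  and once more for the value.\<close>

lemma sol_bounds:
  assumes u: "is_sol s t u u'" and st: "s < t" and x: "x \<in> {s..t}"
  shows "\<bar>u' x\<bar> \<le> F * (t - s)" "\<bar>u x\<bar> \<le> F * (t - s) * (t - s)"
proof -
  have sp: "second_primitive s t (\<lambda>x. p x - g (u x)) u u'" and u0: "u s = 0" "u t = 0"
    using u by (auto simp: is_sol_def)
  obtain \<xi> where \<xi>: "\<xi> \<in> {s..t}" "u t - u s = (t - s) * u' \<xi>"
    using second_primitive_mvt[OF sp, of s t] st by auto
  have B: "\<bar>u' x\<bar> \<le> F * (t - s)" if "x \<in> {s..t}" for x
  proof -
    have "u' \<xi> = 0" using \<xi> u0 st by auto
    moreover have "\<bar>u' x - u' \<xi>\<bar> \<le> F * \<bar>x - \<xi>\<bar>"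
      by (rule second_primitive_slope_bounds[OF sp]) (use that \<xi> sol_rhs_bound[OF u] in auto)
    moreover have "F * \<bar>x - \<xi>\<bar> \<le> F * (t - s)" using that \<xi> F_nonneg by (intro mult_left_mono) auto
    ultimately show ?thesis by simp
  qed
  show "\<bar>u' x\<bar> \<le> F * (t - s)" by (rule B[OF x])
  have "\<bar>u x - u s\<bar> \<le> F * (t - s) * \<bar>x - s\<bar>"
    by (rule second_primitive_value_bounds[OF sp]) (use x st B in auto)
  also have "\<dots> \<le> F * (t - s) * (t - s)" using x F_nonneg by (intro mult_left_mono) auto
  finally show "\<bar>u x\<bar> \<le> F * (t - s) * (t - s)" using u0 by simp
qed


lemma sol_second_primitive: "is_sol s t u u' \<Longrightarrow> second_primitive s t (\<lambda>x. p x - g (u x)) u u'"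
  and sol_left: "is_sol s t u u' \<Longrightarrow> u s = 0" and sol_right: "is_sol s t u u' \<Longrightarrow> u t = 0"
  and sol_above: "is_sol s t u u' \<Longrightarrow> above s t u"
  by (auto simp: is_sol_def)

lemma sol_continuous_on: "is_sol s t u u' \<Longrightarrow> continuous_on {s..t} u"
  by (meson second_primitive_continuous_on(1) sol_second_primitive)

section \<open>Comparison of arcs on nested intervals\<close>

lemma above_subinterval:
  assumes "above s' t' v" "s' \<le> s" "t \<le> t'"
  shows "above s t v"
  unfolding above_def
proof
  fix x assume x: "x \<in> {s..t}"
  have "a / 4 * ((x - s) * (t - x)) \<le> a / 4 * ((x - s') * (t' - x))"
    using a_pos assms x by (intro mult_left_mono mult_mono) auto
  also have "\<dots> \<le> v x" using assms x by (intro aboveD[OF assms(1)]) auto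
  finally show "a / 4 * ((x - s) * (t - x)) \<le> v x" .
qed

text \<open>The contraction absorbs half of the maximal difference, so that twice the boundary
  values of \<open>v\<close> remain. For equal intervals and \<open>M = 0\<close> this is uniqueness
  of the arc. The slope bound starts from a mean value point, where the slopes differ by at most
  \<open>2 * M / T0\<close>.\<close>

lemma nested_diff_bound:
  assumes u: "is_sol s t u u'" and v: "is_sol s' t' v v'" and nest: "s' \<le> s" "t \<le> t'"
    and T: "T0 \<le> t - s" and M: "\<bar>v s\<bar> \<le> M" "\<bar>v t\<bar> \<le> M" and x: "x \<in> {s..t}"
  shows "\<bar>v x - u x\<bar> \<le> 2 * M"
    and "\<bar>v' x - u' x\<bar> \<le> (2 / T0 + 2 * K * (t - s)) * M"
proof -
  have st: "s < t" using T T0_pos by simp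
  have sub: "{s..t} \<subseteq> {s'..t'}" using nest by auto
  note v1 = second_primitive_subinterval[OF sol_second_primitive[OF v] sub]
  note vab = above_subinterval[OF sol_above[OF v] nest]
  have cont: "continuous_on {s..t} u" "continuous_on {s..t} v"
    using sol_continuous_on[OF u] second_primitive_continuous_on(1)[OF v1] by auto
  let ?h = "\<lambda>x. g (v x) - g (u x)"
  have h: "continuous_on {s..t} ?h" by (intro continuous_intros continuous_on_g cont)
  have w: "second_primitive s t (\<lambda>x. - ?h x) (\<lambda>x. v x - u x) (\<lambda>x. v' x - u' x)"
    using second_primitive_diff[OF v1 sol_second_primitive[OF u]] by simp
  have M0: "0 \<le> M" using M by linarith
  have "continuous_on {s..t} (\<lambda>x. \<bar>v x - u x\<bar>)" by (intro continuous_intros cont)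
  then obtain z where z: "z \<in> {s..t}" "\<And>x. x \<in> {s..t} \<Longrightarrow> \<bar>v x - u x\<bar> \<le> \<bar>v z - u z\<bar>"
    using continuous_attains_sup[of "{s..t}" "\<lambda>x. \<bar>v x - u x\<bar>"] st by auto
  define D where "D = \<bar>v z - u z\<bar>"
  have "(t - s) * D \<le> integral {s..t} (\<lambda>x. (x - s) * (t - x) * \<bar>?h x\<bar>) + (t - z) * \<bar>v s\<bar> + (z - s) * \<bar>v t\<bar>"
    unfolding D_def using green_abs_bound[OF st h w z(1)] sol_left[OF u] sol_right[OF u] by simp
  also have "\<dots> \<le> (t - s) * D / 2 + (t - z) * M + (z - s) * M"
    using z M by (intro add_mono mult_left_mono contraction[OF T] cont vab sol_above[OF u]) (auto simp: D_def)
  finally have "(t - s) * D \<le> (t - s) * (2 * M)" by (simp add: field_simps)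
  then have D: "D \<le> 2 * M" by (rule mult_left_le_imp_le) (use st in simp)
  have wM: "\<bar>v x - u x\<bar> \<le> 2 * M" if "x \<in> {s..t}" for x
    using z(2)[OF that] D by (simp add: D_def)
  then show "\<bar>v x - u x\<bar> \<le> 2 * M" using x by blast
  have hb: "\<bar>- ?h x\<bar> \<le> K * (2 * M)" if "x \<in> {s..t}" for x
  proof -
    have "\<bar>?h x\<bar> \<le> K * \<bar>v x - u x\<bar>"
      by (rule g_lip) (use above_nonneg vab sol_above[OF u] that in auto)
    also have "\<dots> \<le> K * (2 * M)" using wM[OF that] K_nonneg by (intro mult_left_mono) auto
    finally show ?thesis by simp
  qed
  obtain \<xi> where \<xi>: "\<xi> \<in> {s..t}" "(v t - u t) - (v s - u s) = (t - s) * (v' \<xi> - u' \<xi>)"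
    using second_primitive_mvt[OF w, of s t] st by auto
  have "(t - s) * \<bar>v' \<xi> - u' \<xi>\<bar> = \<bar>(v t - u t) - (v s - u s)\<bar>" unfolding \<xi>(2) using st by (simp add: abs_mult)
  also have "\<dots> \<le> 2 * M" using M sol_left[OF u] sol_right[OF u] by simp
  finally have "T0 * \<bar>v' \<xi> - u' \<xi>\<bar> \<le> 2 * M"
    using mult_right_mono[OF T, of "\<bar>v' \<xi> - u' \<xi>\<bar>"] by simp
  then have "\<bar>v' \<xi> - u' \<xi>\<bar> \<le> 2 * M / T0" using T0_pos by (simp add: field_simps)
  moreover have "\<bar>(v' x - u' x) - (v' \<xi> - u' \<xi>)\<bar> \<le> K * (2 * M) * \<bar>x - \<xi>\<bar>"
    by (rule second_primitive_slope_bounds[OF w hb x \<xi>(1)]) auto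
  moreover have "K * (2 * M) * \<bar>x - \<xi>\<bar> \<le> K * (2 * M) * (t - s)"
    using x \<xi>(1) K_nonneg M0 by (intro mult_left_mono) auto
  ultimately show "\<bar>v' x - u' x\<bar> \<le> (2 / T0 + 2 * K * (t - s)) * M" by (simp add: algebra_simps)
qed

definition U where "U s t = (SOME u. \<exists>u'. is_sol s t u u')"
definition U' where "U' s t = (SOME u'. is_sol s t (U s t) u')"
text \<open>The signs of \<open>W\<close> and \<open>V\<close> are chosen so that both end speeds
  are positive on long arcs.\<close>

definition W where "W s t = U' s t s"
definition V where "V s t = - U' s t t"

lemma is_sol_U: "T0 \<le> t - s \<Longrightarrow> is_sol s t (U s t) (U' s t)"
  using someI_ex[OF sol_exists[where s=s and t=t]] someI_ex[of "\<lambda>u'. is_sol s t (U s t) u'"] by (simp add: U_def U'_def)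

section \<open>The action density and its elementary bounds\<close>

definition primg where "primg y = integral {0..y} g"

lemma primg_diff: "0 \<le> x \<Longrightarrow> x \<le> y \<Longrightarrow> primg y - primg x = integral {x..y} g"
  unfolding primg_def
  using Henstock_Kurzweil_Integration.integral_combine[of 0 x y g]
    integrable_continuous_real[OF continuous_on_subset[OF g_cont]] by auto

lemma primg_lip:
  assumes "0 \<le> x" "0 \<le> y"
  shows "\<bar>primg y - primg x\<bar> \<le> gp * \<bar>y - x\<bar>"
proof -
  have *: "\<bar>primg y - primg x\<bar> \<le> gp * \<bar>y - x\<bar>" if "0 \<le> x" "x \<le> y" for x y
    using integral_bound[of x y g gp] that g_bounds continuous_on_subset[OF g_cont]
    by (auto simp: primg_diff)
  show ?thesis using *[of x y] *[of y x] assms by (cases "x \<le> y") (auto simp: abs_minus_commute)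
qed

text \<open>On the interval \<open>g\<close> deviates from the mean of its end values by at most the
  Lipschitz constant times the length. The resulting quadratic error is small enough for the first
  variation of the action.\<close>

lemma primg_trapezoid:
  assumes "0 \<le> x" "0 \<le> y"
  shows "\<bar>1 / 2 * (y - x) * (g y + g x) - (primg y - primg x)\<bar> \<le> K * (y - x)\<^sup>2"
proof -
  have *: "\<bar>1 / 2 * (y - x) * (g y + g x) - (primg y - primg x)\<bar> \<le> K * (y - x)\<^sup>2"
    if "0 \<le> x" "x \<le> y" for x y
  proof -
    let ?m = "1 / 2 * (g y + g x)"
    have gi: "g integrable_on {x..y}"
      by (rule integrable_continuous_real[OF continuous_on_subset[OF g_cont]]) auto
    have "\<bar>integral {x..y} (\<lambda>z. g z - ?m)\<bar> \<le> (K * (y - x)) * (y - x)"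
    proof -
      have "norm (g z - ?m) \<le> K * (y - x)" if z: "z \<in> {x..y}" for z
      proof -
        have "\<bar>g z - g x\<bar> \<le> K * \<bar>z - x\<bar>" "\<bar>g z - g y\<bar> \<le> K * \<bar>z - y\<bar>"
          by (rule g_lip; use z \<open>0 \<le> x\<close> in auto)+
        moreover have "K * \<bar>z - x\<bar> \<le> K * (y - x)" "K * \<bar>z - y\<bar> \<le> K * (y - x)"
          using z K_nonneg by (auto intro!: mult_left_mono)
        ultimately have "\<bar>g z - g x\<bar> \<le> K * (y - x)" "\<bar>g z - g y\<bar> \<le> K * (y - x)"
          by linarith+
        then show ?thesis unfolding real_norm_def abs_le_iff by - (intro conjI; elim conjE; simp add: field_simps)
      qed
      moreover have "continuous_on {x..y} (\<lambda>z. g z - ?m)"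
        by (intro continuous_intros continuous_on_subset[OF g_cont]) auto
      ultimately show ?thesis
        using integral_bound[of x y "\<lambda>z. g z - ?m" "K * (y - x)"] that by auto
    qed
    moreover have "integral {x..y} (\<lambda>z. g z - ?m) = (primg y - primg x) - ?m * (y - x)"
      using integral_diff[OF gi integrable_const_ivl[of ?m]] that by (simp add: primg_diff mult.commute)
    ultimately show ?thesis by (simp add: power2_eq_square abs_minus_commute field_simps)
  qed
  show ?thesis
  proof (cases "x \<le> y")
    case False
    have "1 / 2 * (y - x) * (g y + g x) - (primg y - primg x)
       = - (1 / 2 * (x - y) * (g x + g y) - (primg x - primg y))" by (simp add: field_simps)
    then show ?thesis using *[of y x] assms False by (simp add: power2_commute)
  qed (use * assms in auto)
qed

text \<open>On a Dirichlet solution, integration by parts turns the Lagrangian \<open>u'\<^sup>2/2 - G(u) + pu\<close> into the density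
  below, which avoids the derivative of \<open>u\<close>.\<close>

definition act where "act u x = 1 / 2 * u x * g (u x) - primg (u x) + 1 / 2 * p x * u x" for u :: "real \<Rightarrow> real"
definition phi where "phi s t = integral {s..t} (act (U s t))"

lemma act_continuous_on:
  assumes "continuous_on S u" "\<And>x. x \<in> S \<Longrightarrow> 0 \<le> u x"
  shows "continuous_on S (act u)"
proof -
  have "gp-lipschitz_on {0..} primg"
    using primg_lip gp_nonneg by (auto intro!: lipschitz_onI simp: dist_real_def)
  then have "continuous_on {0..} primg" by (rule lipschitz_on_continuous_on)
  then have "continuous_on S (\<lambda>x. primg (u x))"
    using assms by (auto intro: continuous_on_compose2)
  then show ?thesis unfolding act_def by (intro continuous_intros continuous_on_g continuous_on_p assms(1))
qed

lemma act_bound: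
  assumes "0 \<le> u x"
  shows "\<bar>act u x\<bar> \<le> 2 * F * u x"
proof -
  have "\<bar>u x * g (u x)\<bar> \<le> u x * gp" using g_bounds assms by (auto simp: abs_mult intro!: mult_left_mono)
  moreover have "\<bar>primg (u x)\<bar> \<le> gp * u x" using primg_lip[of 0 "u x"] assms by (simp add: primg_def)
  moreover have "\<bar>p x * u x\<bar> \<le> P * u x" using p_bound[of x] assms by (auto simp: abs_mult intro!: mult_right_mono)
  moreover have "0 \<le> gp * u x" "0 \<le> P * u x" using gp_nonneg P_nonneg assms by auto
  ultimately show ?thesis unfolding act_def F_def by (simp add: algebra_simps abs_le_iff)
qed

text \<open>The bound is linear in the height \<open>M\<close>. On the strips between nested
  intervals both the height and the width are of the order of the displacement, so their action is
  of second order.\<close>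

lemma act_integral_bound:
  assumes "a' \<le> b'" "continuous_on {a'..b'} u" "\<And>x. x \<in> {a'..b'} \<Longrightarrow> 0 \<le> u x \<and> u x \<le> M"
  shows "\<bar>integral {a'..b'} (act u)\<bar> \<le> 2 * F * M * (b' - a')"
proof -
  have "norm (integral {a'..b'} (act u)) \<le> 2 * F * M * (b' - a')"
  proof (rule integral_bound[OF assms(1)])
    show "continuous_on {a'..b'} (act u)" using assms by (intro act_continuous_on) auto
    fix x assume "x \<in> {a'..b'}"
    then have "\<bar>act u x\<bar> \<le> 2 * F * u x" "2 * F * u x \<le> 2 * F * M"
      using assms(3)[of x] F_nonneg by (auto intro!: act_bound mult_left_mono)
    then show "norm (act u x) \<le> 2 * F * M" by simp
  qed
  then show ?thesis by simp
qed

end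

section \<open>The action of an arc\<close>

context half_problem_T
begin

lemma U_nonneg: "T0 \<le> t - s \<Longrightarrow> x \<in> {s..t} \<Longrightarrow> 0 \<le> U s t x"
  using above_nonneg sol_above is_sol_U by blast


text \<open>The Wronskian identity for \<open>v u' - u v'\<close> removes the terms of first order in \<open>v - u\<close> up to a trapezoidal
  error of second order.\<close>

lemma act_wronskian:
  assumes u: "is_sol s t u u'" and v: "is_sol s' t' v v'" and nest: "s' \<le> s" "t \<le> t'" and st: "s \<le> t"
    and D: "\<And>x. x \<in> {s..t} \<Longrightarrow> \<bar>v x - u x\<bar> \<le> D"
  shows "\<bar>integral {s..t} (act v) - integral {s..t} (act u) - 1 / 2 * (v t * u' t - v s * u' s)\<bar>
     \<le> K * D\<^sup>2 * (t - s)"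
proof -
  have sub: "{s..t} \<subseteq> {s'..t'}" using nest by auto
  note u1 = sol_second_primitive[OF u]
  note v1 = second_primitive_subinterval[OF sol_second_primitive[OF v] sub]
  have uv0: "0 \<le> u x" "0 \<le> v x" if "x \<in> {s..t}" for x
    using above_nonneg sol_above u v that sub by blast+
  have cont: "continuous_on {s..t} u" "continuous_on {s..t} v"
    using second_primitive_continuous_on(1) u1 v1 by auto
  let ?z = "\<lambda>x. u x * g (v x) - v x * g (u x) + p x * (v x - u x)"
  let ?e = "\<lambda>x. 1 / 2 * (v x - u x) * (g (v x) + g (u x)) - (primg (v x) - primg (u x))"
  have z: "(?z has_integral (v t * u' t - u t * v' t - (v s * u' s - u s * v' s))) {s..t}"
    using st by (intro FTC_real_within)
      (auto intro!: derivative_eq_intros second_primitiveD[OF u1] second_primitiveD[OF v1] simp: algebra_simps)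
  have i: "act v integrable_on {s..t}" "act u integrable_on {s..t}"
    using uv0 cont by (auto intro!: integrable_continuous_real act_continuous_on)
  have "((\<lambda>x. act v x - act u x - 1 / 2 * ?z x) has_integral
      (integral {s..t} (act v) - integral {s..t} (act u) - 1 / 2 * (v t * u' t - u t * v' t - (v s * u' s - u s * v' s)))) {s..t}"
    by (intro has_integral_diff has_integral_mult_right z integrable_integral i)
  moreover have "act v x - act u x - 1 / 2 * ?z x = ?e x" for x by (simp add: act_def field_simps)
  ultimately have e: "(?e has_integral
      (integral {s..t} (act v) - integral {s..t} (act u) - 1 / 2 * (v t * u' t - v s * u' s))) {s..t}"
    using sol_left[OF u] sol_right[OF u] by simp
  have "norm (integral {s..t} (act v) - integral {s..t} (act u) - 1 / 2 * (v t * u' t - v s * u' s))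
     \<le> K * D\<^sup>2 * measure lborel (cbox s t)"
  proof (rule has_integral_bound)
    show "0 \<le> K * D\<^sup>2" using K_nonneg by simp
    show "(?e has_integral
      (integral {s..t} (act v) - integral {s..t} (act u) - 1 / 2 * (v t * u' t - v s * u' s))) (cbox s t)"
      using e by simp
    fix x assume "x \<in> cbox s t"
    then have x: "x \<in> {s..t}" by simp
    have "\<bar>?e x\<bar> \<le> K * (v x - u x)\<^sup>2" using uv0[OF x] by (intro primg_trapezoid)
    also have "\<dots> \<le> K * D\<^sup>2"
      using D[OF x] K_nonneg power_mono[OF D[OF x], of 2] by (intro mult_left_mono) auto
    finally show "norm (?e x) \<le> K * D\<^sup>2" by simp
  qed
  then show ?thesis using st by simp
qed

text \<open>First variation of the arc with respect to its end points, for outward displacements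
  only: then the larger arc restricts to the smaller interval and can be compared there. The strips
  are of second order, and the inner part reduces to the boundary term of
  \<open>act_wronskian\<close>, in which \<open>v t\<close> is about \<open>V s t * (t' - t)\<close>
  and \<open>v s\<close> about \<open>W s t * (s - s')\<close>.\<close>

lemma nested_action:
  assumes Tm: "0 \<le> Tm"
  shows "\<exists>L\<ge>0. \<forall>s' s t t'. s' \<le> s \<longrightarrow> t \<le> t' \<longrightarrow> T0 \<le> t - s \<longrightarrow> t' - s' \<le> Tm \<longrightarrow>
     \<bar>V s' t' - V s t\<bar> \<le> L * ((s - s') + (t' - t)) \<and> \<bar>W s' t' - W s t\<bar> \<le> L * ((s - s') + (t' - t)) \<and>
     \<bar>phi s' t' - phi s t + 1 / 2 * (V s t)\<^sup>2 * (t' - t) + 1 / 2 * (W s t)\<^sup>2 * (s - s')\<bar>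
       \<le> L * ((s - s') + (t' - t))\<^sup>2"
proof -
  \<comment> \<open>\<open>c1\<close> is the slope factor of \<open>nested_diff_bound\<close>, and
    \<open>L1\<close> adds the change of slope across a strip. The summands of \<open>L2\<close>
    come from the two strips, the trapezoidal error, and the linearisation of the two boundary
    terms.\<close>
  define c1 where "c1 = 2 / T0 + 2 * K * Tm"
  define L1 where "L1 = F + c1 * (F * Tm)"
  define L2 where "L2 = 2 * F * (F * Tm) + K * (2 * (F * Tm))\<^sup>2 * Tm + F * Tm * (F + L1)"
  have c1: "0 \<le> c1" using T0_pos K_nonneg Tm by (simp add: c1_def)
  have L1: "0 \<le> L1" using F_nonneg Tm c1 by (simp add: L1_def)
  have L2: "0 \<le> L2" using F_nonneg Tm L1 K_nonneg by (simp add: L2_def)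
  have combine: "\<bar>I1 + I2 + I3 - J + 1 / 2 * Q + 1 / 2 * R\<bar> \<le> a1 + a3 + b + c"
    if "\<bar>I1\<bar> \<le> a1" "\<bar>I3\<bar> \<le> a3" "\<bar>I2 - J - 1 / 2 * (X - Y)\<bar> \<le> b" "\<bar>X + Q\<bar> \<le> c" "\<bar>Y - R\<bar> \<le> c"
    for I1 I2 I3 J Q R X Y a1 a3 b c :: real
    using that unfolding abs_le_iff by - (intro conjI; elim conjE; simp add: field_simps)
  have main: "\<bar>V s' t' - V s t\<bar> \<le> L1 * ((s - s') + (t' - t)) \<and> \<bar>W s' t' - W s t\<bar> \<le> L1 * ((s - s') + (t' - t)) \<and>
     \<bar>phi s' t' - phi s t + 1 / 2 * (V s t)\<^sup>2 * (t' - t) + 1 / 2 * (W s t)\<^sup>2 * (s - s')\<bar>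
       \<le> L2 * ((s - s') + (t' - t))\<^sup>2"
    if nest: "s' \<le> s" "t \<le> t'" and T: "T0 \<le> t - s" and T': "t' - s' \<le> Tm" for s' s t t'
  proof -
    define e where "e = (s - s') + (t' - t)"
    have e0: "0 \<le> e" using nest by (simp add: e_def)
    have st: "s < t" "s' < t'" using T T0_pos nest by auto
    define u u' v v' where "u = U s t" "u' = U' s t" "v = U s' t'" "v' = U' s' t'"
    have u: "is_sol s t u u'" and v: "is_sol s' t' v v'"
      unfolding u_u'_v_v'_def using T nest by (auto intro!: is_sol_U)
    note v1 = sol_second_primitive[OF v]
    have v0: "0 \<le> v x" if "x \<in> {s'..t'}" for x using above_nonneg sol_above[OF v] that by blast
    have v'b: "\<bar>v' x\<bar> \<le> F * Tm" if "x \<in> {s'..t'}" for x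
      using sol_bounds(1)[OF v st(2) that] mult_left_mono[OF T' F_nonneg] by linarith
    have u'b: "\<bar>u' x\<bar> \<le> F * Tm" if "x \<in> {s..t}" for x
    proof -
      have "F * (t - s) \<le> F * Tm" using F_nonneg nest T' by (intro mult_left_mono) auto
      then show ?thesis using sol_bounds(1)[OF u st(1) that] by linarith
    qed
    \<comment> \<open>Height of the outer arc on the strips, inner end points included: its slope is
      at most \<open>F * Tm\<close> and it vanishes at distance at most \<open>e\<close>.\<close>
    define M where "M = F * Tm * e"
    have M0: "0 \<le> M" using F_nonneg Tm e0 by (simp add: M_def)
    have vL: "v x \<le> M" if "x \<in> {s'..s}" for x
    proof -
      have "\<bar>v x - v s'\<bar> \<le> F * Tm * \<bar>x - s'\<bar>"
        by (rule second_primitive_value_bounds[OF v1 v'b]) (use that nest st in auto)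
      also have "\<dots> \<le> M" unfolding M_def using that F_nonneg Tm nest by (intro mult_left_mono) (auto simp: e_def)
      finally show ?thesis using sol_left[OF v] by simp
    qed
    have vR: "v x \<le> M" if "x \<in> {t..t'}" for x
    proof -
      have "\<bar>v x - v t'\<bar> \<le> F * Tm * \<bar>x - t'\<bar>"
        by (rule second_primitive_value_bounds[OF v1 v'b]) (use that nest st in auto)
      also have "\<dots> \<le> M" unfolding M_def using that F_nonneg Tm nest by (intro mult_left_mono) (auto simp: e_def)
      finally show ?thesis using sol_right[OF v] by simp
    qed
    have vst: "\<bar>v s\<bar> \<le> M" "\<bar>v t\<bar> \<le> M"
      using vL[of s] vR[of t] v0[of s] v0[of t] nest st by auto
    have w: "\<bar>v x - u x\<bar> \<le> 2 * M" "\<bar>v' x - u' x\<bar> \<le> c1 * M" if x: "x \<in> {s..t}" for x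
    proof -
      show "\<bar>v x - u x\<bar> \<le> 2 * M" by (rule nested_diff_bound(1)[OF u v nest T vst x])
      have "\<bar>v' x - u' x\<bar> \<le> (2 / T0 + 2 * K * (t - s)) * M" by (rule nested_diff_bound(2)[OF u v nest T vst x])
      also have "\<dots> \<le> c1 * M"
        unfolding c1_def using M0 K_nonneg nest T' by (intro mult_right_mono add_left_mono mult_left_mono) auto
      finally show "\<bar>v' x - u' x\<bar> \<le> c1 * M" .
    qed
    have slope: "\<bar>v' x - v' y\<bar> \<le> F * e" if "x \<in> {s'..t'}" "y \<in> {s'..t'}" "\<bar>x - y\<bar> \<le> e" for x y
    proof -
      have "\<bar>v' x - v' y\<bar> \<le> F * \<bar>x - y\<bar>"
        by (rule second_primitive_slope_bounds[OF v1 sol_rhs_bound[OF v] that(1,2)])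
      also have "\<dots> \<le> F * e" using that F_nonneg by (intro mult_left_mono)
      finally show ?thesis .
    qed
    have dV: "\<bar>v' t' - u' t\<bar> \<le> L1 * e"
    proof -
      have "\<bar>v' t' - v' t\<bar> \<le> F * e" by (rule slope) (use nest st in \<open>auto simp: e_def\<close>)
      then show ?thesis using w(2)[of t] st by (simp add: L1_def M_def algebra_simps)
    qed
    have dW: "\<bar>v' s' - u' s\<bar> \<le> L1 * e"
    proof -
      have "\<bar>v' s' - v' s\<bar> \<le> F * e" by (rule slope) (use nest st in \<open>auto simp: e_def\<close>)
      then show ?thesis using w(2)[of s] st by (simp add: L1_def M_def algebra_simps)
    qed
    have vt: "\<bar>v t + u' t * (t' - t)\<bar> \<le> (F + L1) * e * e"
    proof -
      obtain \<xi> where \<xi>: "\<xi> \<in> {t..t'}" "v t' - v t = (t' - t) * v' \<xi>"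
        using second_primitive_mvt[OF v1, of t t'] nest st by auto
      have "\<bar>v' \<xi> - v' t'\<bar> \<le> F * e" by (rule slope) (use \<xi> nest st in \<open>auto simp: e_def\<close>)
      then have "\<bar>u' t - v' \<xi>\<bar> \<le> (F + L1) * e" using dV by (simp add: algebra_simps)
      then have "\<bar>u' t - v' \<xi>\<bar> * (t' - t) \<le> (F + L1) * e * e"
        using nest by (intro mult_mono) (auto simp: e_def)
      moreover have "v t + u' t * (t' - t) = (u' t - v' \<xi>) * (t' - t)"
        using \<xi>(2) sol_right[OF v] by (simp add: algebra_simps)
      ultimately show ?thesis using nest by (simp add: abs_mult)
    qed
    have vs: "\<bar>v s - u' s * (s - s')\<bar> \<le> (F + L1) * e * e"
    proof -
      obtain \<xi> where \<xi>: "\<xi> \<in> {s'..s}" "v s - v s' = (s - s') * v' \<xi>"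
        using second_primitive_mvt[OF v1, of s' s] nest st by auto
      have "\<bar>v' \<xi> - v' s'\<bar> \<le> F * e" by (rule slope) (use \<xi> nest st in \<open>auto simp: e_def\<close>)
      then have "\<bar>v' \<xi> - u' s\<bar> \<le> (F + L1) * e" using dW by (simp add: algebra_simps)
      then have "\<bar>v' \<xi> - u' s\<bar> * (s - s') \<le> (F + L1) * e * e"
        using nest by (intro mult_mono) (auto simp: e_def)
      moreover have "v s - u' s * (s - s') = (v' \<xi> - u' s) * (s - s')"
        using \<xi>(2) sol_left[OF v] by (simp add: algebra_simps)
      ultimately show ?thesis using nest by (simp add: abs_mult)
    qed
    have bt: "\<bar>v t * u' t + (u' t)\<^sup>2 * (t' - t)\<bar> \<le> F * Tm * ((F + L1) * e * e)"
    proof -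
      have "v t * u' t + (u' t)\<^sup>2 * (t' - t) = u' t * (v t + u' t * (t' - t))"
        by (simp add: algebra_simps power2_eq_square)
      moreover have "\<bar>u' t\<bar> * \<bar>v t + u' t * (t' - t)\<bar> \<le> F * Tm * ((F + L1) * e * e)"
        using u'b[of t] vt st F_nonneg Tm by (intro mult_mono) auto
      ultimately show ?thesis by (simp add: abs_mult)
    qed
    have bs: "\<bar>v s * u' s - (u' s)\<^sup>2 * (s - s')\<bar> \<le> F * Tm * ((F + L1) * e * e)"
    proof -
      have "v s * u' s - (u' s)\<^sup>2 * (s - s') = u' s * (v s - u' s * (s - s'))"
        by (simp add: algebra_simps power2_eq_square)
      moreover have "\<bar>u' s\<bar> * \<bar>v s - u' s * (s - s')\<bar> \<le> F * Tm * ((F + L1) * e * e)"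
        using u'b[of s] vs st F_nonneg Tm by (intro mult_mono) auto
      ultimately show ?thesis by (simp add: abs_mult)
    qed
    have mid: "\<bar>integral {s..t} (act v) - integral {s..t} (act u) - 1 / 2 * (v t * u' t - v s * u' s)\<bar>
       \<le> K * (2 * M)\<^sup>2 * Tm"
    proof -
      have "K * (2 * M)\<^sup>2 * (t - s) \<le> K * (2 * M)\<^sup>2 * Tm"
        using K_nonneg nest T' by (intro mult_left_mono) auto
      moreover have "\<bar>integral {s..t} (act v) - integral {s..t} (act u) - 1 / 2 * (v t * u' t - v s * u' s)\<bar>
          \<le> K * (2 * M)\<^sup>2 * (t - s)"
        by (rule act_wronskian[OF u v nest]) (use w(1) st in auto)
      ultimately show ?thesis by (rule order_trans[rotated])
    qed
    have vc: "continuous_on {s'..t'} v" by (rule sol_continuous_on[OF v])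
    have oL: "\<bar>integral {s'..s} (act v)\<bar> \<le> 2 * F * M * (s - s')"
      by (rule act_integral_bound) (use nest st vL v0 in \<open>auto intro: continuous_on_subset[OF vc]\<close>)
    have oR: "\<bar>integral {t..t'} (act v)\<bar> \<le> 2 * F * M * (t' - t)"
      by (rule act_integral_bound) (use nest st vR v0 in \<open>auto intro: continuous_on_subset[OF vc]\<close>)
    have av: "act v integrable_on {s'..t'}" "act v integrable_on {s..t'}"
      using v0 nest by (auto intro!: integrable_continuous_real act_continuous_on continuous_on_subset[OF vc])
    have "integral {s'..t'} (act v) = integral {s'..s} (act v) + integral {s..t} (act v) + integral {t..t'} (act v)"
      using Henstock_Kurzweil_Integration.integral_combine[OF _ _ av(1), of s]
        Henstock_Kurzweil_Integration.integral_combine[OF _ _ av(2), of t] nest st by auto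
    moreover have "phi s' t' = integral {s'..t'} (act v)" "phi s t = integral {s..t} (act u)"
      "V s t = - u' t" "W s t = u' s"
      by (auto simp: phi_def u_u'_v_v'_def V_def W_def)
    ultimately have "\<bar>phi s' t' - phi s t + 1 / 2 * (V s t)\<^sup>2 * (t' - t) + 1 / 2 * (W s t)\<^sup>2 * (s - s')\<bar>
      \<le> 2 * F * M * (s - s') + 2 * F * M * (t' - t) + K * (2 * M)\<^sup>2 * Tm + F * Tm * ((F + L1) * e * e)"
      using combine[OF oL oR mid bt bs] by (simp add: mult.assoc add.commute add.left_commute)
    also have "\<dots> = L2 * e\<^sup>2" by (simp add: L2_def M_def e_def power2_eq_square algebra_simps)
    finally have "\<bar>phi s' t' - phi s t + 1 / 2 * (V s t)\<^sup>2 * (t' - t) + 1 / 2 * (W s t)\<^sup>2 * (s - s')\<bar> \<le> L2 * e\<^sup>2" .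
    moreover have "\<bar>V s' t' - V s t\<bar> \<le> L1 * e" "\<bar>W s' t' - W s t\<bar> \<le> L1 * e"
      using dV dW by (auto simp: V_def W_def u_u'_v_v'_def)
    ultimately show ?thesis unfolding e_def[symmetric] by blast
  qed
  show ?thesis
  proof (intro exI[of _ "L1 + L2"] conjI allI impI)
    show "0 \<le> L1 + L2" using L1 L2 by simp
    fix s' s t t' :: real
    assume as: "s' \<le> s" "t \<le> t'" "T0 \<le> t - s" "t' - s' \<le> Tm"
    define e where "e = (s - s') + (t' - t)"
    have e: "0 \<le> e" "0 \<le> e\<^sup>2" using as by (auto simp: e_def)
    have "0 \<le> L2 * e" "0 \<le> L1 * e\<^sup>2" using e L1 L2 by auto
    with main[OF as, folded e_def] show "\<bar>V s' t' - V s t\<bar> \<le> (L1 + L2) * ((s - s') + (t' - t))"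
      "\<bar>W s' t' - W s t\<bar> \<le> (L1 + L2) * ((s - s') + (t' - t))"
      "\<bar>phi s' t' - phi s t + 1 / 2 * (V s t)\<^sup>2 * (t' - t) + 1 / 2 * (W s t)\<^sup>2 * (s - s')\<bar>
       \<le> (L1 + L2) * ((s - s') + (t' - t))\<^sup>2"
      unfolding e_def[symmetric] distrib_right by linarith+
  qed
qed

end

text \<open>Two nearby intervals need not be nested, but both lie in their common hull, which is
  compared with each of them. Each end moves by less than 1, whence \<open>t - s + 2\<close> as
  bound for the length of the hull.\<close>

lemma continuous_on_nested_lipschitz:
  fixes f :: "real \<Rightarrow> real \<Rightarrow> real"
  assumes "\<And>Tm. 0 \<le> Tm \<Longrightarrow> \<exists>L\<ge>0. \<forall>s' s t t'. s' \<le> s \<longrightarrow> t \<le> t' \<longrightarrow> T0 \<le> t - s \<longrightarrow> t' - s' \<le> Tm \<longrightarrow>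
     \<bar>f s' t' - f s t\<bar> \<le> L * ((s - s') + (t' - t))" and T0: "0 \<le> T0"
  shows "continuous_on {x. T0 \<le> snd x - fst x} (\<lambda>x. f (fst x) (snd x))"
  unfolding continuous_on_def
proof
  fix x :: "real \<times> real" assume x: "x \<in> {x. T0 \<le> snd x - fst x}"
  define s t where "s = fst x" "t = snd x"
  have st: "T0 \<le> t - s" using x by (simp add: s_t_def)
  define Tm where "Tm = t - s + 2"
  have "0 \<le> Tm" using st T0 by (simp add: Tm_def)
  then obtain L where L: "0 \<le> L" "\<And>s' s t t'. s' \<le> s \<Longrightarrow> t \<le> t' \<Longrightarrow> T0 \<le> t - s \<Longrightarrow> t' - s' \<le> Tm \<Longrightarrow>
     \<bar>f s' t' - f s t\<bar> \<le> L * ((s - s') + (t' - t))" using assms(1)[of Tm] by metis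
  let ?h = "\<lambda>y. 2 * L * (\<bar>fst y - s\<bar> + \<bar>snd y - t\<bar>)"
  have close: "norm (f (fst y) (snd y) - f s t) \<le> ?h y"
    if y: "T0 \<le> snd y - fst y" "dist y x < 1" for y
  proof -
    have d: "\<bar>fst y - s\<bar> < 1" "\<bar>snd y - t\<bar> < 1"
      using dist_fst_le[of y x] dist_snd_le[of y x] y(2) by (auto simp: s_t_def dist_real_def)
    define s' t' where "s' = min (fst y) s" "t' = max (snd y) t"
    have 1: "\<bar>f s' t' - f s t\<bar> \<le> L * ((s - s') + (t' - t))"
      by (rule L(2)) (use d st in \<open>auto simp: s'_t'_def Tm_def\<close>)
    have 2: "\<bar>f s' t' - f (fst y) (snd y)\<bar> \<le> L * ((fst y - s') + (t' - snd y))"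
      by (rule L(2)) (use d st y in \<open>auto simp: s'_t'_def Tm_def\<close>)
    have 3: "(s - s') + (t' - t) + ((fst y - s') + (t' - snd y)) = \<bar>fst y - s\<bar> + \<bar>snd y - t\<bar>"
      by (auto simp: s'_t'_def min_def max_def)
    have "\<bar>f (fst y) (snd y) - f s t\<bar> \<le> L * ((s - s') + (t' - t)) + L * ((fst y - s') + (t' - snd y))"
      using 1 2 by linarith
    also have "\<dots> = L * (\<bar>fst y - s\<bar> + \<bar>snd y - t\<bar>)" unfolding 3[symmetric] by (simp add: algebra_simps)
    also have "\<dots> \<le> ?h y" using L(1) by (intro mult_right_mono) auto
    finally show ?thesis by simp
  qed
  have "\<forall>\<^sub>F y in at x within {x. T0 \<le> snd x - fst x}. norm (f (fst y) (snd y) - f s t) \<le> ?h y"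
    unfolding eventually_at by (intro exI[of _ 1]) (use close in auto)
  moreover have "(?h \<longlongrightarrow> 2 * L * (\<bar>fst x - s\<bar> + \<bar>snd x - t\<bar>)) (at x within {x. T0 \<le> snd x - fst x})"
    by (intro tendsto_intros)
  then have "(?h \<longlongrightarrow> 0) (at x within {x. T0 \<le> snd x - fst x})" by (simp add: s_t_def)
  ultimately have "((\<lambda>y. f (fst y) (snd y) - f s t) \<longlongrightarrow> 0) (at x within {x. T0 \<le> snd x - fst x})"
    by (rule Lim_null_comparison)
  then show "((\<lambda>y. f (fst y) (snd y)) \<longlongrightarrow> f (fst x) (snd x)) (at x within {x. T0 \<le> snd x - fst x})"
    unfolding s_t_def[symmetric] by (simp add: Lim_null[symmetric])
qed

lemma DERIV_quadratic_remainder: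
  fixes f :: "real \<Rightarrow> real"
  assumes \<delta>: "0 < \<delta>" and C: "\<And>y. \<bar>y - x\<bar> < \<delta> \<Longrightarrow> \<bar>f y - f x - D * (y - x)\<bar> \<le> C * (y - x)\<^sup>2"
  shows "(f has_real_derivative D) (at x)"
proof -
  have close: "norm ((f y - f x) / (y - x) - D) \<le> C * \<bar>y - x\<bar>" if y: "\<bar>y - x\<bar> < \<delta>" "y \<noteq> x" for y
  proof -
    have "(f y - f x) / (y - x) - D = (f y - f x - D * (y - x)) / (y - x)"
      using y by (simp add: field_simps)
    then have "norm ((f y - f x) / (y - x) - D) = \<bar>f y - f x - D * (y - x)\<bar> / \<bar>y - x\<bar>"
      by (simp add: abs_divide)
    also have "\<dots> \<le> C * (y - x)\<^sup>2 / \<bar>y - x\<bar>" using C[OF y(1)] by (intro divide_right_mono) auto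
    also have "\<dots> = C * \<bar>y - x\<bar>"
      using y by (metis abs_eq_0 diff_eq_eq add_0 nonzero_mult_div_cancel_right
          power2_abs power2_eq_square mult.assoc)
    finally show ?thesis .
  qed
  have "\<forall>\<^sub>F y in at x. norm ((f y - f x) / (y - x) - D) \<le> C * \<bar>y - x\<bar>"
    unfolding eventually_at by (intro exI[of _ \<delta>]) (use close \<delta> in \<open>auto simp: dist_real_def\<close>)
  moreover have "((\<lambda>y. C * \<bar>y - x\<bar>) \<longlongrightarrow> C * \<bar>x - x\<bar>) (at x)" by (intro tendsto_intros)
  then have "((\<lambda>y. C * \<bar>y - x\<bar>) \<longlongrightarrow> 0) (at x)" by simp
  ultimately have "((\<lambda>y. (f y - f x) / (y - x) - D) \<longlongrightarrow> 0) (at x)" by (rule Lim_null_comparison)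
  then show ?thesis by (simp add: has_field_derivative_iff Lim_null[symmetric])
qed

context half_problem_T
begin

section \<open>Continuity and partial derivatives of the action\<close>

lemma VW_bound:
  assumes "T0 \<le> t - s"
  shows "\<bar>V s t\<bar> \<le> F * (t - s)" "\<bar>W s t\<bar> \<le> F * (t - s)"
  using sol_bounds(1)[OF is_sol_U[OF assms], of t] sol_bounds(1)[OF is_sol_U[OF assms], of s] assms T0_pos
  by (auto simp: V_def W_def)

lemma V_continuous: "continuous_on {x. T0 \<le> snd x - fst x} (\<lambda>x. V (fst x) (snd x))"
  and W_continuous: "continuous_on {x. T0 \<le> snd x - fst x} (\<lambda>x. W (fst x) (snd x))"
  using nested_action T0_pos by (intro continuous_on_nested_lipschitz; meson less_imp_le)+

lemma sq_le_of_abs_le: "\<bar>x\<bar> \<le> (b::real) \<Longrightarrow> x\<^sup>2 \<le> b\<^sup>2"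
  by (metis abs_ge_zero power2_abs power_mono)

lemma phi_continuous: "continuous_on {x. T0 \<le> snd x - fst x} (\<lambda>x. phi (fst x) (snd x))"
proof (rule continuous_on_nested_lipschitz)
  fix Tm :: real assume Tm: "0 \<le> Tm"
  obtain L where L: "0 \<le> L" "\<And>s' s t t'. s' \<le> s \<Longrightarrow> t \<le> t' \<Longrightarrow> T0 \<le> t - s \<Longrightarrow> t' - s' \<le> Tm \<Longrightarrow>
     \<bar>phi s' t' - phi s t + 1 / 2 * (V s t)\<^sup>2 * (t' - t) + 1 / 2 * (W s t)\<^sup>2 * (s - s')\<bar>
       \<le> L * ((s - s') + (t' - t))\<^sup>2"
    using nested_action[OF Tm] by metis
  let ?L = "L * Tm + (F * Tm)\<^sup>2"
  show "\<exists>L\<ge>0. \<forall>s' s t t'. s' \<le> s \<longrightarrow> t \<le> t' \<longrightarrow> T0 \<le> t - s \<longrightarrow> t' - s' \<le> Tm \<longrightarrow>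
     \<bar>phi s' t' - phi s t\<bar> \<le> L * ((s - s') + (t' - t))"
  proof (intro exI[of _ ?L] conjI allI impI)
    show "0 \<le> ?L" using L Tm by simp
    fix s' s t t' :: real assume as: "s' \<le> s" "t \<le> t'" "T0 \<le> t - s" "t' - s' \<le> Tm"
    define e where "e = (s - s') + (t' - t)"
    have e: "0 \<le> e" "e \<le> Tm" using as T0_pos by (auto simp: e_def)
    have "F * (t - s) \<le> F * Tm" using as F_nonneg by (intro mult_left_mono) auto
    then have sq: "(V s t)\<^sup>2 \<le> (F * Tm)\<^sup>2" "(W s t)\<^sup>2 \<le> (F * Tm)\<^sup>2"
      using VW_bound[OF as(3)] by (auto intro!: sq_le_of_abs_le)
    have 1: "(V s t)\<^sup>2 * (t' - t) \<le> (F * Tm)\<^sup>2 * (t' - t)" "(W s t)\<^sup>2 * (s - s') \<le> (F * Tm)\<^sup>2 * (s - s')"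
      using sq as by (auto intro!: mult_right_mono)
    have 2: "0 \<le> (V s t)\<^sup>2 * (t' - t)" "0 \<le> (W s t)\<^sup>2 * (s - s')" using as by auto
    have 3: "(F * Tm)\<^sup>2 * (t' - t) + (F * Tm)\<^sup>2 * (s - s') = (F * Tm)\<^sup>2 * e" by (simp add: e_def algebra_simps)
    have 4: "0 \<le> (F * Tm)\<^sup>2 * e" using e by simp
    have "L * (e * e) \<le> L * (Tm * e)" using e L(1) by (intro mult_left_mono mult_right_mono) auto
    then have 5: "L * e\<^sup>2 \<le> L * Tm * e" by (simp add: power2_eq_square mult.assoc)
    have comb: "\<bar>x\<bar> \<le> l + f" if "\<bar>x + 1 / 2 * v + 1 / 2 * w\<bar> \<le> l" "v + w \<le> f" "0 \<le> v" "0 \<le> w" for x v w l f :: real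
      using that by (simp add: abs_le_iff field_simps)
    have "\<bar>phi s' t' - phi s t\<bar> \<le> L * e\<^sup>2 + (F * Tm)\<^sup>2 * e"
      by (rule comb[of _ "(V s t)\<^sup>2 * (t' - t)" "(W s t)\<^sup>2 * (s - s')"])
        (use L(2)[OF as] 1 2 3 in \<open>auto simp: e_def mult.assoc\<close>)
    also have "\<dots> \<le> ?L * e" using 5 by (simp add: algebra_simps)
    finally show "\<bar>phi s' t' - phi s t\<bar> \<le> ?L * ((s - s') + (t' - t))" by (simp add: e_def)
  qed
qed (use T0_pos in simp)

text \<open>For \<open>y < t\<close> the outward expansion is centred at the smaller interval
  \<open>{s..y}\<close> and involves \<open>V s y\<close>. The Lipschitz bound for \<open>V\<close>
  replaces it by \<open>V s t\<close> at a cost of second order.\<close>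

lemma phi_DERIV_right:
  assumes st: "T0 < t - s"
  shows "((\<lambda>t. phi s t) has_real_derivative - (1 / 2 * (V s t)\<^sup>2)) (at t)"
proof -
  define Tm where "Tm = t - s + 1"
  have Tm: "0 \<le> Tm" using st T0_pos by (simp add: Tm_def)
  obtain L where L: "0 \<le> L" "\<And>s' s t t'. s' \<le> s \<Longrightarrow> t \<le> t' \<Longrightarrow> T0 \<le> t - s \<Longrightarrow> t' - s' \<le> Tm \<Longrightarrow>
     \<bar>V s' t' - V s t\<bar> \<le> L * ((s - s') + (t' - t)) \<and>
     \<bar>phi s' t' - phi s t + 1 / 2 * (V s t)\<^sup>2 * (t' - t) + 1 / 2 * (W s t)\<^sup>2 * (s - s')\<bar>
       \<le> L * ((s - s') + (t' - t))\<^sup>2"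
    using nested_action[OF Tm] by metis
  define \<delta> where "\<delta> = min 1 (t - s - T0)"
  show ?thesis
  proof (rule DERIV_quadratic_remainder[of \<delta> _ _ _ "L + L * (F * Tm)"])
    show "0 < \<delta>" using st by (simp add: \<delta>_def)
    fix y assume "\<bar>y - t\<bar> < \<delta>"
    then have y: "\<bar>y - t\<bar> < 1" "T0 \<le> y - s" by (auto simp: \<delta>_def)
    have nn: "0 \<le> L * (F * Tm) * (y - t)\<^sup>2" using L(1) F_nonneg Tm by simp
    show "\<bar>phi s y - phi s t - - (1 / 2 * (V s t)\<^sup>2) * (y - t)\<bar> \<le> (L + L * (F * Tm)) * (y - t)\<^sup>2"
    proof (cases "t \<le> y")
      case True
      then have "\<bar>phi s y - phi s t + 1 / 2 * (V s t)\<^sup>2 * (y - t)\<bar> \<le> L * (y - t)\<^sup>2"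
        using L(2)[of s s t y] y st by (auto simp: Tm_def)
      then show ?thesis using nn by (simp add: algebra_simps)
    next
      case False
      have l: "\<bar>V s t - V s y\<bar> \<le> L * (t - y)" "\<bar>phi s t - phi s y + 1 / 2 * (V s y)\<^sup>2 * (t - y)\<bar> \<le> L * (t - y)\<^sup>2"
        using L(2)[of s s y t] y st False by (auto simp: Tm_def)
      have "F * (t - s) \<le> F * Tm" "F * (y - s) \<le> F * Tm"
        using y F_nonneg by (auto intro!: mult_left_mono simp: Tm_def)
      then have "\<bar>V s t + V s y\<bar> \<le> 2 * (F * Tm)"
        using VW_bound(1)[of t s] VW_bound(1)[of y s] st y by linarith
      then have "\<bar>V s t - V s y\<bar> * \<bar>V s t + V s y\<bar> \<le> L * (t - y) * (2 * (F * Tm))"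
        using l(1) L(1) False by (intro mult_mono) auto
      then have "\<bar>(V s t)\<^sup>2 - (V s y)\<^sup>2\<bar> \<le> L * (t - y) * (2 * (F * Tm))"
        by (simp add: power2_eq_square square_diff_square_factored abs_mult mult.commute)
      then have "\<bar>(V s t)\<^sup>2 - (V s y)\<^sup>2\<bar> * (t - y) \<le> L * (t - y) * (2 * (F * Tm)) * (t - y)"
        using False by (intro mult_right_mono) auto
      moreover have "\<bar>(V s t)\<^sup>2 - (V s y)\<^sup>2\<bar> * (t - y) = \<bar>(V s t)\<^sup>2 * (t - y) - (V s y)\<^sup>2 * (t - y)\<bar>"
        using False by (simp add: abs_mult left_diff_distrib[symmetric])
      ultimately have q: "\<bar>(V s t)\<^sup>2 * (t - y) - (V s y)\<^sup>2 * (t - y)\<bar> \<le> 2 * (L * (F * Tm) * (t - y)\<^sup>2)"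
        by (simp add: power2_eq_square algebra_simps)
      have comb: "\<bar>- d - 1 / 2 * v\<bar> \<le> l + f" if "\<bar>d + 1 / 2 * w\<bar> \<le> l" "\<bar>v - w\<bar> \<le> 2 * f" for d v w l f :: real
        using that unfolding abs_le_iff by - (intro conjI; elim conjE; simp add: field_simps)
      have "\<bar>- (phi s t - phi s y) - 1 / 2 * ((V s t)\<^sup>2 * (t - y))\<bar> \<le> L * (t - y)\<^sup>2 + L * (F * Tm) * (t - y)\<^sup>2"
        by (rule comb[OF _ q]) (use l(2) in \<open>simp add: mult.assoc\<close>)
      moreover have "phi s y - phi s t - - (1 / 2 * (V s t)\<^sup>2) * (y - t) = - (phi s t - phi s y) - 1 / 2 * ((V s t)\<^sup>2 * (t - y))"
        by (simp add: field_simps)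
      ultimately show ?thesis by (simp add: distrib_right power2_commute)
    qed
  qed
qed

lemma phi_DERIV_left:
  assumes st: "T0 < t - s"
  shows "((\<lambda>s. phi s t) has_real_derivative 1 / 2 * (W s t)\<^sup>2) (at s)"
proof -
  define Tm where "Tm = t - s + 1"
  have Tm: "0 \<le> Tm" using st T0_pos by (simp add: Tm_def)
  obtain L where L: "0 \<le> L" "\<And>s' s t t'. s' \<le> s \<Longrightarrow> t \<le> t' \<Longrightarrow> T0 \<le> t - s \<Longrightarrow> t' - s' \<le> Tm \<Longrightarrow>
     \<bar>W s' t' - W s t\<bar> \<le> L * ((s - s') + (t' - t)) \<and>
     \<bar>phi s' t' - phi s t + 1 / 2 * (V s t)\<^sup>2 * (t' - t) + 1 / 2 * (W s t)\<^sup>2 * (s - s')\<bar>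
       \<le> L * ((s - s') + (t' - t))\<^sup>2"
    using nested_action[OF Tm] by metis
  define \<delta> where "\<delta> = min 1 (t - s - T0)"
  show ?thesis
  proof (rule DERIV_quadratic_remainder[of \<delta> _ _ _ "L + L * (F * Tm)"])
    show "0 < \<delta>" using st by (simp add: \<delta>_def)
    fix y assume "\<bar>y - s\<bar> < \<delta>"
    then have y: "\<bar>y - s\<bar> < 1" "T0 \<le> t - y" by (auto simp: \<delta>_def)
    have nn: "0 \<le> L * (F * Tm) * (y - s)\<^sup>2" using L(1) F_nonneg Tm by simp
    show "\<bar>phi y t - phi s t - 1 / 2 * (W s t)\<^sup>2 * (y - s)\<bar> \<le> (L + L * (F * Tm)) * (y - s)\<^sup>2"
    proof (cases "y \<le> s")
      case True
      then have "\<bar>phi y t - phi s t + 1 / 2 * (W s t)\<^sup>2 * (s - y)\<bar> \<le> L * (s - y)\<^sup>2"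
        using L(2)[of y s t t] y st by (auto simp: Tm_def)
      moreover have "phi y t - phi s t - 1 / 2 * (W s t)\<^sup>2 * (y - s) = phi y t - phi s t + 1 / 2 * (W s t)\<^sup>2 * (s - y)"
        by (simp add: field_simps)
      ultimately show ?thesis using nn by (simp only: distrib_right power2_commute[of y s])
    next
      case False
      have l: "\<bar>W s t - W y t\<bar> \<le> L * (y - s)" "\<bar>phi s t - phi y t + 1 / 2 * (W y t)\<^sup>2 * (y - s)\<bar> \<le> L * (y - s)\<^sup>2"
        using L(2)[of s y t t] y st False by (auto simp: Tm_def)
      have "F * (t - s) \<le> F * Tm" "F * (t - y) \<le> F * Tm"
        using y F_nonneg by (auto intro!: mult_left_mono simp: Tm_def)
      then have "\<bar>W s t + W y t\<bar> \<le> 2 * (F * Tm)"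
        using VW_bound(2)[of t s] VW_bound(2)[of t y] st y by linarith
      then have "\<bar>W s t - W y t\<bar> * \<bar>W s t + W y t\<bar> \<le> L * (y - s) * (2 * (F * Tm))"
        using l(1) L(1) False by (intro mult_mono) auto
      then have "\<bar>(W s t)\<^sup>2 - (W y t)\<^sup>2\<bar> \<le> L * (y - s) * (2 * (F * Tm))"
        by (simp add: power2_eq_square square_diff_square_factored abs_mult mult.commute)
      then have "\<bar>(W s t)\<^sup>2 - (W y t)\<^sup>2\<bar> * (y - s) \<le> L * (y - s) * (2 * (F * Tm)) * (y - s)"
        using False by (intro mult_right_mono) auto
      moreover have "\<bar>(W s t)\<^sup>2 - (W y t)\<^sup>2\<bar> * (y - s) = \<bar>(W s t)\<^sup>2 * (y - s) - (W y t)\<^sup>2 * (y - s)\<bar>"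
        using False by (simp add: abs_mult left_diff_distrib[symmetric])
      ultimately have q: "\<bar>(W s t)\<^sup>2 * (y - s) - (W y t)\<^sup>2 * (y - s)\<bar> \<le> 2 * (L * (F * Tm) * (y - s)\<^sup>2)"
        by (simp add: power2_eq_square algebra_simps)
      have comb: "\<bar>- d - 1 / 2 * v\<bar> \<le> l + f" if "\<bar>d + 1 / 2 * w\<bar> \<le> l" "\<bar>v - w\<bar> \<le> 2 * f" for d v w l f :: real
        using that unfolding abs_le_iff by - (intro conjI; elim conjE; simp add: field_simps)
      have "\<bar>- (phi s t - phi y t) - 1 / 2 * ((W s t)\<^sup>2 * (y - s))\<bar> \<le> L * (y - s)\<^sup>2 + L * (F * Tm) * (y - s)\<^sup>2"
        by (rule comb[OF _ q]) (use l(2) in \<open>simp add: mult.assoc\<close>)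
      then show ?thesis by (simp add: distrib_right mult.assoc)
    qed
  qed
qed

section \<open>Leading orders of the end speeds and of the action\<close>

lemma VW_asymptotic:
  assumes "0 < \<eta>"
  shows "\<exists>T1\<ge>T0. \<forall>s t. T1 \<le> t - s \<longrightarrow>
    \<bar>V s t - a / 2 * (t - s)\<bar> \<le> \<eta> * (t - s) \<and> \<bar>W s t - a / 2 * (t - s)\<bar> \<le> \<eta> * (t - s)"
proof -
  obtain T1 where T1: "\<And>s t u x y. T1 \<le> t - s \<Longrightarrow> continuous_on {s..t} u \<Longrightarrow> above s t u \<Longrightarrow>
    s \<le> x \<Longrightarrow> x \<le> y \<Longrightarrow> y \<le> t \<Longrightarrow> \<bar>integral {x..y} (\<lambda>r. g (u r) - p r - a)\<bar> \<le> \<eta> * (t - s)"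
    using forcing_mean[OF assms] by metis
  show ?thesis
  proof (intro exI[of _ "max T0 T1"] conjI allI impI)
    fix s t assume T: "max T0 T1 \<le> t - s"
    then have st: "s < t" "T1 \<le> t - s" using T0_pos by auto
    have u: "is_sol s t (U s t) (U' s t)" using T by (intro is_sol_U) auto
    note c = sol_continuous_on[OF u]
    let ?h = "\<lambda>x. g (U s t x) - p x"
    have h: "continuous_on {s..t} ?h" by (intro continuous_intros continuous_on_g continuous_on_p c)
    have sp: "second_primitive s t (\<lambda>x. - ?h x) (U s t) (U' s t)" using sol_second_primitive[OF u] by simp
    note b = green_mean_bound[OF st(1) h sp sol_left[OF u] sol_right[OF u] T1[OF st(2) c sol_above[OF u]]]
    show "\<bar>V s t - a / 2 * (t - s)\<bar> \<le> \<eta> * (t - s)" unfolding V_def by (rule b(3))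
    show "\<bar>W s t - a / 2 * (t - s)\<bar> \<le> \<eta> * (t - s)" unfolding W_def by (rule b(2))
  qed simp
qed


lemma phi_bound:
  assumes T: "T0 \<le> t - s"
  shows "\<bar>phi s t\<bar> \<le> 2 * F * (F * (t - s) * (t - s)) * (t - s)"
  unfolding phi_def
proof (rule act_integral_bound)
  have st: "s < t" using T T0_pos by simp
  then show "s \<le> t" by simp
  show "continuous_on {s..t} (U s t)" by (rule sol_continuous_on[OF is_sol_U[OF T]])
  show "0 \<le> U s t x \<and> U s t x \<le> F * (t - s) * (t - s)" if "x \<in> {s..t}" for x
    using sol_bounds(2)[OF is_sol_U[OF T] st that] U_nonneg[OF T that] by auto
qed

text \<open>The end speeds give the leading order of the derivative of \<open>phi s\<close>, namely
  \<open>- (a\<^sup>2 / 8) * (t - s)\<^sup>2\<close>; integrating from length \<open>T1\<close> on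
  gives the cubic law. The value at length \<open>T1\<close> is bounded by \<open>B\<close> and is
  absorbed on long intervals.\<close>

lemma phi_asymptotic:
  assumes \<eta>: "0 < \<eta>"
  shows "\<exists>T1\<ge>T0. \<forall>s t. T1 \<le> t - s \<longrightarrow> \<bar>phi s t + a\<^sup>2 / 24 * (t - s) ^ 3\<bar> \<le> \<eta> * (t - s) ^ 3"
proof -
  \<comment> \<open>Factoring the difference of the squares of \<open>V s t\<close> and
    \<open>a / 2 * (t - s)\<close> gives a relative error
    \<open>\<epsilon> * (\<epsilon> + a)\<close>, which this choice keeps below
    \<open>\<eta>\<close>.\<close>
  define \<epsilon> where "\<epsilon> = min 1 (\<eta> / (a + 1))"
  have \<epsilon>: "0 < \<epsilon>" "\<epsilon> \<le> 1" using \<eta> a_pos by (auto simp: \<epsilon>_def)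
  have "\<epsilon> * (a + 1) \<le> \<eta> / (a + 1) * (a + 1)" using a_pos by (intro mult_right_mono) (auto simp: \<epsilon>_def)
  then have \<epsilon>\<eta>: "\<epsilon> * (a + 1) \<le> \<eta>" using a_pos by simp
  obtain T1' where T1': "T0 \<le> T1'" "\<And>s t. T1' \<le> t - s \<Longrightarrow> \<bar>V s t - a / 2 * (t - s)\<bar> \<le> \<epsilon> * (t - s)"
    using VW_asymptotic[OF \<epsilon>(1)] by metis
  \<comment> \<open>The added 1 makes \<open>T0 < T1\<close> strict, as
    \<open>phi_DERIV_right\<close> requires at the left end of the integration.\<close>
  define T1 where "T1 = T1' + 1"
  have T1: "T0 < T1" "0 < T1" using T1' T0_pos by (auto simp: T1_def)
  have sq: "\<bar>(V s t)\<^sup>2 / 2 - a\<^sup>2 / 8 * (t - s)\<^sup>2\<bar> \<le> \<eta> / 2 * (t - s)\<^sup>2" if T: "T1 \<le> t - s" for s t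
  proof -
    have 1: "\<bar>V s t - a / 2 * (t - s)\<bar> \<le> \<epsilon> * (t - s)" using T1'(2) T by (simp add: T1_def)
    have pos: "0 \<le> a / 2 * (t - s)" using a_pos T T1 by simp
    have "\<bar>V s t + a / 2 * (t - s)\<bar> \<le> \<epsilon> * (t - s) + 2 * (a / 2 * (t - s))" using 1 pos by linarith
    also have "\<dots> = (\<epsilon> + a) * (t - s)" by (simp add: field_simps)
    also have "\<dots> \<le> (a + 1) * (t - s)" using \<epsilon> T T1 by (intro mult_right_mono) auto
    finally have 2: "\<bar>V s t + a / 2 * (t - s)\<bar> \<le> (a + 1) * (t - s)" .
    have "\<bar>V s t - a / 2 * (t - s)\<bar> * \<bar>V s t + a / 2 * (t - s)\<bar> \<le> \<epsilon> * (t - s) * ((a + 1) * (t - s))"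
      using 1 2 \<epsilon> T T1 by (intro mult_mono) auto
    also have "\<dots> = \<epsilon> * (a + 1) * (t - s)\<^sup>2" by (simp add: power2_eq_square)
    also have "\<dots> \<le> \<eta> * (t - s)\<^sup>2" using \<epsilon>\<eta> by (intro mult_right_mono) auto
    finally have "\<bar>(V s t - a / 2 * (t - s)) * (V s t + a / 2 * (t - s))\<bar> \<le> \<eta> * (t - s)\<^sup>2"
      by (simp add: abs_mult)
    moreover have "(V s t - a / 2 * (t - s)) * (V s t + a / 2 * (t - s)) = 2 * ((V s t)\<^sup>2 / 2 - a\<^sup>2 / 8 * (t - s)\<^sup>2)"
      by (simp add: power2_eq_square field_simps)
    ultimately have "\<bar>2 * ((V s t)\<^sup>2 / 2 - a\<^sup>2 / 8 * (t - s)\<^sup>2)\<bar> \<le> \<eta> * (t - s)\<^sup>2" by metis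
    then show ?thesis unfolding abs_mult by simp
  qed
  define \<psi> where "\<psi> s t = phi s t + a\<^sup>2 / 24 * (t - s) ^ 3" for s t
  define B where "B = 2 * F * (F * T1 * T1) * T1 + a\<^sup>2 / 24 * T1 ^ 3"
  have B0: "0 \<le> B" using F_nonneg T1 by (simp add: B_def)
  define T2 where "T2 = max T1 (max 1 (2 * B / \<eta>))"
  show ?thesis
  proof (intro exI[of _ T2] conjI allI impI)
    show "T0 \<le> T2" using T1 by (simp add: T2_def)
    fix s t assume T: "T2 \<le> t - s"
    define T where "T = t - s"
    have T': "T1 \<le> T" "1 \<le> T" "2 * B / \<eta> \<le> T" using T by (auto simp: T2_def T_def)
    have d: "(\<psi> s has_real_derivative (a\<^sup>2 / 8 * (r - s)\<^sup>2 - (V s r)\<^sup>2 / 2)) (at r within {s + T1..t})"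
      if r: "r \<in> {s + T1..t}" for r
      unfolding \<psi>_def
      by (rule has_field_derivative_at_within)
        (use r T1 in \<open>auto intro!: derivative_eq_intros phi_DERIV_right simp: power2_eq_square\<close>)
    have "norm (\<psi> s t - \<psi> s (s + T1)) \<le> \<eta> / 2 * T\<^sup>2 * norm (t - (s + T1))"
    proof (rule field_differentiable_bound[OF _ d])
      show "norm (a\<^sup>2 / 8 * (r - s)\<^sup>2 - (V s r)\<^sup>2 / 2) \<le> \<eta> / 2 * T\<^sup>2" if r: "r \<in> {s + T1..t}" for r
      proof -
        have "\<bar>(V s r)\<^sup>2 / 2 - a\<^sup>2 / 8 * (r - s)\<^sup>2\<bar> \<le> \<eta> / 2 * (r - s)\<^sup>2" using r by (intro sq) auto
        also have "\<dots> \<le> \<eta> / 2 * T\<^sup>2" using r \<eta> T1 by (intro mult_left_mono power_mono) (auto simp: T_def)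
        finally show ?thesis by (simp add: abs_minus_commute)
      qed
    qed (use T' in \<open>auto simp: T_def\<close>)
    also have "\<dots> \<le> \<eta> / 2 * T\<^sup>2 * T" using T' T1 \<eta> by (intro mult_left_mono) (auto simp: T_def)
    finally have 1: "\<bar>\<psi> s t - \<psi> s (s + T1)\<bar> \<le> \<eta> / 2 * T ^ 3" by (simp add: power3_eq_cube power2_eq_square)
    have "\<bar>phi s (s + T1)\<bar> \<le> 2 * F * (F * T1 * T1) * T1" using phi_bound[of "s + T1" s] T1 by simp
    moreover have "0 \<le> a\<^sup>2 / 24 * T1 ^ 3" using T1 by simp
    ultimately have 2: "\<bar>\<psi> s (s + T1)\<bar> \<le> B" by (simp add: \<psi>_def B_def)
    have "1 * 1 \<le> T * T" using T'(2) by (intro mult_mono) auto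
    then have "1 * T \<le> T * T * T" using T'(2) by (intro mult_right_mono) auto
    then have "T \<le> T ^ 3" by (simp add: power3_eq_cube)
    then have "2 * B / \<eta> \<le> T ^ 3" using T'(3) by linarith
    then have "B \<le> \<eta> / 2 * T ^ 3" using \<eta> by (simp add: field_simps)
    then have "\<bar>\<psi> s t\<bar> \<le> \<eta> / 2 * T ^ 3 + \<eta> / 2 * T ^ 3" using 1 2 by linarith
    then show "\<bar>phi s t + a\<^sup>2 / 24 * (t - s) ^ 3\<bar> \<le> \<eta> * (t - s) ^ 3" by (simp add: \<psi>_def T_def)
  qed
qed

end

lemma (in half_problem) half_problem_T_exists: "\<exists>T0. half_problem_T g p gp A K P T0"
proof -
  have a8: "0 < a / 8" using a_pos by simp
  from forcing_mean[OF a8] obtain T1 where T1: "0 < T1" "\<forall>s t u. T1 \<le> t - s \<longrightarrow> continuous_on {s..t} u \<longrightarrow> above s t u \<longrightarrow>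
    (\<forall>x y. s \<le> x \<longrightarrow> x \<le> y \<longrightarrow> y \<le> t \<longrightarrow> \<bar>integral {x..y} (\<lambda>r. g (u r) - p r - a)\<bar> \<le> a / 8 * (t - s))"
    by blast
  from forcing_contraction obtain T2 where T2: "0 < T2" "\<forall>s t u v D. T2 \<le> t - s \<longrightarrow> continuous_on {s..t} u \<longrightarrow> continuous_on {s..t} v \<longrightarrow>
    above s t u \<longrightarrow> above s t v \<longrightarrow> (\<forall>x\<in>{s..t}. \<bar>u x - v x\<bar> \<le> D) \<longrightarrow>
    integral {s..t} (\<lambda>x. (x - s) * (t - x) * \<bar>g (u x) - g (v x)\<bar>) \<le> (t - s) * D / 2"
    by blast
  have "half_problem_T g p gp A K P (max T1 T2)"
  proof unfold_locales
    show "0 < max T1 T2" using T1 by simp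
    show "\<bar>integral {x..y} (\<lambda>r. g (u r) - p r - a)\<bar> \<le> a / 8 * (t - s)"
      if "max T1 T2 \<le> t - s" "continuous_on {s..t} u" "above s t u" "s \<le> x" "x \<le> y" "y \<le> t" for s t u x y
      using T1(2)[rule_format, of t s u x y] that by simp
    show "integral {s..t} (\<lambda>x. (x - s) * (t - x) * \<bar>g (u x) - g (v x)\<bar>) \<le> (t - s) * D / 2"
      if "max T1 T2 \<le> t - s" "continuous_on {s..t} u" "continuous_on {s..t} v" "above s t u" "above s t v"
        "\<And>x. x \<in> {s..t} \<Longrightarrow> \<bar>u x - v x\<bar> \<le> D" for s t u v D
      using T2(2)[rule_format, of t s u v D] that by simp
  qed
  then show ?thesis by blast
qed

section \<open>Chains of arcs\<close>

text \<open>Tychonoff. The index type is left open: finite chains are indexed by natural numbers,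
  limit chains by integers.\<close>

lemma compact_product_intervals:
  fixes l u :: "'a \<Rightarrow> real"
  shows "compact {t. \<forall>i. l i \<le> t i \<and> t i \<le> u i}"
proof -
  have "compactin (product_topology (\<lambda>i::'a. euclidean :: real topology) UNIV) (PiE UNIV (\<lambda>i. {l i..u i}))"
    by (subst compactin_PiE) auto
  then have "compact (PiE UNIV (\<lambda>i. {l i..u i}))" by (simp add: euclidean_product_topology)
  moreover have "PiE UNIV (\<lambda>i. {l i..u i}) = {t. \<forall>i. l i \<le> t i \<and> t i \<le> u i}"
    by (auto simp: PiE_def Pi_def)
  ultimately show ?thesis by simp
qed

text \<open>The Boolean argument is the sign of the arc; \<open>V\<close> and \<open>W\<close> are the speeds at its right and left end.\<close>

locale chain =
  fixes phi V W :: "bool \<Rightarrow> real \<Rightarrow> real \<Rightarrow> real" and a :: "bool \<Rightarrow> real" and \<tau> :: real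
  assumes a_pos: "\<And>b. 0 < a b" and \<tau>_pos: "0 < \<tau>"
    and phi_cont: "\<And>b. continuous_on {x. \<tau> \<le> a b * (snd x - fst x)} (\<lambda>x. phi b (fst x) (snd x))"
    and V_cont: "\<And>b. continuous_on {x. \<tau> \<le> a b * (snd x - fst x)} (\<lambda>x. V b (fst x) (snd x))"
    and W_cont: "\<And>b. continuous_on {x. \<tau> \<le> a b * (snd x - fst x)} (\<lambda>x. W b (fst x) (snd x))"
    and phi_right: "\<And>b s t. \<tau> \<le> a b * (t - s) \<Longrightarrow> (phi b s has_real_derivative - (1 / 2 * (V b s t)\<^sup>2)) (at t)"
    and phi_left: "\<And>b s t. \<tau> \<le> a b * (t - s) \<Longrightarrow> ((\<lambda>s. phi b s t) has_real_derivative 1 / 2 * (W b s t)\<^sup>2) (at s)"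
    and V_asym: "\<And>b s t. \<tau> \<le> a b * (t - s) \<Longrightarrow> \<bar>V b s t - a b * (t - s) / 2\<bar> \<le> a b * (t - s) / 100"
    and W_asym: "\<And>b s t. \<tau> \<le> a b * (t - s) \<Longrightarrow> \<bar>W b s t - a b * (t - s) / 2\<bar> \<le> a b * (t - s) / 100"
    and phi_asym: "\<And>b s t. \<tau> \<le> a b * (t - s) \<Longrightarrow>
       \<bar>phi b s t + (a b * (t - s)) ^ 3 / (24 * a b)\<bar> \<le> (a b * (t - s)) ^ 3 / (24 * a b) / 10"
begin

text \<open>The time taken by two consecutive arcs of normalised gap 1.\<close>

definition \<kappa> where "\<kappa> = 1 / a True + 1 / a False"
text \<open>Merging four arcs must pay off, which needs a factor above about 0.504; splitting two
  must pay off, which needs one below about 0.992. The value \<open>4 / 5\<close> lies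
  between.\<close>

definition C where "C = 4 / 5 * (\<kappa> * \<tau> ^ 3)"

lemma \<kappa>_pos: "0 < \<kappa>" using a_pos by (simp add: \<kappa>_def add_pos_pos)

text \<open>The end speeds are close to half of the normalised gap for both signs, so comparing
  speeds across a zero amounts to comparing normalised gaps.\<close>

definition ell where "ell b s t = a b * (t - s)"

definition adm where "adm b s t \<longleftrightarrow> \<tau> \<le> ell b s t \<and> ell b s t \<le> 5 * \<tau>"

text \<open>The offset \<open>k\<close> fixes the sign of the first arc, so that a segment can be spliced into a longer chain.\<close>

definition ok where "ok k n t \<longleftrightarrow> (\<forall>i<n. adm (even (k + i)) (t i) (t (Suc i)))" for k n :: nat
definition val where "val k n t = (\<Sum>i<n. phi (even (k + i)) (t i) (t (Suc i)) - C)" for k n :: nat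

lemma okD: "ok k n t \<Longrightarrow> i < n \<Longrightarrow> adm (even (k + i)) (t i) (t (Suc i))"
  by (simp add: ok_def)

lemma ok_add: "ok k (m + n) t \<longleftrightarrow> ok k m t \<and> ok (k + m) n (\<lambda>j. t (m + j))"
proof (intro iffI conjI)
  assume h: "ok k (m + n) t"
  show "ok k m t" using h by (simp add: ok_def)
  show "ok (k + m) n (\<lambda>j. t (m + j))"
    unfolding ok_def using okD[OF h, of "m + _"] by (simp add: add.assoc)
next
  assume "ok k m t \<and> ok (k + m) n (\<lambda>j. t (m + j))"
  then show "ok k (m + n) t"
    unfolding ok_def
  proof (intro allI impI)
    fix i assume h: "(\<forall>i<m. adm (even (k + i)) (t i) (t (Suc i))) \<and>
      (\<forall>i<n. adm (even (k + m + i)) (t (m + i)) (t (m + Suc i)))" and i: "i < m + n"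
    show "adm (even (k + i)) (t i) (t (Suc i))"
    proof (cases "i < m")
      case False
      then obtain j where "i = m + j" by (metis le_Suc_ex not_less)
      then show ?thesis using h i by (simp add: add.assoc)
    qed (use h in blast)
  qed
qed

lemma val_add: "val k (m + n) t = val k m t + val (k + m) n (\<lambda>j. t (m + j))"
  unfolding val_def by (induction n) (auto simp: add.assoc)

lemma ok_cong: "(\<And>j. j \<le> n \<Longrightarrow> t j = t' j) \<Longrightarrow> even k = even k' \<Longrightarrow> ok k n t \<longleftrightarrow> ok k' n t'"
  by (simp add: ok_def)

lemma val_cong: "(\<And>j. j \<le> n \<Longrightarrow> t j = t' j) \<Longrightarrow> even k = even k' \<Longrightarrow> val k n t = val k' n t'"
  unfolding val_def by (intro sum.cong) auto

text \<open>Equal parity of the removed and the inserted number of arcs leaves the sign of every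
  later arc unchanged, so the tail can be reused with shifted indices.\<close>

lemma splice:
  assumes t: "ok 0 (i + m + r) t" and q: "ok i m' q" and ends: "q 0 = t i" "q m' = t (i + m)"
    and par: "even m = even m'"
  obtains t' where "ok 0 (i + m' + r) t'" "t' 0 = t 0" "t' (i + m' + r) = t (i + m + r)"
    "val 0 (i + m' + r) t' = val 0 (i + m + r) t - val i m (\<lambda>j. t (i + j)) + val i m' q"
proof
  define t' where "t' j = (if j \<le> i then t j else if j \<le> i + m' then q (j - i) else t (j - m' + m))" for j
  have 1: "t' j = t j" if "j \<le> i" for j using that by (simp add: t'_def)
  have 2: "t' (i + j) = q j" if "j \<le> m'" for j using that ends by (cases j) (auto simp: t'_def)
  have 3: "t' (i + m' + j) = t (i + m + j)" for j
    using ends 1 2[of m'] by (cases j) (auto simp: t'_def algebra_simps)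
  have ok: "ok 0 (i + m) t" "ok (i + m) r (\<lambda>j. t (i + m + j))" "ok 0 i t"
    using t by (auto simp: ok_add)
  have "ok 0 i t'" using ok(3) 1 by (subst ok_cong[of i t' t 0 0]) auto
  moreover have "ok i m' (\<lambda>j. t' (i + j))" using q 2 by (subst ok_cong[of m' _ q i i]) auto
  moreover have "ok (i + m') r (\<lambda>j. t' (i + m' + j))"
    using ok(2) 3 par by (subst ok_cong[of r _ "\<lambda>j. t (i + m + j)" "i + m'" "i + m"]) auto
  ultimately show "ok 0 (i + m' + r) t'" by (auto simp: ok_add)
  show "t' 0 = t 0" using 1 by simp
  show "t' (i + m' + r) = t (i + m + r)" by (rule 3)
  have "val 0 i t' = val 0 i t" using 1 by (intro val_cong) auto
  moreover have "val i m' (\<lambda>j. t' (i + j)) = val i m' q" using 2 by (intro val_cong) auto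
  moreover have "val (i + m') r (\<lambda>j. t' (i + m' + j)) = val (i + m) r (\<lambda>j. t (i + m + j))"
    using 3 par by (intro val_cong) auto
  ultimately show "val 0 (i + m' + r) t' = val 0 (i + m + r) t - val i m (\<lambda>j. t (i + j)) + val i m' q"
    by (simp add: val_add)
qed

section \<open>Existence and local optimality of maximising chains\<close>

definition feasible where
  "feasible X n t \<longleftrightarrow> even n \<and> ok 0 n t \<and> t 0 = - X \<and> t n = X"

definition optimal where
  "optimal X n t \<longleftrightarrow> feasible X n t \<and> (\<forall>n' t'. feasible X n' t' \<longrightarrow> val 0 n' t' \<le> val 0 n t)"

lemma optimal_local:
  assumes opt: "optimal X n t" and i: "i + m \<le> n" and q: "ok i m' q" "q 0 = t i" "q m' = t (i + m)" "even m = even m'"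
  shows "val i m' q \<le> val i m (\<lambda>j. t (i + j))"
proof -
  obtain r where r: "n = i + m + r" using i by (metis le_Suc_ex)
  have f: "feasible X n t" using opt by (simp add: optimal_def)
  obtain t' where t': "ok 0 (i + m' + r) t'" "t' 0 = t 0" "t' (i + m' + r) = t (i + m + r)"
    "val 0 (i + m' + r) t' = val 0 (i + m + r) t - val i m (\<lambda>j. t (i + j)) + val i m' q"
    using splice[of i m r t m' q] f q by (auto simp: feasible_def r)
  have "feasible X (i + m' + r) t'" using f t' q(4) by (auto simp: feasible_def r)
  then have "val 0 (i + m' + r) t' \<le> val 0 n t" using opt by (simp add: optimal_def)
  then show ?thesis using t'(4) by (simp add: r)
qed

lemma adm_gap:
  assumes "adm b s t"
  shows "\<tau> / a b \<le> t - s" "t - s \<le> 5 * \<tau> / a b" "0 < t - s" "t - s \<le> 5 * \<tau> * \<kappa>"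
proof -
  show 1: "\<tau> / a b \<le> t - s" "t - s \<le> 5 * \<tau> / a b"
    using assms a_pos[of b] by (auto simp: adm_def ell_def field_simps)
  have "0 < \<tau> / a b" using a_pos[of b] \<tau>_pos by simp
  then show "0 < t - s" using 1 by linarith
  have "1 / a b \<le> \<kappa>" using a_pos[of True] a_pos[of False] by (cases b) (auto simp: \<kappa>_def)
  then have "5 * \<tau> * (1 / a b) \<le> 5 * \<tau> * \<kappa>" using \<tau>_pos by (intro mult_left_mono) auto
  then show "t - s \<le> 5 * \<tau> * \<kappa>" using 1 by simp
qed

lemma ok_gap_upper: "ok k n t \<Longrightarrow> i \<le> j \<Longrightarrow> j \<le> n \<Longrightarrow> t j - t i \<le> 5 * \<tau> * \<kappa> * real (j - i)"
proof (induction j)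
  case (Suc j)
  show ?case
  proof (cases "i = Suc j")
    case False
    then have "t j - t i \<le> 5 * \<tau> * \<kappa> * real (j - i)" "t (Suc j) - t j \<le> 5 * \<tau> * \<kappa>" "Suc j - i = Suc (j - i)"
      using Suc adm_gap(4)[OF okD[OF Suc.prems(1), of j]] by auto
    then show ?thesis by (simp add: algebra_simps)
  qed simp
qed simp

lemma ok_mono: "ok k n t \<Longrightarrow> i \<le> j \<Longrightarrow> j \<le> n \<Longrightarrow> t i \<le> t j"
proof (induction j)
  case (Suc j)
  show ?case
  proof (cases "i = Suc j")
    case False
    then have "t i \<le> t j" "0 < t (Suc j) - t j"
      using Suc adm_gap(3)[OF okD[OF Suc.prems(1), of j]] by auto
    then show ?thesis by simp
  qed simp
qed simp

definition gmin where "gmin = min (\<tau> / a True) (\<tau> / a False)"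

lemma gmin_pos: "0 < gmin" using a_pos \<tau>_pos by (simp add: gmin_def)

lemma ok_gap_lower: "ok k n t \<Longrightarrow> gmin * real n \<le> t n - t 0"
proof (induction n)
  case (Suc n)
  then have "gmin * real n \<le> t n - t 0" "\<tau> / a (even (k + n)) \<le> t (Suc n) - t n"
    using adm_gap(1) by (auto simp: ok_def)
  moreover have "gmin \<le> \<tau> / a (even (k + n))" by (cases "even (k + n)") (auto simp: gmin_def)
  ultimately show ?case by (simp add: algebra_simps)
qed simp

lemma continuous_on_coordinate_pair:
  fixes f :: "bool \<Rightarrow> real \<Rightarrow> real \<Rightarrow> real" and i j :: 'c
  assumes "continuous_on {x. \<tau> \<le> a b * (snd x - fst x)} (\<lambda>x. f b (fst x) (snd x))"
    and "\<And>t. t \<in> S \<Longrightarrow> \<tau> \<le> a b * (t j - t i)"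
  shows "continuous_on S (\<lambda>t. f b (t i) (t j))"
proof -
  have "continuous_on S (\<lambda>t. (t i, t j))"
    by (intro continuous_on_Pair continuous_on_subset[OF continuous_on_product_coordinates]) auto
  moreover have "(\<lambda>t. (t i, t j)) ` S \<subseteq> {x. \<tau> \<le> a b * (snd x - fst x)}" using assms(2) by auto
  ultimately have "continuous_on S (\<lambda>t. f b (fst (t i, t j)) (snd (t i, t j)))"
    by (rule continuous_on_compose2[OF assms(1)])
  then show ?thesis by simp
qed

lemma closed_adm:
  fixes i j :: 'c
  shows "closed {t. adm b (t i) (t j)}"
  unfolding adm_def ell_def
  by (intro closed_Collect_conj closed_Collect_le continuous_intros continuous_on_product_coordinates)

text \<open>Gaps are at least \<open>gmin\<close>, so only finitely many numbers of arcs fit between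
  \<open>- X\<close> and \<open>X\<close>; for each of them \<open>val\<close> is continuous on a
  compact set of zeros.\<close>

lemma optimal_exists:
  assumes "feasible X n0 t0"
  obtains n t where "optimal X n t"
proof -
  define S where "S n = {t. \<forall>i. - X \<le> t i \<and> t i \<le> X} \<inter> {t. ok 0 n t \<and> t 0 = - X \<and> t n = X}" for n
  have "compact (S n)" for n
    unfolding S_def
  proof (rule compact_Int_closed[OF compact_product_intervals])
    have "{t. ok 0 n t \<and> t 0 = - X \<and> t n = X} =
        (\<Inter>i\<in>{..<n}. {t. adm (even (0 + i)) (t i) (t (Suc i))}) \<inter> {t. t 0 = - X} \<inter> {t. t n = X}"
      by (auto simp: ok_def)
    also have "closed \<dots>"
      by (intro closed_Int closed_INT ballI closed_adm closed_Collect_eq continuous_intros continuous_on_product_coordinates)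
    finally show "closed {t. ok 0 n t \<and> t 0 = - X \<and> t n = X}" .
  qed
  moreover have "continuous_on (S n) (val 0 n)" for n
    unfolding val_def
    by (intro continuous_intros continuous_on_coordinate_pair phi_cont)
      (auto simp: S_def ok_def adm_def ell_def)
  ultimately have comp: "compact (val 0 n ` S n)" for n by (intro compact_continuous_image)
  define N where "N = nat \<lceil>2 * X / gmin\<rceil>"
  define I where "I = {n. even n \<and> n \<le> N}"
  have norm: "n \<in> I \<and> (\<exists>t'\<in>S n. val 0 n t' = val 0 n t)" if f: "feasible X n t" for n t
  proof
    have ok: "ok 0 n t" and t0: "t 0 = - X" and tn: "t n = X" and ev: "even n" using f by (auto simp: feasible_def)
    have "real n \<le> 2 * X / gmin" using ok_gap_lower[OF ok] t0 tn gmin_pos by (simp add: field_simps)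
    then have "n \<le> N" unfolding N_def by linarith
    then show "n \<in> I" using ev by (simp add: I_def)
    \<comment> \<open>\<open>ok\<close> and \<open>val\<close> read the first \<open>n + 1\<close>
      zeros; filling up with \<open>X\<close> moves the sequence into the compact cube without
      changing its value.\<close>
    define t' where "t' j = (if j \<le> n then t j else X)" for j
    have "- X \<le> t' j \<and> t' j \<le> X" for j
      using ok_mono[OF ok, of 0 j] ok_mono[OF ok, of j n] ok_mono[OF ok, of 0 n] t0 tn by (auto simp: t'_def)
    moreover have "ok 0 n t'" using ok by (subst ok_cong[of n t' t 0 0]) (auto simp: t'_def)
    ultimately have "t' \<in> S n" using t0 tn by (auto simp: S_def t'_def)
    moreover have "val 0 n t' = val 0 n t" by (rule val_cong) (auto simp: t'_def)
    ultimately show "\<exists>t'\<in>S n. val 0 n t' = val 0 n t" by blast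
  qed
  let ?R = "\<Union>n\<in>I. val 0 n ` S n"
  have "compact ?R" using comp by (intro compact_UN) (auto simp: I_def)
  moreover have "?R \<noteq> {}" using norm[OF assms] by blast
  ultimately have "\<exists>z\<in>?R. \<forall>y\<in>?R. y \<le> z" by (rule compact_attains_sup)
  then obtain z where z: "z \<in> ?R" "\<forall>y\<in>?R. y \<le> z" by (elim bexE)
  obtain n t where nt: "n \<in> I" "t \<in> S n" "z = val 0 n t" using z(1) by (elim UN_E imageE)
  have "optimal X n t"
    unfolding optimal_def
  proof (intro conjI allI impI)
    show "feasible X n t" using nt by (auto simp: feasible_def S_def I_def)
    fix n' t' assume "feasible X n' t'"
    from norm[OF this] obtain t'' where "n' \<in> I" "t'' \<in> S n'" "val 0 n' t'' = val 0 n' t'" by blast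
    then have "val 0 n' t' \<in> ?R" by (intro UN_I[of n'] image_eqI[of _ _ t'']) auto
    then show "val 0 n' t' \<le> val 0 n t" using z(2) nt(3) by blast
  qed
  then show ?thesis by (rule that)
qed


section \<open>Excluding contact with the gap constraints\<close>

lemma inverse_sum: "1 / a b + 1 / a (\<not> b) = \<kappa>"
  by (cases b) (auto simp: \<kappa>_def)

lemma adm_ell: "adm b s t \<Longrightarrow> \<tau> \<le> a b * (t - s)"
  by (simp add: adm_def ell_def)

lemma V_bounds: "adm b s t \<Longrightarrow> 49 / 100 * ell b s t \<le> V b s t \<and> V b s t \<le> 51 / 100 * ell b s t"
  using V_asym[of b t s] adm_ell[of b s t] unfolding ell_def abs_le_iff by auto

lemma W_bounds: "adm b s t \<Longrightarrow> 49 / 100 * ell b s t \<le> W b s t \<and> W b s t \<le> 51 / 100 * ell b s t"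
  using W_asym[of b t s] adm_ell[of b s t] unfolding ell_def abs_le_iff by auto

lemma VW_pos: "adm b s t \<Longrightarrow> 0 < V b s t" "adm b s t \<Longrightarrow> 0 < W b s t"
  using V_bounds[of b s t] W_bounds[of b s t] \<tau>_pos by (auto simp: adm_def)

text \<open>The leading order \<open>a\<^sup>2 * (t - s) ^ 3 / 24\<close> of \<open>- phi\<close>,
  written in terms of the normalised gap \<open>l = a * (t - s)\<close>.\<close>

definition cost where "cost b l = l ^ 3 * (1 / a b) / 24"

lemma cost_mono: "0 \<le> l \<Longrightarrow> l \<le> m \<Longrightarrow> cost b l \<le> cost b m"
  unfolding cost_def using a_pos[of b] by (intro divide_right_mono mult_right_mono power_mono) auto

lemma cost_nonneg: "0 \<le> l \<Longrightarrow> 0 \<le> cost b l"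
  unfolding cost_def using a_pos[of b] by simp

lemma cost_sum: "cost b l + cost (\<not> b) l = l ^ 3 * \<kappa> / 24"
  unfolding inverse_sum[of b, symmetric] cost_def by (simp add: field_simps)

lemma phi_bounds:
  assumes "adm b s t"
  shows "phi b s t \<le> - (9 / 10 * cost b (ell b s t))" "- (11 / 10 * cost b (ell b s t)) \<le> phi b s t"
proof -
  have "\<bar>phi b s t + cost b (ell b s t)\<bar> \<le> cost b (ell b s t) / 10"
    using phi_asym[OF adm_ell[OF assms]] by (simp add: cost_def ell_def field_simps)
  then show "phi b s t \<le> - (9 / 10 * cost b (ell b s t))" "- (11 / 10 * cost b (ell b s t)) \<le> phi b s t"
    unfolding abs_le_iff by auto
qed

definition opt3 where
  "opt3 b s x z \<longleftrightarrow> adm b s x \<and> adm (\<not> b) x z \<and>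
    (\<forall>y. adm b s y \<longrightarrow> adm (\<not> b) y z \<longrightarrow> phi b s y + phi (\<not> b) y z \<le> phi b s x + phi (\<not> b) x z)"

text \<open>The derivative of the two actions in the middle zero is half of the squared right speed
  minus the squared left one. If it is positive, the zero would move right unless the left gap is
  maximal or the right gap minimal; the negative case is symmetric.\<close>

lemma opt3_boundary:
  assumes o: "opt3 b s x z"
  shows "V b s x < W (\<not> b) x z \<Longrightarrow> ell b s x = 5 * \<tau> \<or> ell (\<not> b) x z = \<tau>"
    and "W (\<not> b) x z < V b s x \<Longrightarrow> ell b s x = \<tau> \<or> ell (\<not> b) x z = 5 * \<tau>"
proof -
  let ?v = "V b s x" and ?w = "W (\<not> b) x z"
  have ad: "adm b s x" "adm (\<not> b) x z"
    and opt: "\<And>y. adm b s y \<Longrightarrow> adm (\<not> b) y z \<Longrightarrow> phi b s y + phi (\<not> b) y z \<le> phi b s x + phi (\<not> b) x z"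
    using o by (auto simp: opt3_def)
  have d: "((\<lambda>y. phi b s y + phi (\<not> b) y z) has_real_derivative (- (1 / 2 * ?v\<^sup>2) + 1 / 2 * ?w\<^sup>2)) (at x)"
    by (intro DERIV_add phi_right phi_left adm_ell ad)
  show "ell b s x = 5 * \<tau> \<or> ell (\<not> b) x z = \<tau>" if less: "?v < ?w"
  proof (rule ccontr)
    assume "\<not> ?thesis"
    then have n: "ell b s x < 5 * \<tau>" "\<tau> < ell (\<not> b) x z" using ad by (auto simp: adm_def)
    have "?v\<^sup>2 < ?w\<^sup>2" using less VW_pos(1)[OF ad(1)] by (intro power_strict_mono) auto
    then have "0 < - (1 / 2 * ?v\<^sup>2) + 1 / 2 * ?w\<^sup>2" by simp
    from DERIV_pos_inc_right[OF d this] obtain \<delta> where \<delta>: "0 < \<delta>"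
      "\<And>h. 0 < h \<Longrightarrow> h < \<delta> \<Longrightarrow> phi b s x + phi (\<not> b) x z < phi b s (x + h) + phi (\<not> b) (x + h) z" by blast
    define h where "h = min (\<delta> / 2) (min ((5 * \<tau> - ell b s x) / a b) ((ell (\<not> b) x z - \<tau>) / a (\<not> b)))"
    have h: "0 < h" "h < \<delta>" "h \<le> (5 * \<tau> - ell b s x) / a b" "h \<le> (ell (\<not> b) x z - \<tau>) / a (\<not> b)"
      using \<delta>(1) n a_pos[of b] a_pos[of "\<not> b"]
      by (auto simp: h_def min_le_iff_disj min_less_iff_disj)
    have h': "0 < a b * h" "a b * h \<le> 5 * \<tau> - ell b s x" "0 < a (\<not> b) * h" "a (\<not> b) * h \<le> ell (\<not> b) x z - \<tau>"
      using h a_pos[of b] a_pos[of "\<not> b"] by (auto simp: field_simps)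
    have "ell b s (x + h) = ell b s x + a b * h" "ell (\<not> b) (x + h) z = ell (\<not> b) x z - a (\<not> b) * h"
      by (auto simp: ell_def algebra_simps)
    then have "adm b s (x + h)" "adm (\<not> b) (x + h) z" using ad h' by (auto simp: adm_def)
    from opt[OF this] \<delta>(2)[OF h(1,2)] show False by simp
  qed
  show "ell b s x = \<tau> \<or> ell (\<not> b) x z = 5 * \<tau>" if less: "?w < ?v"
  proof (rule ccontr)
    assume "\<not> ?thesis"
    then have n: "\<tau> < ell b s x" "ell (\<not> b) x z < 5 * \<tau>" using ad by (auto simp: adm_def)
    have "?w\<^sup>2 < ?v\<^sup>2" using less VW_pos(2)[OF ad(2)] by (intro power_strict_mono) auto
    then have "- (1 / 2 * ?v\<^sup>2) + 1 / 2 * ?w\<^sup>2 < 0" by simp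
    from DERIV_neg_dec_left[OF d this] obtain \<delta> where \<delta>: "0 < \<delta>"
      "\<And>h. 0 < h \<Longrightarrow> h < \<delta> \<Longrightarrow> phi b s x + phi (\<not> b) x z < phi b s (x - h) + phi (\<not> b) (x - h) z" by blast
    define h where "h = min (\<delta> / 2) (min ((ell b s x - \<tau>) / a b) ((5 * \<tau> - ell (\<not> b) x z) / a (\<not> b)))"
    have h: "0 < h" "h < \<delta>" "h \<le> (ell b s x - \<tau>) / a b" "h \<le> (5 * \<tau> - ell (\<not> b) x z) / a (\<not> b)"
      using \<delta>(1) n a_pos[of b] a_pos[of "\<not> b"]
      by (auto simp: h_def min_le_iff_disj min_less_iff_disj)
    have h': "0 < a b * h" "a b * h \<le> ell b s x - \<tau>" "0 < a (\<not> b) * h" "a (\<not> b) * h \<le> 5 * \<tau> - ell (\<not> b) x z"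
      using h a_pos[of b] a_pos[of "\<not> b"] by (auto simp: field_simps)
    have "ell b s (x - h) = ell b s x - a b * h" "ell (\<not> b) (x - h) z = ell (\<not> b) x z + a (\<not> b) * h"
      by (auto simp: ell_def algebra_simps)
    then have "adm b s (x - h)" "adm (\<not> b) (x - h) z" using ad h' by (auto simp: adm_def)
    from opt[OF this] \<delta>(2)[OF h(1,2)] show False by simp
  qed
qed

text \<open>Equal speeds give gaps of ratio at least \<open>49 / 51\<close>. If the left speed is
  smaller, the speeds bound the left gap by \<open>51 / 49\<close> of the right one, and contact
  with a constraint makes the left gap the larger of the two; symmetrically in the third
  case.\<close>

lemma opt3_comparable:
  assumes o: "opt3 b s x z"
  shows "9 / 10 * ell b s x \<le> ell (\<not> b) x z" "9 / 10 * ell (\<not> b) x z \<le> ell b s x"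
proof -
  have ad: "adm b s x" "adm (\<not> b) x z" using o by (auto simp: opt3_def)
  note vb = V_bounds[OF ad(1)] and wb = W_bounds[OF ad(2)]
  have r: "\<tau> \<le> ell b s x" "ell b s x \<le> 5 * \<tau>" "\<tau> \<le> ell (\<not> b) x z" "ell (\<not> b) x z \<le> 5 * \<tau>"
    using ad by (auto simp: adm_def)
  consider "V b s x = W (\<not> b) x z" | "V b s x < W (\<not> b) x z" | "W (\<not> b) x z < V b s x" by linarith
  then have "9 / 10 * ell b s x \<le> ell (\<not> b) x z \<and> 9 / 10 * ell (\<not> b) x z \<le> ell b s x"
  proof cases
    case 1 then show ?thesis using vb wb r \<tau>_pos by auto
  next
    case 2 then show ?thesis using opt3_boundary(1)[OF o 2] vb wb r \<tau>_pos by auto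
  next
    case 3 then show ?thesis using opt3_boundary(2)[OF o 3] vb wb r \<tau>_pos by auto
  qed
  then show "9 / 10 * ell b s x \<le> ell (\<not> b) x z" "9 / 10 * ell (\<not> b) x z \<le> ell b s x" by auto
qed

text \<open>Building block of the competitors: two arcs of the same normalised gap \<open>l\<close>,
  filling the time \<open>l * \<kappa>\<close>.\<close>

lemma equal_pair:
  assumes l: "\<tau> \<le> l" "l \<le> 5 * \<tau>"
  shows "adm b s (s + l / a b)" "adm (\<not> b) (s + l / a b) (s + l * \<kappa>)"
    "- (11 / 10 * (l ^ 3 * \<kappa> / 24)) \<le> phi b s (s + l / a b) + phi (\<not> b) (s + l / a b) (s + l * \<kappa>)"
proof -
  have "l * \<kappa> - l / a b = l / a (\<not> b)" unfolding inverse_sum[of b, symmetric] by (simp add: distrib_left)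
  then have e: "ell b s (s + l / a b) = l" "ell (\<not> b) (s + l / a b) (s + l * \<kappa>) = l"
    using a_pos[of b] a_pos[of "\<not> b"] by (auto simp: ell_def)
  show ad: "adm b s (s + l / a b)" "adm (\<not> b) (s + l / a b) (s + l * \<kappa>)" using l by (auto simp: adm_def e)
  show "- (11 / 10 * (l ^ 3 * \<kappa> / 24)) \<le> phi b s (s + l / a b) + phi (\<not> b) (s + l / a b) (s + l * \<kappa>)"
    using phi_bounds(2)[OF ad(1)] phi_bounds(2)[OF ad(2)] unfolding e cost_sum[of b, symmetric] distrib_left by linarith
qed

lemma pair_length:
  assumes "m \<le> ell b s x" "ell b s x \<le> M" "m \<le> ell (\<not> b) x z" "ell (\<not> b) x z \<le> M"
  shows "m * \<kappa> \<le> z - s" "z - s \<le> M * \<kappa>"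
proof -
  have "z - s = ell b s x * (1 / a b) + ell (\<not> b) x z * (1 / a (\<not> b))"
    using a_pos[of b] a_pos[of "\<not> b"] by (simp add: ell_def)
  moreover have "m * (1 / a b) \<le> ell b s x * (1 / a b)" "m * (1 / a (\<not> b)) \<le> ell (\<not> b) x z * (1 / a (\<not> b))"
    "ell b s x * (1 / a b) \<le> M * (1 / a b)" "ell (\<not> b) x z * (1 / a (\<not> b)) \<le> M * (1 / a (\<not> b))"
    using assms a_pos[of b] a_pos[of "\<not> b"] by (intro mult_right_mono; simp)+
  moreover have "m * \<kappa> = m * (1 / a b) + m * (1 / a (\<not> b))" "M * \<kappa> = M * (1 / a b) + M * (1 / a (\<not> b))"
    unfolding inverse_sum[of b, symmetric] by (auto simp: distrib_left)
  ultimately show "m * \<kappa> \<le> z - s" "z - s \<le> M * \<kappa>" by linarith+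
qed

lemma ok_2: "ok i 2 q \<longleftrightarrow> adm (even i) (q 0) (q 1) \<and> adm (\<not> even i) (q 1) (q 2)"
proof -
  have "ok i (Suc (Suc 0)) q \<longleftrightarrow> adm (even i) (q 0) (q (Suc 0)) \<and> adm (\<not> even i) (q (Suc 0)) (q (Suc (Suc 0)))"
    by (auto simp: ok_def less_Suc_eq)
  then show ?thesis by (simp add: numeral_2_eq_2)
qed

lemma val_2: "val i 2 q = phi (even i) (q 0) (q 1) + phi (\<not> even i) (q 1) (q 2) - 2 * C"
proof -
  have "val i (Suc (Suc 0)) q = phi (even i) (q 0) (q (Suc 0)) + phi (\<not> even i) (q (Suc 0)) (q (Suc (Suc 0))) - 2 * C"
    by (simp add: val_def)
  then show ?thesis by (simp add: numeral_2_eq_2)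
qed

lemma ok_4: "ok i 4 q \<longleftrightarrow> adm (even i) (q 0) (q 1) \<and> adm (\<not> even i) (q 1) (q 2) \<and>
    adm (even i) (q 2) (q 3) \<and> adm (\<not> even i) (q 3) (q 4)"
  using ok_add[of i 2 2 q] ok_2[of "i + 2" "\<lambda>j. q (2 + j)"] by (simp add: ok_2)

lemma val_4: "val i 4 q = phi (even i) (q 0) (q 1) + phi (\<not> even i) (q 1) (q 2) +
    phi (even i) (q 2) (q 3) + phi (\<not> even i) (q 3) (q 4) - 4 * C"
  using val_add[of i 2 2 q] val_2[of "i + 2" "\<lambda>j. q (2 + j)"] by (simp add: val_2)

lemma optimal_opt3:
  assumes opt: "optimal X n t" and i: "i + 2 \<le> n"
  shows "opt3 (even i) (t i) (t (i + 1)) (t (i + 2))"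
  unfolding opt3_def
proof (intro conjI allI impI)
  have ok: "ok 0 n t" using opt by (simp add: optimal_def feasible_def)
  show "adm (even i) (t i) (t (i + 1))" "adm (\<not> even i) (t (i + 1)) (t (i + 2))"
    using okD[OF ok, of i] okD[OF ok, of "i + 1"] i by auto
  fix y assume y: "adm (even i) (t i) y" "adm (\<not> even i) y (t (i + 2))"
  define q where "q j = (if j = 0 then t i else if j = 1 then y else t (i + 2))" for j :: nat
  have "val i 2 q \<le> val i 2 (\<lambda>j. t (i + j))"
    by (rule optimal_local[OF opt i]) (use y in \<open>auto simp: ok_2 q_def\<close>)
  then show "phi (even i) (t i) y + phi (\<not> even i) y (t (i + 2))
      \<le> phi (even i) (t i) (t (i + 1)) + phi (\<not> even i) (t (i + 1)) (t (i + 2))"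
    by (simp add: val_2 q_def)
qed

text \<open>Two almost maximal gaps are better replaced by four equal ones, because the action is of cubic order
  in the gap.\<close>

lemma optimal_not_long:
  assumes opt: "optimal X n t" and i: "i + 2 \<le> n"
    and long: "9 / 2 * \<tau> \<le> ell (even i) (t i) (t (i + 1))" "9 / 2 * \<tau> \<le> ell (\<not> even i) (t (i + 1)) (t (i + 2))"
  shows False
proof -
  let ?b = "even i" and ?s = "t i" and ?x = "t (i + 1)" and ?z = "t (i + 2)"
  have ad: "adm ?b ?s ?x" "adm (\<not> ?b) ?x ?z" using optimal_opt3[OF opt i] by (auto simp: opt3_def)
  \<comment> \<open>The gap for which two equal pairs fill the same time; it lies between
    \<open>9 / 4 * \<tau>\<close> and \<open>5 / 2 * \<tau>\<close>, inside the constraint.\<close>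
  define l where "l = (?z - ?s) / (2 * \<kappa>)"
  have "9 / 2 * \<tau> * \<kappa> \<le> ?z - ?s" "?z - ?s \<le> 5 * \<tau> * \<kappa>"
    using pair_length[OF long(1) _ long(2)] pair_length[of _ ?b ?s ?x "5 * \<tau>" ?z] ad by (auto simp: adm_def)
  then have l: "9 / 4 * \<tau> \<le> l" "l \<le> 5 / 2 * \<tau>" using \<kappa>_pos by (auto simp: l_def field_simps)
  then have l': "\<tau> \<le> l" "l \<le> 5 * \<tau>" using \<tau>_pos by auto
  have z: "?z = ?s + l * \<kappa> + l * \<kappa>" using \<kappa>_pos by (simp add: l_def)
  define q where "q j = (if j = 0 then ?s else if j = 1 then ?s + l / a ?b else if j = 2 then ?s + l * \<kappa>
     else if j = 3 then ?s + l * \<kappa> + l / a ?b else ?z)" for j :: nat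
  have q: "q 0 = ?s" "q 1 = ?s + l / a ?b" "q 2 = ?s + l * \<kappa>" "q 3 = ?s + l * \<kappa> + l / a ?b" "q 4 = ?s + l * \<kappa> + l * \<kappa>"
    using z by (auto simp: q_def)
  note e1 = equal_pair[OF l', of ?b ?s] and e2 = equal_pair[OF l', of ?b "?s + l * \<kappa>"]
  have "val i 4 q \<le> val i 2 (\<lambda>j. t (i + j))"
    by (rule optimal_local[OF opt i]) (use e1 e2 z q in \<open>auto simp: ok_4\<close>)
  then have 1: "- (22 / 10 * (l ^ 3 * \<kappa> / 24)) - 2 * C \<le> phi ?b ?s ?x + phi (\<not> ?b) ?x ?z"
    using e1(3) e2(3) unfolding val_4 val_2 q by simp
  have "cost ?b (9 / 2 * \<tau>) \<le> cost ?b (ell ?b ?s ?x)" "cost (\<not> ?b) (9 / 2 * \<tau>) \<le> cost (\<not> ?b) (ell (\<not> ?b) ?x ?z)"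
    using long \<tau>_pos by (auto intro!: cost_mono)
  then have 2: "phi ?b ?s ?x + phi (\<not> ?b) ?x ?z \<le> - (9 / 10 * ((9 / 2 * \<tau>) ^ 3 * \<kappa> / 24))"
    unfolding cost_sum[of ?b, symmetric] distrib_left using phi_bounds(1)[OF ad(1)] phi_bounds(1)[OF ad(2)] by linarith
  have "l ^ 3 * \<kappa> \<le> (5 / 2 * \<tau>) ^ 3 * \<kappa>" using l l' \<tau>_pos \<kappa>_pos by (intro mult_right_mono power_mono) auto
  then have fin: "- (22 / 10 * ((5 / 2 * \<tau>) ^ 3 * \<kappa> / 24)) - 2 * C \<le> - (9 / 10 * ((9 / 2 * \<tau>) ^ 3 * \<kappa> / 24))"
    using 1 2 by linarith
  \<comment> \<open>In units of \<open>k\<close> the four arcs lose at most about 3.03, their two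
    extra payments of \<open>C\<close> included, while the two long ones lose at least about
    3.42.\<close>
  define k where "k = \<kappa> * \<tau> ^ 3"
  have eq: "(5 / 2 * \<tau>) ^ 3 * \<kappa> = 125 / 8 * k" "(9 / 2 * \<tau>) ^ 3 * \<kappa> = 729 / 8 * k" "C = 4 / 5 * k"
    by (auto simp: k_def C_def power_mult_distrib power_divide)
  have "0 < k" using \<kappa>_pos \<tau>_pos by (simp add: k_def)
  then show False using fin unfolding eq by simp
qed

text \<open>Four almost minimal gaps are better merged into two, because of the cost \<open>C\<close> per gap.\<close>

lemma optimal_not_short:
  assumes opt: "optimal X n t" and i: "i + 4 \<le> n"
    and short: "\<And>k. k < 4 \<Longrightarrow> ell (even (i + k)) (t (i + k)) (t (i + k + 1)) \<le> 7 / 5 * \<tau>"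
  shows False
proof -
  let ?b = "even i"
  have ok: "ok 0 n t" using opt by (simp add: optimal_def feasible_def)
  have S: "Suc (i + 3) = i + 4" "i + 3 = Suc (Suc (Suc i))" "Suc (Suc (Suc (Suc i))) = i + 4" by simp_all
  have ad: "adm ?b (t i) (t (i + 1))" "adm (\<not> ?b) (t (i + 1)) (t (i + 2))"
     "adm ?b (t (i + 2)) (t (i + 3))" "adm (\<not> ?b) (t (i + 3)) (t (i + 4))"
    using okD[OF ok, of i] okD[OF ok, of "i + 1"] okD[OF ok, of "i + 2"] okD[OF ok, of "i + 3"] i
    by (simp_all add: S)
  have sh: "ell ?b (t i) (t (i + 1)) \<le> 7 / 5 * \<tau>" "ell (\<not> ?b) (t (i + 1)) (t (i + 2)) \<le> 7 / 5 * \<tau>"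
     "ell ?b (t (i + 2)) (t (i + 3)) \<le> 7 / 5 * \<tau>" "ell (\<not> ?b) (t (i + 3)) (t (i + 4)) \<le> 7 / 5 * \<tau>"
    using short[of 0] short[of 1] short[of 2] short[of 3] by (simp_all add: S)
  \<comment> \<open>The gap for which a single equal pair fills the time of the four arcs; it lies
    between \<open>2 * \<tau>\<close> and \<open>14 / 5 * \<tau>\<close>.\<close>
  define l where "l = (t (i + 4) - t i) / \<kappa>"
  have "\<tau> * \<kappa> \<le> t (i + 2) - t i" "t (i + 2) - t i \<le> 7 / 5 * \<tau> * \<kappa>"
    using pair_length[of \<tau> ?b "t i" "t (i + 1)" "7 / 5 * \<tau>" "t (i + 2)"] ad sh by (auto simp: adm_def)
  moreover have "\<tau> * \<kappa> \<le> t (i + 4) - t (i + 2)" "t (i + 4) - t (i + 2) \<le> 7 / 5 * \<tau> * \<kappa>"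
    using pair_length[of \<tau> ?b "t (i + 2)" "t (i + 3)" "7 / 5 * \<tau>" "t (i + 4)"] ad sh by (auto simp: adm_def)
  ultimately have "2 * \<tau> * \<kappa> \<le> t (i + 4) - t i" "t (i + 4) - t i \<le> 14 / 5 * \<tau> * \<kappa>" by auto
  then have l: "2 * \<tau> \<le> l" "l \<le> 14 / 5 * \<tau>" using \<kappa>_pos by (auto simp: l_def field_simps)
  then have l': "\<tau> \<le> l" "l \<le> 5 * \<tau>" using \<tau>_pos by auto
  have z: "t (i + 4) = t i + l * \<kappa>" using \<kappa>_pos by (simp add: l_def)
  define q where "q j = (if j = 0 then t i else if j = 1 then t i + l / a ?b else t (i + 4))" for j :: nat
  have q: "q 0 = t i" "q 1 = t i + l / a ?b" "q 2 = t i + l * \<kappa>" using z by (auto simp: q_def)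
  note e = equal_pair[OF l', of ?b "t i"]
  have "val i 2 q \<le> val i 4 (\<lambda>j. t (i + j))"
    by (rule optimal_local[OF opt i]) (use e z q in \<open>auto simp: ok_2\<close>)
  \<comment> \<open>Zero suffices as upper bound for the four old actions: merging saves
    \<open>2 * C\<close>, which is 1.6 in units of \<open>\<kappa> * \<tau> ^ 3\<close>, while the
    new pair loses at most about 1.01.\<close>
  moreover have neg: "phi b s u \<le> 0" if "adm b s u" for b s u
    using phi_bounds(1)[OF that] cost_nonneg[of "ell b s u" b] that \<tau>_pos by (simp add: adm_def)
  ultimately have "- (11 / 10 * (l ^ 3 * \<kappa> / 24)) + 2 * C \<le> 0"
    using e(3) neg[OF ad(1)] neg[OF ad(2)] neg[OF ad(3)] neg[OF ad(4)] unfolding val_4 val_2 q by simp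
  moreover have "l ^ 3 * \<kappa> \<le> (14 / 5 * \<tau>) ^ 3 * \<kappa>" using l l' \<tau>_pos \<kappa>_pos by (intro mult_right_mono power_mono) auto
  moreover define k where "k = \<kappa> * \<tau> ^ 3"
  have "(14 / 5 * \<tau>) ^ 3 * \<kappa> = 2744 / 125 * k" "C = 4 / 5 * k"
    by (auto simp: k_def C_def power_mult_distrib power_divide)
  moreover have "0 < k" using \<kappa>_pos \<tau>_pos by (simp add: k_def)
  ultimately show False by simp
qed

text \<open>Unequal speeds force one of the two gaps to an extreme value, and by comparability the
  other is nearly extreme as well. Two long gaps can be split; two short ones spread shortness to
  four consecutive gaps, which can be merged.\<close>

lemma optimal_matching:
  assumes opt: "optimal X n t" and n: "4 \<le> n" and i: "i + 2 \<le> n"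
  shows "V (even i) (t i) (t (i + 1)) = W (\<not> even i) (t (i + 1)) (t (i + 2))"
proof (rule ccontr)
  assume ne: "\<not> ?thesis"
  define e where "e k = ell (even k) (t k) (t (k + 1))" for k
  have cmp: "9 / 10 * e k \<le> e (k + 1)" "9 / 10 * e (k + 1) \<le> e k" if "k + 2 \<le> n" for k
    using opt3_comparable[OF optimal_opt3[OF opt that]] by (auto simp: e_def)
  have e1: "e (i + 1) = ell (\<not> even i) (t (i + 1)) (t (i + 2))" by (simp add: e_def)
  have "e i = 5 * \<tau> \<or> e (i + 1) = 5 * \<tau> \<or> e i = \<tau> \<or> e (i + 1) = \<tau>"
    using ne opt3_boundary[OF optimal_opt3[OF opt i]] unfolding e1 e_def[of i] by linarith
  moreover have "\<not> (9 / 2 * \<tau> \<le> e i \<and> 9 / 2 * \<tau> \<le> e (i + 1))"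
    using optimal_not_long[OF opt i] unfolding e1 e_def[of i] by blast
  ultimately have s: "e i \<le> 10 / 9 * \<tau>" "e (i + 1) \<le> 10 / 9 * \<tau>"
    using cmp[OF i] \<tau>_pos by auto
  \<comment> \<open>A window of four gaps inside the chain that contains gaps \<open>i\<close> and
    \<open>i + 1\<close>. Every gap in it is at most two comparisons away from these, hence at most
    \<open>(10 / 9) ^ 3 * \<tau>\<close>, which is below \<open>7 / 5 * \<tau>\<close>.\<close>
  define j where "j = min i (n - 4)"
  have j: "j + 4 \<le> n" "i = j \<or> i = j + 1 \<or> i = j + 2" using n i by (auto simp: j_def)
  have S: "j + 3 = Suc (Suc (Suc j))" by simp
  note c = cmp[of j] cmp[of "j + 1"] cmp[of "j + 2"]
  have eb: "e j \<le> 7 / 5 * \<tau>" "e (j + 1) \<le> 7 / 5 * \<tau>" "e (j + 2) \<le> 7 / 5 * \<tau>" "e (j + 3) \<le> 7 / 5 * \<tau>"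
    using j c s \<tau>_pos by (auto simp: S)
  have "e (j + k) \<le> 7 / 5 * \<tau>" if "k < 4" for k
  proof -
    have "k = 0 \<or> k = 1 \<or> k = 2 \<or> k = 3" using that by linarith
    then show ?thesis using eb by auto
  qed
  then show False using optimal_not_short[OF opt j(1)] by (simp add: e_def)
qed

end

section \<open>Bi-infinite chains\<close>

context chain
begin

definition G where "G = 5 * \<tau> * \<kappa>"

lemma G_pos: "0 < G" using \<tau>_pos \<kappa>_pos by (simp add: G_def)

lemma feasible_exists: "\<exists>t. feasible (\<kappa> * \<tau> * real N) (2 * N) t"
proof -
  define X where "X = \<kappa> * \<tau> * real N"
  \<comment> \<open>All normalised gaps equal \<open>2 * \<tau>\<close>, so each of the
    \<open>N\<close> pairs takes the time \<open>2 * \<tau> * \<kappa>\<close>.\<close>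
  define t where "t i = - X + real (i div 2) * (2 * \<tau> * \<kappa>) + (if odd i then 2 * \<tau> / a True else 0)" for i
  have "adm (even (0 + i)) (t i) (t (Suc i))" for i
  proof (cases "even i")
    case True
    then have "t (Suc i) = t i + 2 * \<tau> / a True" by (simp add: t_def)
    then show ?thesis using equal_pair(1)[of "2 * \<tau>" True "t i"] True \<tau>_pos by simp
  next
    case False
    let ?s = "- X + real (i div 2) * (2 * \<tau> * \<kappa>)"
    have "Suc i div 2 = Suc (i div 2)" using False by simp
    then have "t (Suc i) = ?s + 2 * \<tau> * \<kappa>" "t i = ?s + 2 * \<tau> / a True"
      using False by (simp_all add: t_def algebra_simps)
    then show ?thesis using equal_pair(2)[of "2 * \<tau>" True ?s] False \<tau>_pos by simp
  qed
  then have "ok 0 (2 * N) t" by (simp add: ok_def)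
  moreover have "t 0 = - X" "t (2 * N) = X" by (simp_all add: t_def X_def)
  ultimately show ?thesis by (auto simp: feasible_def X_def)
qed

definition matched where
  "matched s i \<longleftrightarrow> adm (even i) (s i) (s (i + 1)) \<and> adm (\<not> even i) (s (i + 1)) (s (i + 2)) \<and>
     V (even i) (s i) (s (i + 1)) = W (\<not> even i) (s (i + 1)) (s (i + 2))" for s :: "int \<Rightarrow> real" and i :: int

text \<open>The growth bound is independent of \<open>M\<close>, so all segments lie in one compact
  product. It comes from renumbering a maximising chain so that a zero within \<open>2 * G\<close>
  of the origin gets index 0; the shift \<open>j\<close> is even in order to preserve the
  signs.\<close>

lemma matched_segment:
  fixes M :: nat
  shows "\<exists>s :: int \<Rightarrow> real. (\<forall>i. \<bar>s i\<bar> \<le> G * (\<bar>real_of_int i\<bar> + 2)) \<and> (\<forall>i. \<bar>i\<bar> \<le> int M \<longrightarrow> matched s i)"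
proof -
  \<comment> \<open>Gaps are at most \<open>G\<close>, so this length leaves at least
    \<open>M + 3\<close> arcs to the left of index \<open>j\<close> and \<open>M + 5\<close> to its
    right. It is also a multiple of \<open>\<kappa> * \<tau>\<close>, as
    \<open>feasible_exists\<close> requires.\<close>
  define X where "X = G * real (M + 5)"
  have "X = \<kappa> * \<tau> * real (5 * (M + 5))" by (simp add: X_def G_def)
  then obtain t0 where "feasible X (2 * (5 * (M + 5))) t0" using feasible_exists by metis
  then obtain n t where opt: "optimal X n t" by (rule optimal_exists)
  then have ok: "ok 0 n t" and t0: "t 0 = - X" and tn: "t n = X" and ev: "even n"
    by (auto simp: optimal_def feasible_def)
  have X_pos: "0 < X" using G_pos by (simp add: X_def)
  have up: "t j - t i \<le> G * real (j - i)" if "i \<le> j" "j \<le> n" for i j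
    using ok_gap_upper[OF ok that] by (simp add: G_def)
  define J where "J = {j. even j \<and> j \<le> n \<and> t j \<le> 0}"
  have J: "finite J" "J \<noteq> {}"
  proof -
    show "finite J" by (rule finite_subset[of _ "{..n}"]) (auto simp: J_def)
    have "0 \<in> J" using t0 X_pos by (simp add: J_def)
    then show "J \<noteq> {}" by blast
  qed
  define j where "j = Max J"
  have j: "even j" "j \<le> n" "t j \<le> 0" using Max_in[OF J] by (auto simp: J_def j_def)
  have "j \<noteq> n" using j tn X_pos by auto
  then have j2: "j + 2 \<le> n" using j(1,2) ev by (metis add_2_eq_Suc' even_Suc le_neq_implies_less less_eq_Suc_le order_le_less)
  have "j + 2 \<notin> J" using Max_ge[OF J(1), of "j + 2"] by (auto simp: j_def)
  then have "0 < t (j + 2)" using j j2 by (simp add: J_def)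
  then have tj: "- (2 * G) \<le> t j" using up[of j "j + 2"] j2 by simp
  have "X - 2 * G \<le> G * real j" using up[of 0 j] j tj t0 by simp
  then have "G * (real M + 3) \<le> G * real j" by (simp add: X_def algebra_simps)
  then have jM: "M + 3 \<le> j" using G_pos by simp
  have "X \<le> G * real (n - j)" using up[of j n] j tn by simp
  then have "G * real (M + 5) \<le> G * real (n - j)" by (simp add: X_def)
  then have nM: "M + 5 \<le> n - j" using G_pos by simp
  then have n4: "4 \<le> n" by simp
  define s where "s i = (if - int j \<le> i \<and> i \<le> int n - int j then t (nat (int j + i)) else 0)" for i
  have "\<bar>s i\<bar> \<le> G * (\<bar>real_of_int i\<bar> + 2)" for i
  proof (cases "- int j \<le> i \<and> i \<le> int n - int j")
    case True
    define k where "k = nat (int j + i)"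
    have k: "k \<le> n" "s i = t k" "int k = int j + i" using True by (auto simp: k_def s_def)
    show ?thesis
    proof (cases "j \<le> k")
      case True
      then have "t j \<le> t k" "t k - t j \<le> G * real (k - j)" using up[of j k] ok_mono[OF ok, of j k] k by auto
      moreover have "real (k - j) = \<bar>real_of_int i\<bar>" using True k(3) by simp
      ultimately have "t k \<le> G * \<bar>real_of_int i\<bar>" "- (2 * G) \<le> t k" using j(3) tj by auto
      moreover have "0 \<le> G * \<bar>real_of_int i\<bar>" using G_pos by simp
      ultimately have "\<bar>t k\<bar> \<le> G * \<bar>real_of_int i\<bar> + 2 * G" using G_pos by linarith
      then show ?thesis using k by (simp add: algebra_simps)
    next
      case False
      then have "t k \<le> t j" "t j - t k \<le> G * real (j - k)" using up[of k j] ok_mono[OF ok, of k j] j by auto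
      moreover have "real (j - k) = \<bar>real_of_int i\<bar>" using False k(3) by simp
      ultimately have "\<bar>t k\<bar> \<le> G * \<bar>real_of_int i\<bar> + 2 * G" using j(3) tj by simp
      then show ?thesis using k by (simp add: algebra_simps)
    qed
  next
    case False
    then have "s i = 0" unfolding s_def by (rule if_not_P)
    then show ?thesis using G_pos by simp
  qed
  moreover have "matched s i" if i: "\<bar>i\<bar> \<le> int M" for i
  proof -
    define k where "k = nat (int j + i)"
    have k: "int k = int j + i" using i jM by (simp add: k_def)
    then have k2: "k + 2 \<le> n" using i nM by linarith
    have par: "even k = even i" using k j(1) by (metis even_add even_of_nat)
    have sk: "s i = t k" "s (i + 1) = t (k + 1)" "s (i + 2) = t (k + 2)"
      using k k2 i jM nM by (auto simp: s_def nat_add_distrib algebra_simps intro!: arg_cong[of _ _ t])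
    have "opt3 (even k) (t k) (t (k + 1)) (t (k + 2))" by (rule optimal_opt3[OF opt k2])
    then show ?thesis
      using optimal_matching[OF opt n4 k2] unfolding matched_def sk opt3_def par by blast
  qed
  ultimately show ?thesis by blast
qed

text \<open>\<open>V\<close> and \<open>W\<close> are continuous where the gaps are admissible, so
  the equation is taken as a preimage relative to that closed set.\<close>

lemma closed_matched: "closed {s. matched s i}"
proof -
  let ?S = "{s. adm (even i) (s i) (s (i + 1))} \<inter> {s. adm (\<not> even i) (s (i + 1)) (s (i + 2))}"
  let ?f = "\<lambda>s. V (even i) (s i) (s (i + 1)) - W (\<not> even i) (s (i + 1)) (s (i + 2))"
  have "continuous_on ?S ?f"
    by (intro continuous_on_diff continuous_on_coordinate_pair V_cont W_cont) (auto simp: adm_def ell_def)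
  moreover have "closed ?S" by (intro closed_Int closed_adm)
  ultimately have "closed (?S \<inter> ?f -` {0})" by (intro continuous_closed_preimage) auto
  moreover have "?S \<inter> ?f -` {0} = {s. matched s i}" by (auto simp: matched_def)
  ultimately show ?thesis by simp
qed

text \<open>The limit of infinite length is taken by the finite intersection property: any finitely
  many matching conditions concern a bounded range of indices and are met by one segment.\<close>

theorem matched_sequence: "\<exists>s :: int \<Rightarrow> real. \<forall>i. matched s i"
proof -
  let ?K = "{s :: int \<Rightarrow> real. \<forall>i. - (G * (\<bar>real_of_int i\<bar> + 2)) \<le> s i \<and> s i \<le> G * (\<bar>real_of_int i\<bar> + 2)}"
  have "?K \<inter> \<Inter> (range (\<lambda>i. {s. matched s i})) \<noteq> {}"
  proof (rule compact_imp_fip)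
    show "compact ?K" by (rule compact_product_intervals)
    show "closed T" if "T \<in> range (\<lambda>i. {s. matched s i})" for T using that closed_matched by auto
    fix F assume F: "finite F" "F \<subseteq> range (\<lambda>i. {s. matched s i})"
    then obtain I where I: "finite I" "F = (\<lambda>i. {s. matched s i}) ` I" by (meson finite_subset_image)
    obtain M where M: "\<And>i. i \<in> I \<Longrightarrow> \<bar>i\<bar> \<le> int M"
    proof (cases "I = {}")
      case False
      show ?thesis
      proof (rule that[of "nat (Max (abs ` I))"])
        fix i assume "i \<in> I"
        then have "\<bar>i\<bar> \<le> Max (abs ` I)" using I by (intro Max_ge) auto
        then show "\<bar>i\<bar> \<le> int (nat (Max (abs ` I)))" by linarith
      qed
    qed (use that in auto)
    obtain s where s: "\<And>i. \<bar>s i\<bar> \<le> G * (\<bar>real_of_int i\<bar> + 2)" "\<And>i. \<bar>i\<bar> \<le> int M \<Longrightarrow> matched s i"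
      using matched_segment[of M] by blast
    have "s \<in> ?K" using s(1) by (simp add: abs_le_iff minus_le_iff)
    moreover have "s \<in> \<Inter> F" using s(2) M I by auto
    ultimately show "?K \<inter> \<Inter> F \<noteq> {}" by blast
  qed
  then show ?thesis by auto
qed

end

section \<open>Both signs\<close>

lemma strictly_concave_imp_convex_on:
  assumes "strictly_concave_on S g"
  shows "convex_on S (\<lambda>x. - g x)"
proof (rule convex_onI)
  show "convex S" using assms by (simp add: strictly_concave_on_def strictly_convex_on_def)
  fix l x y :: real assume lxy: "0 < l" "l < 1" "x \<in> S" "y \<in> S"
  show "- g ((1 - l) *\<^sub>R x + l *\<^sub>R y) \<le> (1 - l) * - g x + l * - g y"
  proof (cases "x = y")
    case True
    then show ?thesis by (simp add: algebra_simps)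
  next
    case False
    then have "- g ((1 - l) * x + l * y) < (1 - l) * - g x + l * - g y"
      using assms lxy unfolding strictly_concave_on_def strictly_convex_on_def by blast
    then show ?thesis by simp
  qed
qed

lemma concave_chord:
  fixes g :: "real \<Rightarrow> real"
  assumes c: "convex_on {0<..} (\<lambda>x. - g x)" and o: "0 < w" "w < z" "z \<le> x" "x < y"
  shows "(g y - g x) / (y - x) \<le> (g z - g w) / (z - w)"
proof -
  have "(- g w - - g z) / (w - z) \<le> (- g z - - g y) / (z - y)"
    using convex_on_slope_le[OF c, of w y z] o by force
  also have "\<dots> \<le> (- g x - - g y) / (x - y)"
  proof (cases "x = z")
    case False
    then show ?thesis using convex_on_slope_le(2)[OF c, of z y x] o by force
  qed simp
  finally have le: "(- g w - - g z) / (w - z) \<le> (- g x - - g y) / (x - y)" .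
  have "(- g w - - g z) / (w - z) = - ((g z - g w) / (z - w))" using o by (simp add: field_simps)
  moreover have "(- g x - - g y) / (x - y) = - ((g y - g x) / (y - x))" using o by (simp add: field_simps)
  ultimately show ?thesis using le by simp
qed

text \<open>Chord slopes of a concave function decrease, so beyond \<open>z\<close> the Lipschitz
  constant is at most the slope of the chord from \<open>z / 2\<close> to \<open>z\<close>.
  Multiplied by \<open>z\<close> this is \<open>2 * (g z - g (z / 2))\<close>, which tends to 0
  because \<open>g\<close> has a limit.\<close>

lemma half_problem_intro:
  fixes g p :: "real \<Rightarrow> real"
  assumes g_cont: "continuous_on UNIV g"
    and lip1: "\<And>x y. x \<in> {0..1} \<Longrightarrow> y \<in> {0..1} \<Longrightarrow> \<bar>g x - g y\<bar> \<le> L * \<bar>x - y\<bar>"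
    and mono: "strict_mono g" and g0: "g 0 = 0" and conc: "strictly_concave_on {0<..} g"
    and lim: "(g \<longlongrightarrow> gp) at_top" and p_cont: "continuous_on UNIV p" and p_bdd: "bounded (range p)"
    and avg: "has_asymptotic_average p A" and A: "A < gp"
  shows "\<exists>K P. half_problem g p gp A K P"
proof -
  note cv = strictly_concave_imp_convex_on[OF conc]
  have mono': "g x \<le> g y" if "x \<le> y" for x y using mono that by (simp add: strict_mono_less_eq)
  have le_gp: "g x \<le> gp" for x
    by (rule tendsto_lowerbound[OF lim]) (auto simp: eventually_at_top_linorder intro: exI[of _ x] mono')
  have slope: "\<bar>g y - g x\<bar> \<le> (g z - g w) / (z - w) * \<bar>y - x\<bar>"
    if "0 < w" "w < z" "z \<le> x" "z \<le> y" for w z x y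
  proof -
    have *: "\<bar>g y - g x\<bar> \<le> (g z - g w) / (z - w) * \<bar>y - x\<bar>" if "z \<le> x" "x < y" for x y
      using concave_chord[OF cv \<open>0 < w\<close> \<open>w < z\<close> that] mono'[of x y] that by (simp add: pos_divide_le_eq)
    show ?thesis using *[of x y] *[of y x] that by (cases x y rule: linorder_cases) (auto simp: abs_minus_commute)
  qed
  \<comment> \<open>Chords bound slopes only away from 0, since concavity is given on the open
    half-line: \<open>L\<close> covers \<open>{0..1}\<close>, and the chord from
    \<open>1 / 2\<close> to \<open>1\<close> covers the rest.\<close>
  define K where "K = max L (2 * (g 1 - g (1/2)))"
  obtain P where P: "\<And>x. \<bar>p x\<bar> \<le> P" using p_bdd by (auto simp: bounded_iff)
  have "half_problem g p gp A K P"
  proof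
    show "continuous_on UNIV g" "(g \<longlongrightarrow> gp) at_top" "continuous_on UNIV p" "A < gp" "\<And>x. \<bar>p x\<bar> \<le> P"
      by (fact g_cont lim p_cont A P)+
    show "0 \<le> g x \<and> g x \<le> gp" if "0 \<le> x" for x using mono'[OF that] le_gp g0 by auto
    show "\<bar>g x - g y\<bar> \<le> K * \<bar>x - y\<bar>" if xy: "0 \<le> x" "0 \<le> y" for x y
    proof -
      have small: "\<bar>g x - g y\<bar> \<le> K * \<bar>x - y\<bar>" if "x \<in> {0..1}" "y \<in> {0..1}" for x y
        using lip1[OF that] mult_right_mono[of L K "\<bar>x - y\<bar>"] by (simp add: K_def)
      have large: "\<bar>g x - g y\<bar> \<le> K * \<bar>x - y\<bar>" if "1 \<le> x" "1 \<le> y" for x y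
      proof -
        have "\<bar>g x - g y\<bar> \<le> 2 * (g 1 - g (1/2)) * \<bar>x - y\<bar>" using slope[of "1/2" 1 y x] that by (simp add: mult.commute)
        also have "\<dots> \<le> K * \<bar>x - y\<bar>" by (rule mult_right_mono) (simp_all add: K_def)
        finally show ?thesis .
      qed
      have mixed: "\<bar>g x - g y\<bar> \<le> K * \<bar>x - y\<bar>" if "0 \<le> x" "x \<le> 1" "1 \<le> y" for x y
      proof -
        have "\<bar>g x - g y\<bar> \<le> K * \<bar>x - 1\<bar> + K * \<bar>1 - y\<bar>"
          using small[of x 1] large[of 1 y] that by auto
        also have "\<dots> = K * (\<bar>x - 1\<bar> + \<bar>1 - y\<bar>)" by (simp add: distrib_left)
        also have "\<bar>x - 1\<bar> + \<bar>1 - y\<bar> = \<bar>x - y\<bar>" using that by simp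
        finally show ?thesis .
      qed
      show ?thesis
        using small[of x y] large[of x y] mixed[of x y] mixed[of y x] xy
        by (cases "x \<le> 1"; cases "y \<le> 1") (auto simp: abs_minus_commute)
    qed
    show "\<exists>Y>0. \<forall>z\<ge>Y. \<forall>x\<ge>z. \<forall>y\<ge>z. z * \<bar>g x - g y\<bar> \<le> \<eta> * \<bar>x - y\<bar>" if "0 < \<eta>" for \<eta>
    proof -
      have "\<forall>\<^sub>F z in at_top. dist (g z) gp < \<eta> / 2" using lim that by (intro tendstoD) auto
      then obtain Z where Z: "\<And>z. Z \<le> z \<Longrightarrow> \<bar>g z - gp\<bar> < \<eta> / 2"
        by (force simp: eventually_at_top_linorder dist_real_def)
      show ?thesis
      proof (intro exI[of _ "max 1 (2 * Z)"] conjI allI impI)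
        fix z x y assume z: "max 1 (2 * Z) \<le> z" and xy: "z \<le> x" "z \<le> y"
        have "\<bar>g x - g y\<bar> \<le> (g z - g (z / 2)) / (z - z / 2) * \<bar>x - y\<bar>" using slope[of "z / 2" z y x] z xy by simp
        then have "z * \<bar>g x - g y\<bar> \<le> z * ((g z - g (z / 2)) / (z - z / 2) * \<bar>x - y\<bar>)"
          using z by (intro mult_left_mono) auto
        also have "\<dots> = 2 * (g z - g (z / 2)) * \<bar>x - y\<bar>" using z by (simp add: field_simps)
        also have "\<dots> \<le> \<eta> * \<bar>x - y\<bar>"
        proof (rule mult_right_mono)
          have "\<bar>g (z / 2) - gp\<bar> < \<eta> / 2" by (rule Z) (use z in simp)
          then have "gp - g (z / 2) < \<eta> / 2" by linarith
          then show "2 * (g z - g (z / 2)) \<le> \<eta>" using le_gp[of z] by simp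
        qed simp
        finally show "z * \<bar>g x - g y\<bar> \<le> \<eta> * \<bar>x - y\<bar>" .
      qed simp
    qed
    show "\<exists>B. \<forall>x y. x \<le> y \<longrightarrow> \<bar>integral {x..y} p - A * (y - x)\<bar> \<le> \<eta> * (y - x) + B" if \<eta>: "0 < \<eta>" for \<eta>
    proof -
      have "\<forall>\<^sub>F T in at_top. \<forall>t\<in>UNIV. dist ((1 / T) * integral {t..t + T} p) A < \<eta>"
        using uniform_limitD[OF avg[unfolded has_asymptotic_average_def] \<eta>] .
      then obtain T0 where T0: "\<And>T t. T0 \<le> T \<Longrightarrow> \<bar>(1 / T) * integral {t..t + T} p - A\<bar> < \<eta>"
        by (auto simp: eventually_at_top_linorder dist_real_def)
      define T1 where "T1 = max 1 T0"
      show ?thesis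
      \<comment> \<open>The constant pays for intervals shorter than \<open>T1\<close>, where the
        means are not yet close to \<open>A\<close>.\<close>
      proof (intro exI[of _ "(P + \<bar>A\<bar>) * T1"] allI impI)
        fix x y :: real assume xy: "x \<le> y"
        have B0: "0 \<le> (P + \<bar>A\<bar>) * T1" using P[of 0] by (simp add: T1_def)
        show "\<bar>integral {x..y} p - A * (y - x)\<bar> \<le> \<eta> * (y - x) + (P + \<bar>A\<bar>) * T1"
        proof (cases "T1 \<le> y - x")
          case True
          then have pos: "0 < y - x" by (simp add: T1_def)
          have "\<bar>(1 / (y - x)) * integral {x..y} p - A\<bar> \<le> \<eta>" using T0[of "y - x" x] True by (simp add: T1_def)
          then have "(y - x) * \<bar>(1 / (y - x)) * integral {x..y} p - A\<bar> \<le> (y - x) * \<eta>" using pos by (intro mult_left_mono) auto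
          moreover have "(y - x) * \<bar>(1 / (y - x)) * integral {x..y} p - A\<bar> = \<bar>integral {x..y} p - A * (y - x)\<bar>"
          proof -
            have "integral {x..y} p - A * (y - x) = (y - x) * ((1 / (y - x)) * integral {x..y} p - A)"
              using pos by (simp add: right_diff_distrib mult.commute)
            then show ?thesis using pos by (simp only: abs_mult abs_of_pos)
          qed
          ultimately show ?thesis using B0 by (simp add: mult.commute)
        next
          case False
          have "\<bar>integral {x..y} p\<bar> \<le> P * (y - x)"
            using integral_bound[OF xy, of p P] continuous_on_subset[OF p_cont] P by auto
          moreover have "\<bar>A * (y - x)\<bar> = \<bar>A\<bar> * (y - x)" using xy by (simp add: abs_mult)
          ultimately have "\<bar>integral {x..y} p - A * (y - x)\<bar> \<le> (P + \<bar>A\<bar>) * (y - x)"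
            unfolding distrib_right by linarith
          also have "\<dots> \<le> (P + \<bar>A\<bar>) * T1" using False P[of 0] by (intro mult_left_mono) auto
          finally show ?thesis using \<eta> xy by (simp add: add_increasing)
        qed
      qed
    qed
  qed
  then show ?thesis by blast
qed

lemma C1_lipschitz_on_compact:
  fixes g :: "real \<Rightarrow> real"
  assumes "C2_real g"
  shows "\<exists>K. \<forall>x\<in>{a..b}. \<forall>y\<in>{a..b}. \<bar>g x - g y\<bar> \<le> K * \<bar>x - y\<bar>"
proof -
  have d: "(g has_real_derivative deriv g x) (at x within {a..b})" for x
    using assms
    by (intro has_field_derivative_at_within[OF DERIV_deriv_iff_real_differentiable[THEN iffD2]])
      (auto simp: C2_real_def differentiable_on_def)
  have "continuous_on {a..b} (deriv g)"
    using assms by (auto simp: C2_real_def intro: continuous_on_subset differentiable_imp_continuous_on)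
  then have "bounded (deriv g ` {a..b})" by (intro compact_imp_bounded compact_continuous_image) auto
  then obtain K where "\<And>x. x \<in> {a..b} \<Longrightarrow> norm (deriv g x) \<le> K" unfolding bounded_iff by blast
  then have "\<forall>x\<in>{a..b}. \<forall>y\<in>{a..b}. norm (g x - g y) \<le> K * norm (x - y)"
    using d by (intro ballI field_differentiable_bound[of "{a..b}" g "deriv g" K]) auto
  then show ?thesis by auto
qed

lemma half_problem_plus:
  fixes g p :: "real \<Rightarrow> real"
  assumes "C2_real g" "strict_mono g" "g 0 = 0" "strictly_concave_on {0<..} g"
    "(g \<longlongrightarrow> gp) at_top" "continuous_on UNIV p" "bounded (range p)"
    "has_asymptotic_average p A" "A < gp"
  shows "\<exists>K P. half_problem g p gp A K P"
proof -
  obtain K where "\<forall>x\<in>{0..1}. \<forall>y\<in>{0..1}. \<bar>g x - g y\<bar> \<le> K * \<bar>x - y\<bar>"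
    using C1_lipschitz_on_compact[OF assms(1)] by blast
  moreover have "continuous_on UNIV g"
    using assms(1) by (auto simp: C2_real_def intro: differentiable_imp_continuous_on)
  ultimately show ?thesis using assms by (intro half_problem_intro[where L=K]) auto
qed

lemma half_problem_minus:
  fixes g p :: "real \<Rightarrow> real"
  assumes C2: "C2_real g" and mono: "strict_mono g" and g0: "g 0 = 0" and conv: "strictly_convex_on {..<0} g"
    and lim: "(g \<longlongrightarrow> gm) at_bot" and p: "continuous_on UNIV p" "bounded (range p)"
    and avg: "has_asymptotic_average p A" and A: "gm < A"
  shows "\<exists>K P. half_problem (\<lambda>x. - g (- x)) (\<lambda>x. - p x) (- gm) (- A) K P"
proof -
  obtain K where K: "\<forall>x\<in>{-1..0}. \<forall>y\<in>{-1..0}. \<bar>g x - g y\<bar> \<le> K * \<bar>x - y\<bar>"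
    using C1_lipschitz_on_compact[OF C2] by blast
  have gc: "continuous_on UNIV g"
    using C2 by (auto simp: C2_real_def intro: differentiable_imp_continuous_on)
  show ?thesis
  proof (rule half_problem_intro[where L=K])
    show "continuous_on UNIV (\<lambda>x. - g (- x))"
      by (intro continuous_on_minus continuous_on_compose2[OF gc] continuous_intros) auto
    show "\<bar>- g (- x) - - g (- y)\<bar> \<le> K * \<bar>x - y\<bar>" if "x \<in> {0..1}" "y \<in> {0..1}" for x y
      using K[rule_format, of "- x" "- y"] that by (simp add: abs_minus_commute)
    show "strict_mono (\<lambda>x. - g (- x))" using mono by (simp add: strict_mono_def)
    show "- g (- 0) = 0" using g0 by simp
    have "g ((1 - l) * (- x) + l * (- y)) < (1 - l) * g (- x) + l * g (- y)"
      if "0 < x" "0 < y" "x \<noteq> y" "0 < l" "l < 1" for x y l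
      using conv[unfolded strictly_convex_on_def, THEN conjunct2, rule_format, of "- x" "- y" l] that by simp
    moreover have "(1 - l) * (- x) + l * (- y) = - ((1 - l) * x + l * y)" for x y l :: real by simp
    ultimately show "strictly_concave_on {0<..} (\<lambda>x. - g (- x))"
      by (auto simp: strictly_concave_on_def strictly_convex_on_def)
    show "((\<lambda>x. - g (- x)) \<longlongrightarrow> - gm) at_top"
      using lim by (intro tendsto_minus) (simp add: filterlim_at_bot_mirror)
    show "continuous_on UNIV (\<lambda>x. - p x)" by (intro continuous_on_minus p)
    show "bounded (range (\<lambda>x. - p x))" using p(2) by (auto simp: bounded_iff)
    have "uniform_limit UNIV (\<lambda>T t. - ((1 / T) * integral {t..t + T} p)) (\<lambda>_. - A) at_top"
      using avg unfolding has_asymptotic_average_def by (rule uniform_limit_uminus)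
    then show "has_asymptotic_average (\<lambda>x. - p x) (- A)" by (simp add: has_asymptotic_average_def)
    show "- A < - gm" using A by simp
  qed
qed

section \<open>Gluing\<close>

context
  fixes s :: "int \<Rightarrow> real" and \<delta> :: real
  assumes \<delta>: "0 < \<delta>" and gap: "\<And>i. \<delta> \<le> s (i + 1) - s i"
begin

lemma nodes_strict_mono: "i < j \<Longrightarrow> s i < s j"
proof (induction j rule: int_gr_induct)
  case base then show ?case using gap[of i] \<delta> by simp
next
  case (step j) then show ?case using gap[of j] \<delta> by simp
qed

lemma nodes_mono: "i \<le> j \<Longrightarrow> s i \<le> s j"
  using nodes_strict_mono[of i j] by (cases "i = j") auto

lemma nodes_growth: "s i + \<delta> * real n \<le> s (i + int n)"
proof (induction n)
  case (Suc n) then show ?case using gap[of "i + int n"] by (simp add: algebra_simps)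
qed simp

text \<open>A uniform gap sends the nodes to infinity in both directions. If no interval contained
  \<open>x\<close>, induction from a node to the left of \<open>x\<close> would keep all later nodes
  to its left.\<close>

lemma node_index_exists: "\<exists>i. s i \<le> x \<and> x < s (i + 1)"
proof (rule ccontr)
  assume no: "\<not> ?thesis"
  obtain n where n: "(s 0 - x) / \<delta> \<le> real n" using real_arch_simple by blast
  then have "s 0 - x \<le> \<delta> * real n" using \<delta> by (simp add: field_simps)
  then have low: "s (- int n) \<le> x" using nodes_growth[of "- int n" n] by simp
  have all: "s i \<le> x" if "- int n \<le> i" for i
    using that by (induction i rule: int_ge_induct) (use low no in \<open>auto simp: not_less\<close>)
  obtain m where m: "(x - s 0) / \<delta> < real m" using reals_Archimedean2 by blast
  then have "x - s 0 < \<delta> * real m" using \<delta> by (simp add: field_simps)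
  then show False using nodes_growth[of 0 m] all[of "int m"] by simp
qed

definition node_index where "node_index x = (SOME i. s i \<le> x \<and> x < s (i + 1))"

lemma node_index: "s (node_index x) \<le> x" "x < s (node_index x + 1)"
  unfolding node_index_def using someI_ex[OF node_index_exists[of x]] by auto

lemma node_index_eq:
  assumes "s i \<le> x" "x < s (i + 1)"
  shows "node_index x = i"
proof -
  have "\<not> i + 1 \<le> node_index x" using nodes_mono[of "i + 1" "node_index x"] node_index[of x] assms by auto
  moreover have "\<not> node_index x + 1 \<le> i" using nodes_mono[of "node_index x + 1" i] node_index[of x] assms by auto
  ultimately show ?thesis by simp
qed

text \<open>At the right end of an interval \<open>node_index\<close> already selects the next arc;
  matching values make the formula valid on the closed interval, as one-sided derivatives
  require.\<close>

lemma glued_eq: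
  assumes match: "\<And>i. y i (s (i + 1)) = y (i + 1) (s (i + 1))" and x: "x \<in> {s i..s (i + 1)}"
  shows "y (node_index x) x = y i x"
proof (cases "x = s (i + 1)")
  case True
  then have "node_index x = i + 1" using nodes_strict_mono[of "i + 1" "i + 1 + 1"] by (intro node_index_eq) auto
  then show ?thesis using match[of i] True by simp
qed (use x node_index_eq in auto)

text \<open>At a node the derivatives within the two adjacent intervals combine into a two-sided
  one. Values and slopes are arbitrary families, so the lemma serves for the solution and again for
  its derivative.\<close>

lemma glued_derivative:
  fixes y y' :: "int \<Rightarrow> real \<Rightarrow> real"
  assumes match: "\<And>i. y i (s (i + 1)) = y (i + 1) (s (i + 1))" "\<And>i. y' i (s (i + 1)) = y' (i + 1) (s (i + 1))"
    and d: "\<And>i x. x \<in> {s i..s (i + 1)} \<Longrightarrow> (y i has_real_derivative y' i x) (at x within {s i..s (i + 1)})"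
  shows "((\<lambda>x. y (node_index x) x) has_real_derivative y' (node_index x) x) (at x)"
proof -
  let ?u = "\<lambda>x. y (node_index x) x" and ?u' = "\<lambda>x. y' (node_index x) x"
  have d': "(?u has_real_derivative ?u' x) (at x within {s i..s (i + 1)})" if x: "x \<in> {s i..s (i + 1)}" for i x
    using has_derivative_transform[OF x _ d[OF x, unfolded has_field_derivative_def], of ?u]
      glued_eq[of y, OF match(1)] glued_eq[of y', OF match(2) x]
    unfolding has_field_derivative_def by auto
  define i where "i = node_index x"
  have i: "s i \<le> x" "x < s (i + 1)" using node_index by (auto simp: i_def)
  have s3: "s (i - 1) < s i" using nodes_strict_mono by simp
  show ?thesis
  proof (cases "x = s i")
    case True
    have "(?u has_real_derivative ?u' x) (at x within {s (i - 1)..s i})" using d'[of x "i - 1"] True s3 by simp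
    moreover have "(?u has_real_derivative ?u' x) (at x within {s i..s (i + 1)})" using d'[of x i] i by simp
    ultimately have "(?u has_real_derivative ?u' x) (at x within {s (i - 1)..s i} \<union> {s i..s (i + 1)})"
      unfolding has_field_derivative_iff unfolding at_within_union by (rule filterlim_sup)
    moreover have "{s (i - 1)..s i} \<union> {s i..s (i + 1)} = {s (i - 1)..s (i + 1)}" using i s3 True by auto
    ultimately show ?thesis using at_within_Icc_at[of "s (i - 1)" x "s (i + 1)"] i s3 True by simp
  next
    case False
    then show ?thesis using d'[of x i] at_within_Icc_at[of "s i" x "s (i + 1)"] i by simp
  qed
qed

end

text \<open>If a value exceeded the essential supremum, so would the values on a nonempty open set,
  which is not negligible.\<close>

lemma Linf_norm_ge:
  assumes u: "continuous_on UNIV u"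
  shows "ereal \<bar>u x\<bar> \<le> Linf_norm u"
proof (rule ccontr)
  assume "\<not> ?thesis"
  then have less: "Linf_norm u < ereal \<bar>u x\<bar>" by simp
  let ?S = "{t. Linf_norm u < ereal \<bar>u t\<bar>}"
  have "AE t in lebesgue. ereal \<bar>u t\<bar> \<le> Linf_norm u" unfolding Linf_norm_def by (rule esssup_AE)
  then have "AE t in lebesgue. t \<notin> ?S" by (auto elim: eventually_mono)
  moreover have "open ?S" by (intro open_Collect_less continuous_intros u continuous_on_ereal)
  moreover from this have "?S \<in> sets lebesgue" by simp
  ultimately have "open ?S" "negligible ?S" unfolding negligible_iff_null_sets by (simp_all add: AE_iff_null_sets)
  then show False using open_not_negligible[of ?S] less by auto
qed

lemma in_Linf_bounded:
  assumes u: "continuous_on UNIV u" and B: "\<And>x. \<bar>u x\<bar> \<le> B"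
  shows "in_Linf u"
proof -
  have m: "u \<in> borel_measurable lebesgue"
    using borel_measurable_continuous_onI[OF u] by (simp add: borel_measurable_if_I measurable_completion)
  have "Linf_norm u \<le> ereal B"
    unfolding Linf_norm_def using m B by (intro esssup_I) auto
  then show ?thesis using m by (auto simp: in_Linf_def)
qed

section \<open>Assembling an oscillating solution of prescribed size\<close>

lemma second_primitive_uminus:
  "second_primitive s t h y y' \<Longrightarrow> second_primitive s t (\<lambda>x. - h x) (\<lambda>x. - y x) (\<lambda>x. - y' x)"
  unfolding second_primitive_def by (auto intro!: derivative_intros)

lemma (in half_problem_T) large_gap:
  "\<exists>\<tau>>0. \<forall>s t. \<tau> \<le> a * (t - s) \<longrightarrow> T0 < t - s \<and>
     \<bar>V s t - a * (t - s) / 2\<bar> \<le> a * (t - s) / 100 \<and> \<bar>W s t - a * (t - s) / 2\<bar> \<le> a * (t - s) / 100 \<and>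
     \<bar>phi s t + (a * (t - s)) ^ 3 / (24 * a)\<bar> \<le> (a * (t - s)) ^ 3 / (24 * a) / 10"
proof -
  have "0 < a / 100" "0 < a\<^sup>2 / 240" using a_pos by auto
  from VW_asymptotic[OF this(1)] phi_asymptotic[OF this(2)] obtain T1 T2 where
    T1: "T0 \<le> T1" "\<forall>s t. T1 \<le> t - s \<longrightarrow> \<bar>V s t - a / 2 * (t - s)\<bar> \<le> a / 100 * (t - s) \<and> \<bar>W s t - a / 2 * (t - s)\<bar> \<le> a / 100 * (t - s)"
    and T2: "\<forall>s t. T2 \<le> t - s \<longrightarrow> \<bar>phi s t + a\<^sup>2 / 24 * (t - s) ^ 3\<bar> \<le> a\<^sup>2 / 240 * (t - s) ^ 3" by blast
  \<comment> \<open>The added 1 gives the strict inequality \<open>T0 < t - s\<close> needed for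
    differentiability of the action.\<close>
  define \<tau> where "\<tau> = a * (max T1 T2 + 1)"
  have "0 < \<tau>" using a_pos T1(1) T0_pos by (simp add: \<tau>_def max_def)
  moreover have "T0 < t - s \<and>
     \<bar>V s t - a * (t - s) / 2\<bar> \<le> a * (t - s) / 100 \<and> \<bar>W s t - a * (t - s) / 2\<bar> \<le> a * (t - s) / 100 \<and>
     \<bar>phi s t + (a * (t - s)) ^ 3 / (24 * a)\<bar> \<le> (a * (t - s)) ^ 3 / (24 * a) / 10" if "\<tau> \<le> a * (t - s)" for s t
  proof -
    have "max T1 T2 + 1 \<le> t - s" using that a_pos by (simp add: \<tau>_def)
    then have T: "T1 \<le> t - s" "T2 \<le> t - s" "T0 < t - s" using T1(1) by auto
    have eq: "(a * (t - s)) ^ 3 / (24 * a) = a\<^sup>2 / 24 * (t - s) ^ 3"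
      using a_pos by (simp add: power_mult_distrib power2_eq_square power3_eq_cube)
    show ?thesis unfolding eq using T1(2)[rule_format, OF T(1)] T2[rule_format, OF T(2)] T(3) by simp
  qed
  ultimately show ?thesis by blast
qed

lemma oscillating_solution:
  fixes g p :: "real \<Rightarrow> real" and R :: real
  assumes plus: "half_problem_T g p gp A K Pb T0"
    and minus: "half_problem_T (\<lambda>x. - g (- x)) (\<lambda>x. - p x) gm B K' Pb' T0'"
  shows "\<exists>u. is_global_solution g p u \<and> in_Linf u \<and> in_Linf (deriv u) \<and> ereal R \<le> Linf_norm u \<and> infinite {t. u t = 0}"
proof -
  interpret P: half_problem_T g p gp A K Pb T0 by (rule plus)
  interpret M: half_problem_T "\<lambda>x. - g (- x)" "\<lambda>x. - p x" gm B K' Pb' T0' by (rule minus)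
  define phi where "phi b = (if b then P.phi else M.phi)" for b
  define V where "V b = (if b then P.V else M.V)" for b
  define W where "W b = (if b then P.W else M.W)" for b
  define a where "a b = (if b then P.a else M.a)" for b
  obtain \<tau>p where \<tau>p: "0 < \<tau>p" "\<forall>s t. \<tau>p \<le> P.a * (t - s) \<longrightarrow> T0 < t - s \<and>
     \<bar>P.V s t - P.a * (t - s) / 2\<bar> \<le> P.a * (t - s) / 100 \<and> \<bar>P.W s t - P.a * (t - s) / 2\<bar> \<le> P.a * (t - s) / 100 \<and>
     \<bar>P.phi s t + (P.a * (t - s)) ^ 3 / (24 * P.a)\<bar> \<le> (P.a * (t - s)) ^ 3 / (24 * P.a) / 10"
    using P.large_gap by (elim exE conjE)
  obtain \<tau>m where \<tau>m: "0 < \<tau>m" "\<forall>s t. \<tau>m \<le> M.a * (t - s) \<longrightarrow> T0' < t - s \<and>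
     \<bar>M.V s t - M.a * (t - s) / 2\<bar> \<le> M.a * (t - s) / 100 \<and> \<bar>M.W s t - M.a * (t - s) / 2\<bar> \<le> M.a * (t - s) / 100 \<and>
     \<bar>M.phi s t + (M.a * (t - s)) ^ 3 / (24 * M.a)\<bar> \<le> (M.a * (t - s)) ^ 3 / (24 * M.a) / 10"
    using M.large_gap by (elim exE conjE)
  \<comment> \<open>At the midpoint of a positive arc the barrier is at least
    \<open>\<tau> * \<tau> / (16 * P.a)\<close>. The last two entries make this at least
    \<open>R\<close>, since \<open>\<tau> \<le> \<tau> * \<tau>\<close> for
    \<open>1 \<le> \<tau>\<close>.\<close>
  define \<tau> where "\<tau> = max (max \<tau>p \<tau>m) (max 1 (16 * P.a * R))"
  have gapp: "T0 < t - s \<and>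
     \<bar>P.V s t - P.a * (t - s) / 2\<bar> \<le> P.a * (t - s) / 100 \<and> \<bar>P.W s t - P.a * (t - s) / 2\<bar> \<le> P.a * (t - s) / 100 \<and>
     \<bar>P.phi s t + (P.a * (t - s)) ^ 3 / (24 * P.a)\<bar> \<le> (P.a * (t - s)) ^ 3 / (24 * P.a) / 10"
    if "\<tau> \<le> P.a * (t - s)" for s t
    using \<tau>p(2)[rule_format, of t s] that by (simp add: \<tau>_def)
  have gapm: "T0' < t - s \<and>
     \<bar>M.V s t - M.a * (t - s) / 2\<bar> \<le> M.a * (t - s) / 100 \<and> \<bar>M.W s t - M.a * (t - s) / 2\<bar> \<le> M.a * (t - s) / 100 \<and>
     \<bar>M.phi s t + (M.a * (t - s)) ^ 3 / (24 * M.a)\<bar> \<le> (M.a * (t - s)) ^ 3 / (24 * M.a) / 10"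
    if "\<tau> \<le> M.a * (t - s)" for s t
    using \<tau>m(2)[rule_format, of t s] that by (simp add: \<tau>_def)
  interpret C: chain phi V W a \<tau>
  proof
    show "0 < a b" for b using P.a_pos M.a_pos by (simp add: a_def)
    show "0 < \<tau>" by (simp add: \<tau>_def)
    have sp: "{x. \<tau> \<le> P.a * (snd x - fst x)} \<subseteq> {x. T0 \<le> snd x - fst x}" 
    proof
      fix x assume "x \<in> {x. \<tau> \<le> P.a * (snd x - fst x)}"
      then have "T0 < snd x - fst x" using gapp[of "snd x" "fst x"] by blast
      then show "x \<in> {x. T0 \<le> snd x - fst x}" by simp
    qed
    have sm: "{x. \<tau> \<le> M.a * (snd x - fst x)} \<subseteq> {x. T0' \<le> snd x - fst x}" 
    proof
      fix x assume "x \<in> {x. \<tau> \<le> M.a * (snd x - fst x)}"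
      then have "T0' < snd x - fst x" using gapm[of "snd x" "fst x"] by blast
      then show "x \<in> {x. T0' \<le> snd x - fst x}" by simp
    qed
    show "continuous_on {x. \<tau> \<le> a b * (snd x - fst x)} (\<lambda>x. phi b (fst x) (snd x))" for b
      using continuous_on_subset[OF P.phi_continuous sp] continuous_on_subset[OF M.phi_continuous sm]
      by (cases b) (simp_all add: a_def phi_def)
    show "continuous_on {x. \<tau> \<le> a b * (snd x - fst x)} (\<lambda>x. V b (fst x) (snd x))" for b
      using continuous_on_subset[OF P.V_continuous sp] continuous_on_subset[OF M.V_continuous sm]
      by (cases b) (simp_all add: a_def V_def)
    show "continuous_on {x. \<tau> \<le> a b * (snd x - fst x)} (\<lambda>x. W b (fst x) (snd x))" for b
      using continuous_on_subset[OF P.W_continuous sp] continuous_on_subset[OF M.W_continuous sm]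
      by (cases b) (simp_all add: a_def W_def)
    fix b s t assume st: "\<tau> \<le> a b * (t - s)"
    show "(phi b s has_real_derivative - (1 / 2 * (V b s t)\<^sup>2)) (at t)"
      using P.phi_DERIV_right[of t s] M.phi_DERIV_right[of t s] gapp[of t s] gapm[of t s] st
      by (cases b) (simp_all add: a_def phi_def V_def)
    show "((\<lambda>s. phi b s t) has_real_derivative 1 / 2 * (W b s t)\<^sup>2) (at s)"
      using P.phi_DERIV_left[of t s] M.phi_DERIV_left[of t s] gapp[of t s] gapm[of t s] st
      by (cases b) (simp_all add: a_def phi_def W_def)
    show "\<bar>V b s t - a b * (t - s) / 2\<bar> \<le> a b * (t - s) / 100"
      using gapp[of t s] gapm[of t s] st by (cases b) (simp_all add: a_def V_def)
    show "\<bar>W b s t - a b * (t - s) / 2\<bar> \<le> a b * (t - s) / 100"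
      using gapp[of t s] gapm[of t s] st by (cases b) (simp_all add: a_def W_def)
    show "\<bar>phi b s t + (a b * (t - s)) ^ 3 / (24 * a b)\<bar> \<le> (a b * (t - s)) ^ 3 / (24 * a b) / 10"
      using gapp[of t s] gapm[of t s] st by (cases b) (simp_all add: a_def phi_def)
  qed
  obtain s :: "int \<Rightarrow> real" where s: "\<And>i. C.matched s i" using C.matched_sequence by blast
  have ad: "C.adm (even i) (s i) (s (i + 1))" for i using s[of i] by (simp add: C.matched_def)
  have gmin: "C.gmin \<le> s (i + 1) - s i" for i
  proof -
    have "C.gmin \<le> \<tau> / a (even i)" by (cases "even i") (simp_all add: C.gmin_def)
    then show ?thesis using C.adm_gap(1)[OF ad[of i]] by linarith
  qed
  have Gmax: "s (i + 1) - s i \<le> C.G" for i using C.adm_gap(4)[OF ad[of i]] by (simp add: C.G_def)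
  have lt: "s i < s (i + 1)" for i using gmin[of i] C.gmin_pos by simp
  have evP: "T0 \<le> s (i + 1) - s i" if "even i" for i
    using gapp[of "s (i + 1)" "s i"] C.adm_ell[OF ad[of i]] that by (simp add: a_def)
  have odM: "T0' \<le> s (i + 1) - s i" if "odd i" for i
    using gapm[of "s (i + 1)" "s i"] C.adm_ell[OF ad[of i]] that by (simp add: a_def)
  define y where "y i = (if even i then P.U (s i) (s (i + 1)) else (\<lambda>x. - M.U (s i) (s (i + 1)) x))" for i
  define y' where "y' i = (if even i then P.U' (s i) (s (i + 1)) else (\<lambda>x. - M.U' (s i) (s (i + 1)) x))" for i
  have sp: "second_primitive (s i) (s (i + 1)) (\<lambda>x. p x - g (y i x)) (y i) (y' i)" for i
  proof (cases "even i")
    case True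
    then show ?thesis using P.sol_second_primitive[OF P.is_sol_U[OF evP]] by (simp add: y_def y'_def)
  next
    case False
    then show ?thesis
      using second_primitive_uminus[OF M.sol_second_primitive[OF M.is_sol_U[OF odM]], of i] by (simp add: y_def y'_def)
  qed
  have y0: "y i (s i) = 0" "y i (s (i + 1)) = 0" for i
    using P.sol_left[OF P.is_sol_U[OF evP]] P.sol_right[OF P.is_sol_U[OF evP]]
      M.sol_left[OF M.is_sol_U[OF odM]] M.sol_right[OF M.is_sol_U[OF odM]] by (simp_all add: y_def)
  have m0: "y i (s (i + 1)) = y (i + 1) (s (i + 1))" for i by (simp add: y0)
  \<comment> \<open>For even \<open>i\<close> the positive arc arrives with slope \<open>- V\<close>
    and the following negative arc departs with slope \<open>- W\<close>, by the sign in
    \<open>y'\<close>; for odd \<open>i\<close> both signs flip.\<close>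
  have m1: "y' i (s (i + 1)) = y' (i + 1) (s (i + 1))" for i
  proof -
    have "V (even i) (s i) (s (i + 1)) = W (\<not> even i) (s (i + 1)) (s (i + 2))"
      using s[of i] by (simp add: C.matched_def)
    then show ?thesis
      by (cases "even i") (simp_all add: V_def W_def y'_def P.V_def P.W_def M.V_def M.W_def add.assoc)
  qed
  \<comment> \<open>Neighbouring arcs vanish at their common node, so their second derivatives agree
    there. This allows the gluing lemma to be applied to \<open>u'\<close>.\<close>
  have m2: "p (s (i + 1)) - g (y i (s (i + 1))) = p (s (i + 1)) - g (y (i + 1) (s (i + 1)))" for i
    by (simp add: y0)
  let ?ix = "node_index s"
  note glue = glued_derivative[where s=s and \<delta>=C.gmin, OF C.gmin_pos gmin]
  note glue_eq = glued_eq[where s=s and \<delta>=C.gmin and y=y, OF C.gmin_pos gmin m0]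
  define u where "u x = y (?ix x) x" for x
  define u' where "u' x = y' (?ix x) x" for x
  have du: "(u has_real_derivative u' x) (at x)" for x
    unfolding u_def u'_def
    by (rule glue[of y y', OF m0 m1 second_primitiveD(1)[OF sp]])
  have du': "(u' has_real_derivative p x - g (u x)) (at x)" for x
    unfolding u_def u'_def
    by (rule glue[of y' "\<lambda>i x. p x - g (y i x)", OF m1 m2 second_primitiveD(2)[OF sp]])
  have deriv: "deriv u = u'" "deriv u' = (\<lambda>x. p x - g (u x))"
    using du du' by (auto intro!: DERIV_imp_deriv)
  have diff: "u differentiable_on UNIV" "u' differentiable_on UNIV"
    using du du' by (auto simp: differentiable_on_def real_differentiable_def)
  have ix: "x \<in> {s (?ix x)..s (?ix x + 1)}" for x
    using node_index[where s=s and \<delta>=C.gmin, OF C.gmin_pos gmin, of x] by auto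
  have bounds: "\<bar>y i x\<bar> \<le> P.F * C.G * C.G + M.F * C.G * C.G" "\<bar>y' i x\<bar> \<le> P.F * C.G + M.F * C.G"
    if x: "x \<in> {s i..s (i + 1)}" for i x
  proof -
    have G1: "P.F * (s (i + 1) - s i) \<le> P.F * C.G" "M.F * (s (i + 1) - s i) \<le> M.F * C.G"
      using Gmax P.F_nonneg M.F_nonneg by (auto intro!: mult_left_mono)
    have G2: "P.F * (s (i + 1) - s i) * (s (i + 1) - s i) \<le> P.F * C.G * C.G"
      "M.F * (s (i + 1) - s i) * (s (i + 1) - s i) \<le> M.F * C.G * C.G"
      using G1 Gmax[of i] lt[of i] P.F_nonneg M.F_nonneg C.G_pos by (auto intro!: mult_mono)
    have nn: "0 \<le> P.F * C.G" "0 \<le> M.F * C.G" "0 \<le> P.F * C.G * C.G" "0 \<le> M.F * C.G * C.G"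
      using P.F_nonneg M.F_nonneg C.G_pos by auto
    have "\<bar>y i x\<bar> \<le> P.F * C.G * C.G + M.F * C.G * C.G \<and> \<bar>y' i x\<bar> \<le> P.F * C.G + M.F * C.G"
    proof (cases "even i")
      case True
      from P.sol_bounds[OF P.is_sol_U[OF evP[OF True]] lt x] show ?thesis
        using G1 G2 nn True by (simp add: y_def y'_def)
    next
      case False
      from M.sol_bounds[OF M.is_sol_U[OF odM[OF False]] lt x] show ?thesis
        using G1 G2 nn False by (simp add: y_def y'_def)
    qed
    then show "\<bar>y i x\<bar> \<le> P.F * C.G * C.G + M.F * C.G * C.G" "\<bar>y' i x\<bar> \<le> P.F * C.G + M.F * C.G" by auto
  qed
  have cu: "continuous_on UNIV u" "continuous_on UNIV u'"
    using diff by (auto intro: differentiable_imp_continuous_on)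
  have "in_Linf u" by (rule in_Linf_bounded[OF cu(1)]) (use bounds(1) ix in \<open>auto simp: u_def\<close>)
  moreover have "in_Linf (deriv u)"
    unfolding deriv by (rule in_Linf_bounded[OF cu(2)]) (use bounds(2) ix in \<open>auto simp: u'_def\<close>)
  moreover have "is_global_solution g p u"
    using diff deriv by (simp add: is_global_solution_def)
  moreover have "ereal R \<le> Linf_norm u"
  proof -
    define x where "x = (s 0 + s 1) / 2"
    have x: "x \<in> {s 0..s (0 + 1)}" using lt[of 0] by (simp add: x_def)
    have "u x = y 0 x" unfolding u_def by (rule glue_eq[OF x])
    moreover have "P.a / 4 * ((x - s 0) * (s (0 + 1) - x)) \<le> y 0 x"
      using P.aboveD[OF P.sol_above[OF P.is_sol_U[OF evP[of 0]]] x] by (simp add: y_def)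
    moreover have "R \<le> P.a / 4 * ((x - s 0) * (s (0 + 1) - x))"
    proof -
      have h: "x - s 0 = (s 1 - s 0) / 2" "s (0 + 1) - x = (s 1 - s 0) / 2" by (simp_all add: x_def field_simps)
      have "\<tau> / P.a \<le> s 1 - s 0" using C.adm_gap(1)[OF ad[of 0]] by (simp add: a_def)
      then have "(\<tau> / P.a) * (\<tau> / P.a) \<le> (s 1 - s 0) * (s 1 - s 0)"
        using C.\<tau>_pos P.a_pos lt[of 0] by (intro mult_mono) auto
      then have "P.a / 16 * ((\<tau> / P.a) * (\<tau> / P.a)) \<le> P.a / 16 * ((s 1 - s 0) * (s 1 - s 0))"
        using P.a_pos by (intro mult_left_mono) auto
      moreover have "P.a / 16 * ((\<tau> / P.a) * (\<tau> / P.a)) = \<tau> * \<tau> / (16 * P.a)" using P.a_pos by (simp add: field_simps)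
      moreover have "R \<le> \<tau> * \<tau> / (16 * P.a)"
      proof -
        have "16 * P.a * R \<le> \<tau>" "1 \<le> \<tau>" by (simp_all add: \<tau>_def)
        moreover have "1 * \<tau> \<le> \<tau> * \<tau>" using \<open>1 \<le> \<tau>\<close> by (intro mult_right_mono) auto
        ultimately have "16 * P.a * R \<le> \<tau> * \<tau>" by linarith
        then show ?thesis using P.a_pos by (simp add: field_simps)
      qed
      ultimately show ?thesis unfolding h by simp
    qed
    ultimately have "R \<le> \<bar>u x\<bar>" by linarith
    then have "ereal R \<le> ereal \<bar>u x\<bar>" by simp
    also have "\<dots> \<le> Linf_norm u" by (rule Linf_norm_ge[OF cu(1)])
    finally show ?thesis .
  qed
  moreover have "infinite {t. u t = 0}"
  proof -
    have "inj s"
      using nodes_strict_mono[where s=s and \<delta>=C.gmin, OF C.gmin_pos gmin] by (intro injI) (metis linorder_neqE order_less_irrefl)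
    then have "infinite (range s)" using finite_imageD[of s UNIV] infinite_UNIV_int by blast
    moreover have "u (s i) = 0" for i
      unfolding u_def using glue_eq[of "s i" i] lt[of i] y0 by simp
    then have "range s \<subseteq> {t. u t = 0}" by auto
    ultimately show ?thesis using finite_subset by blast
  qed
  ultimately show ?thesis by blast
qed

theorem theorem2p1:
  fixes g p :: "real \<Rightarrow> real" and g_minus g_plus A :: real
  assumes "C2_real g"
    and "bounded (range g)"
    and "strict_mono g"
    and "g 0 = 0"
    and "strictly_concave_on {0<..} g"
    and "strictly_convex_on {..<0} g"
    and "(g \<longlongrightarrow> g_minus) at_bot"
    and "(g \<longlongrightarrow> g_plus) at_top"
    and "continuous_on UNIV p"
    and "bounded (range p)"
    and "has_asymptotic_average p A"
    and "g_minus < A"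
    and "A < g_plus"
  shows "\<exists>u :: nat \<Rightarrow> real \<Rightarrow> real.
    (\<forall>m. is_global_solution g p (u m) \<and> in_Linf (u m) \<and> in_Linf (deriv (u m))) \<and>
    ((\<lambda>m. Linf_norm (u m)) \<longlonglongrightarrow> \<infinity>) \<and>
    (\<forall>m. infinite {t. u m t = 0})"
proof -
  obtain K P where "half_problem g p g_plus A K P"
    using half_problem_plus[OF assms(1,3,4,5,8,9,10,11,13)] by blast
  then obtain T0 where plus: "half_problem_T g p g_plus A K P T0"
    using half_problem.half_problem_T_exists by blast
  obtain K' P' where "half_problem (\<lambda>x. - g (- x)) (\<lambda>x. - p x) (- g_minus) (- A) K' P'"
    using half_problem_minus[OF assms(1,3,4,6,7,9,10,11,12)] by blast
  then obtain T0' where minus: "half_problem_T (\<lambda>x. - g (- x)) (\<lambda>x. - p x) (- g_minus) (- A) K' P' T0'"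
    using half_problem.half_problem_T_exists by blast
  have "\<forall>m :: nat. \<exists>u. is_global_solution g p u \<and> in_Linf u \<and> in_Linf (deriv u) \<and>
      ereal (real m) \<le> Linf_norm u \<and> infinite {t. u t = 0}"
    using oscillating_solution[OF plus minus] by blast
  then obtain u where u: "\<And>m :: nat. is_global_solution g p (u m) \<and> in_Linf (u m) \<and> in_Linf (deriv (u m)) \<and>
      ereal (real m) \<le> Linf_norm (u m) \<and> infinite {t. u m t = 0}"
    by metis
  have "(\<lambda>m. Linf_norm (u m)) \<longlonglongrightarrow> \<infinity>"
    unfolding tendsto_PInfty
  proof
    fix r :: real
    obtain N :: nat where N: "r < real N" using reals_Archimedean2 by blast
    show "\<forall>\<^sub>F m in sequentially. ereal r < Linf_norm (u m)"
      unfolding eventually_sequentially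
    proof (intro exI[of _ N] allI impI)
      fix m assume "N \<le> m"
      then have "ereal r < ereal (real m)" using N by simp
      also have "\<dots> \<le> Linf_norm (u m)" using u by blast
      finally show "ereal r < Linf_norm (u m)" .
    qed
  qed
  then show ?thesis using u by blast
qed

end
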